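(* Let $r\ge 0$, let $d\ge 1$ be an integer, let $C=C([-r,0],\mathbb{R}^d)$ with the supremum norm, and let $L\colon[0,\infty)\to\mathcal{L}(C,\mathbb{R}^d)$ be continuous (with respect to the operator norm). Consider the linear delay differential equation $$x'(t)=L(t)x_t .\qquad (\ast)$$ Suppose that $$\sup_{t\ge 0}\|L(t)\|<\infty .$$ Then the following statements are equivalent: (i) equation $(\ast)$ is Hyers--Ulam stable; (ii) equation $(\ast)$ is shadowable; (iii) equation $(\ast)$ admits an exponential dichotomy.
   Context: Setting. $|\cdot|$ is any fixed norm on $\mathbb{R}^d$; $C=C([-r,0],\mathbb{R}^d)$ is the Banach space of continuous maps $\phi\colon[-r,0]\to\mathbb{R}^d$ with norm $\|\phi\|=\sup_{\theta\in[-r,0]}|\phi(\theta)|$; $\mathcal{L}(C,\mathbb{R}^d)$ is the space of bounded linear operators from $C$ to $\mathbb{R}^d$ with the operator norm. For a continuous $\mathbb{R}^d$-valued function $x$ defined on $[t-r,t]$, $x_t\in C$ is defined by $x_t(\theta)=x(t+\theta)$, $\theta\in[-r,0]$. Solutions. For $s\ge 0$, a solution of $(\ast)$ on $[s,\infty)$ is a continuous function $x\colon[s-r,\infty)\to\mathbb{R}^d$ which is differentiable on $[s,\infty)$ (right-hand derivative at $t=s$) and satisfies $x'(t)=L(t)x_t$ for all $t\ge s$. For every $s\ge0$ and $\phi\in C$ there is a unique solution $x$ on $[s,\infty)$ with $x_s=\phi$. For $t\ge s\ge 0$ the solution operator $T(t,s)\colon C\to C$ is defined by $T(t,s)\phi=x_t$,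 where $x$ is the unique solution on $[s,\infty)$ with $x_s=\phi$. Hyers--Ulam stable. Equation $(\ast)$ is Hyers--Ulam stable if there exists $\kappa>0$ such that for each $\delta>0$ and each continuous function $y\colon[-r,\infty)\to\mathbb{R}^d$ which is continuously differentiable on $[0,\infty)$ and satisfies $\sup_{t\ge 0}|y'(t)-L(t)y_t|\le\delta$, there exists a solution $x$ of $(\ast)$ on $[0,\infty)$ with $\sup_{t\ge 0}\|x_t-y_t\|\le\kappa\delta$. Shadowable. Equation $(\ast)$ is shadowable if for each $\varepsilon>0$ there exists $\delta>0$ such that for each continuous function $y\colon[-r,\infty)\to\mathbb{R}^d$ which is continuously differentiable on $[0,\infty)$ and satisfies $\sup_{t\ge 0}|y'(t)-L(t)y_t|\le\delta$, there exists a solution $x$ of $(\ast)$ on $[0,\infty)$ with $\sup_{t\ge 0}\|x_t-y_t\|\le\varepsilon$. Exponential dichotomy. Equation $(\ast)$ admits an exponential dichotomy if there exist a family $(P(t))_{t\ge 0}$ of projections on $C$ (bounded linear operators with $P(t)^2=P(t)$) and constants $D,\lambda>0$ such that: (1) for all $t\ge s\ge 0$, $P(t)T(t,s)=T(t,s)P(s)$, and the restriction $T(t,s)|_{\operatorname{Ker}P(s)}\colon\operatorname{Ker}P(s)\to\operatorname{Ker}P(t)$ is onto and invertible; (2) for all $t\ge s\ge 0$, $\|T(t,s)P(s)\|\le De^{-\lambda(t-s)}$; (3) for all $0\le t\le s$, $\|T(t,s)Q(s)\|\le De^{-\lambda(s-t)}$, where $Q(s)=\mathrm{Id}-P(s)$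 and, for $0\le t\le s$, $T(t,s):=\bigl(T(s,t)|_{\operatorname{Ker}P(t)}\bigr)^{-1}\colon\operatorname{Ker}P(s)\to\operatorname{Ker}P(t)$. *)

theory Defs
  imports "HOL-Analysis.Analysis"
begin

definition is_norm :: "(real ^ 'n \<Rightarrow> real) \<Rightarrow> bool" where
  "is_norm N \<longleftrightarrow>
     (\<forall>v. N v = 0 \<longleftrightarrow> v = 0) \<and>
     (\<forall>c v. N (c *\<^sub>R v) = \<bar>c\<bar> * N v) \<and>
     (\<forall>v w. N (v + w) \<le> N v + N w)"

(* C([-r,0], R^d). The interval depends on the term r, so the space is a carrier set inside a
   function type; the value 0 outside [-r,0] makes HOL equality agree with equality in the space
   and keeps the carrier closed under pointwise operations. *)
definition hist_space :: "real \<Rightarrow> (real \<Rightarrow> real ^ 'n) set" where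
  "hist_space r = {\<phi>. continuous_on {-r..0} \<phi> \<and> (\<forall>\<theta>. \<theta> \<notin> {-r..0} \<longrightarrow> \<phi> \<theta> = 0)}"

definition hist_norm :: "(real ^ 'n \<Rightarrow> real) \<Rightarrow> real \<Rightarrow> (real \<Rightarrow> real ^ 'n) \<Rightarrow> real" where
  "hist_norm N r \<phi> = (SUP \<theta>\<in>{-r..0}. N (\<phi> \<theta>))"

definition segment :: "real \<Rightarrow> (real \<Rightarrow> real ^ 'n) \<Rightarrow> real \<Rightarrow> (real \<Rightarrow> real ^ 'n)" where
  "segment r x t = (\<lambda>\<theta>. if \<theta> \<in> {-r..0} then x (t + \<theta>) else 0)"

(* M is the norm of the codomain. Extended-real valued, so that an upper bound on the operator
   norm includes the claim that the operator is bounded. *)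
definition op_norm ::
  "(real ^ 'n \<Rightarrow> real) \<Rightarrow> real \<Rightarrow> ('b \<Rightarrow> real) \<Rightarrow> ((real \<Rightarrow> real ^ 'n) \<Rightarrow> 'b) \<Rightarrow> ereal" where
  "op_norm N r M A = (SUP \<phi>\<in>{\<phi> \<in> hist_space r. hist_norm N r \<phi> \<le> 1}. ereal (M (A \<phi>)))"

definition bounded_linear_to_vec ::
  "(real ^ 'n \<Rightarrow> real) \<Rightarrow> real \<Rightarrow> ((real \<Rightarrow> real ^ 'n) \<Rightarrow> real ^ 'n) \<Rightarrow> bool" where
  "bounded_linear_to_vec N r A \<longleftrightarrow>
     (\<forall>\<phi>\<in>hist_space r. \<forall>\<psi>\<in>hist_space r. A (\<lambda>\<theta>. \<phi> \<theta> + \<psi> \<theta>) = A \<phi> + A \<psi>) \<and>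
     (\<forall>c. \<forall>\<phi>\<in>hist_space r. A (\<lambda>\<theta>. c *\<^sub>R \<phi> \<theta>) = c *\<^sub>R A \<phi>) \<and>
     (\<exists>K. \<forall>\<phi>\<in>hist_space r. N (A \<phi>) \<le> K * hist_norm N r \<phi>)"

definition bounded_linear_to_hist ::
  "(real ^ 'n \<Rightarrow> real) \<Rightarrow> real \<Rightarrow> ((real \<Rightarrow> real ^ 'n) \<Rightarrow> (real \<Rightarrow> real ^ 'n)) \<Rightarrow> bool" where
  "bounded_linear_to_hist N r A \<longleftrightarrow>
     A ` hist_space r \<subseteq> hist_space r \<and>
     (\<forall>\<phi>\<in>hist_space r. \<forall>\<psi>\<in>hist_space r.
        A (\<lambda>\<theta>. \<phi> \<theta> + \<psi> \<theta>) = (\<lambda>\<theta>. A \<phi> \<theta> + A \<psi> \<theta>)) \<and>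
     (\<forall>c. \<forall>\<phi>\<in>hist_space r. A (\<lambda>\<theta>. c *\<^sub>R \<phi> \<theta>) = (\<lambda>\<theta>. c *\<^sub>R A \<phi> \<theta>)) \<and>
     (\<exists>K. \<forall>\<phi>\<in>hist_space r. hist_norm N r (A \<phi>) \<le> K * hist_norm N r \<phi>)"

definition hist_projection ::
  "(real ^ 'n \<Rightarrow> real) \<Rightarrow> real \<Rightarrow> ((real \<Rightarrow> real ^ 'n) \<Rightarrow> (real \<Rightarrow> real ^ 'n)) \<Rightarrow> bool" where
  "hist_projection N r P \<longleftrightarrow>
     bounded_linear_to_hist N r P \<and> (\<forall>\<phi>\<in>hist_space r. P (P \<phi>) = P \<phi>)"

definition hist_ker ::
  "real \<Rightarrow> ((real \<Rightarrow> real ^ 'n) \<Rightarrow> (real \<Rightarrow> real ^ 'n)) \<Rightarrow> (real \<Rightarrow> real ^ 'n) set" where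
  "hist_ker r A = {\<phi> \<in> hist_space r. A \<phi> = (\<lambda>\<theta>. 0)}"

definition continuous_in_op_norm ::
  "(real ^ 'n \<Rightarrow> real) \<Rightarrow> real \<Rightarrow> (real \<Rightarrow> (real \<Rightarrow> real ^ 'n) \<Rightarrow> real ^ 'n) \<Rightarrow> bool" where
  "continuous_in_op_norm N r L \<longleftrightarrow>
     (\<forall>t\<ge>0. ((\<lambda>s. op_norm N r N (\<lambda>\<phi>. L s \<phi> - L t \<phi>)) \<longlongrightarrow> 0) (at t within {0..}))"

definition dde_solution ::
  "real \<Rightarrow> (real \<Rightarrow> (real \<Rightarrow> real ^ 'n) \<Rightarrow> real ^ 'n) \<Rightarrow> real \<Rightarrow> (real \<Rightarrow> real ^ 'n) \<Rightarrow> bool" where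
  "dde_solution r L s x \<longleftrightarrow>
     continuous_on {s - r..} x \<and>
     (\<forall>t\<ge>s. (x has_vector_derivative L t (segment r x t)) (at t within {s..}))"

(* x itself is determined only on [s-r,\<infinity>), hence the description of the segment x_t rather
   than of x. *)
definition sol_op ::
  "real \<Rightarrow> (real \<Rightarrow> (real \<Rightarrow> real ^ 'n) \<Rightarrow> real ^ 'n) \<Rightarrow> real \<Rightarrow> real \<Rightarrow>
     (real \<Rightarrow> real ^ 'n) \<Rightarrow> (real \<Rightarrow> real ^ 'n)" where
  "sol_op r L t s \<phi> =
     (THE \<psi>. \<exists>x. dde_solution r L s x \<and> segment r x s = \<phi> \<and> \<psi> = segment r x t)"

definition approx_solution ::
  "(real ^ 'n \<Rightarrow> real) \<Rightarrow> real \<Rightarrow> (real \<Rightarrow> (real \<Rightarrow> real ^ 'n) \<Rightarrow> real ^ 'n) \<Rightarrow> real \<Rightarrow>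
     (real \<Rightarrow> real ^ 'n) \<Rightarrow> bool" where
  "approx_solution N r L \<delta> y \<longleftrightarrow>
     continuous_on {-r..} y \<and>
     (\<exists>y'. continuous_on {0..} y' \<and>
           (\<forall>t\<ge>0. (y has_vector_derivative y' t) (at t within {0..})) \<and>
           (SUP t\<in>{0..}. ereal (N (y' t - L t (segment r y t)))) \<le> ereal \<delta>)"

definition sup_dist ::
  "(real ^ 'n \<Rightarrow> real) \<Rightarrow> real \<Rightarrow> (real \<Rightarrow> real ^ 'n) \<Rightarrow> (real \<Rightarrow> real ^ 'n) \<Rightarrow> ereal" where
  "sup_dist N r x y =
     (SUP t\<in>{0..}. ereal (hist_norm N r (\<lambda>\<theta>. segment r x t \<theta> - segment r y t \<theta>)))"

definition hyers_ulam_stable ::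
  "(real ^ 'n \<Rightarrow> real) \<Rightarrow> real \<Rightarrow> (real \<Rightarrow> (real \<Rightarrow> real ^ 'n) \<Rightarrow> real ^ 'n) \<Rightarrow> bool" where
  "hyers_ulam_stable N r L \<longleftrightarrow>
     (\<exists>\<kappa>>0. \<forall>\<delta>>0. \<forall>y. approx_solution N r L \<delta> y \<longrightarrow>
        (\<exists>x. dde_solution r L 0 x \<and> sup_dist N r x y \<le> ereal (\<kappa> * \<delta>)))"

definition shadowable ::
  "(real ^ 'n \<Rightarrow> real) \<Rightarrow> real \<Rightarrow> (real \<Rightarrow> (real \<Rightarrow> real ^ 'n) \<Rightarrow> real ^ 'n) \<Rightarrow> bool" where
  "shadowable N r L \<longleftrightarrow>
     (\<forall>\<epsilon>>0. \<exists>\<delta>>0. \<forall>y. approx_solution N r L \<delta> y \<longrightarrow>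
        (\<exists>x. dde_solution r L 0 x \<and> sup_dist N r x y \<le> ereal \<epsilon>))"

(* In the last conjunct inv_into is the inverse of T(s,t) : Ker P(t) \<rightarrow> Ker P(s), applied to
   Q(s)\<phi>, which lies in Ker P(s). *)
definition exponential_dichotomy ::
  "(real ^ 'n \<Rightarrow> real) \<Rightarrow> real \<Rightarrow> (real \<Rightarrow> (real \<Rightarrow> real ^ 'n) \<Rightarrow> real ^ 'n) \<Rightarrow> bool" where
  "exponential_dichotomy N r L \<longleftrightarrow>
     (\<exists>P D \<mu>. D > 0 \<and> \<mu> > 0 \<and>
        (\<forall>t\<ge>0. hist_projection N r (P t)) \<and>
        (\<forall>s\<ge>0. \<forall>t\<ge>s.
           (\<forall>\<phi>\<in>hist_space r. P t (sol_op r L t s \<phi>) = sol_op r L t s (P s \<phi>)) \<and>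
           bij_betw (sol_op r L t s) (hist_ker r (P s)) (hist_ker r (P t))) \<and>
        (\<forall>s\<ge>0. \<forall>t\<ge>s.
           op_norm N r (hist_norm N r) (\<lambda>\<phi>. sol_op r L t s (P s \<phi>))
             \<le> ereal (D * exp (- \<mu> * (t - s)))) \<and>
        (\<forall>t\<ge>0. \<forall>s\<ge>t.
           op_norm N r (hist_norm N r)
               (\<lambda>\<phi>. inv_into (hist_ker r (P t)) (sol_op r L s t) (\<lambda>\<theta>. \<phi> \<theta> - P s \<phi> \<theta>))
             \<le> ereal (D * exp (- \<mu> * (s - t)))))"

end

theory Submission
  imports Defs "HOL-Complex_Analysis.Great_Picard"
begin

text \<open>
  By constant extension, the history space embeds into the Banach space of bounded continuous
  functions on the line, where the delay equation generates an evolution family that is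
  compact over time steps of length at least \<open>r\<close>. By scaling, Hyers--Ulam stability and shadowability
  both say that approximate solutions with residual at most 1 are shadowed within a fixed distance.

  Shadowing implies dichotomy: gluing orbits with a smooth cutoff turns a sequence of impulses
  \<open>e\<^sub>k\<close> in the history space into an approximate solution whose residual does not depend on the number
  of impulses, so the response to bounded impulses can be made bounded by an orbit correction. A single
  impulse combined with compactness shows that the initial values of bounded orbits have a finite-dimensional
  complement \<open>Z\<close>, and requiring the correction to start in \<open>Z\<close> makes it unique. This yields the
  projections; feeding an orbit back as impulses yields \<open>n \<bar>x\<bar> \<le> const\<close> after \<open>n\<close> steps, hence
  exponential decay forward on bounded orbits and backward on orbits from \<open>Z\<close>.

  Dichotomy implies shadowing: an approximate solution sampled at integer times is a pseudo-orbit of the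
  evolution operators, which the Green function of the dichotomy corrects to an exact orbit; Gronwall's
  inequality controls the times in between. No variation-of-constants formula is needed.
\<close>

section \<open>Finite-codimensional splittings\<close>

text \<open>Two obstacles shape the first direction. A residual takes values in R^d, whereas a
  dichotomy needs the response to arbitrary impulses in the history space; switching an orbit on by
  a cutoff realises such an impulse within time r + 1, when the cutoff has left the delay window,
  and this fixes the step h = r + 1. And the evolution cannot be run backward, so the unstable
  component of a state is always represented by its initial value in \<open>Z\<close>; invertibility
  on the kernels then comes almost for free. Boundedness of the projections rests on no closed graph
  argument: shadowing within a fixed distance gives one constant for impulse trains of any length,
  and such a constant survives the passage to \<open>Z\<close> because the finitely many generators
  have controlled coefficients. Uniqueness of the response starting in \<open>Z\<close> turns mere
  boundedness into the bound \<open>K\<close> times the size of the impulses. Applied to n copies of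
  an orbit it gives n x <= K^2 y, so n >= 2 K^2 steps halve the orbit.\<close>

lemma geometric_decomposition:
  fixes A :: "'i \<Rightarrow> 'a::real_normed_vector \<Rightarrow> 'b::real_normed_vector"
  assumes fin: "finite F"
    and lin: "\<And>i. i \<in> I \<Longrightarrow> bounded_linear (A i)"
    and step: "\<And>v. norm v \<le> 1 \<Longrightarrow>
      \<exists>f\<in>F. \<exists>w. norm w \<le> 1 \<and> (\<forall>i\<in>I. norm (A i (v + f - (1/2) *\<^sub>R w)) \<le> K)"
    and v: "norm v \<le> 1"
  shows "\<exists>c. (\<forall>f\<in>F. \<bar>c f\<bar> \<le> 2) \<and> (\<forall>i\<in>I. norm (A i (v + (\<Sum>f\<in>F. c f *\<^sub>R f))) \<le> 2 * K)"
proof -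
  have "\<exists>f w. norm v \<le> 1 \<longrightarrow> f \<in> F \<and> norm w \<le> 1 \<and>
          (\<forall>i\<in>I. norm (A i (v + f - (1/2) *\<^sub>R w)) \<le> K)" for v
    using step[of v] by blast
  then obtain f w where fw: "\<And>v. norm v \<le> 1 \<Longrightarrow> f v \<in> F \<and> norm (w v) \<le> 1 \<and>
          (\<forall>i\<in>I. norm (A i (v + f v - (1/2) *\<^sub>R w v)) \<le> K)"
    by metis
  \<comment> \<open>Up to an element of \<open>F\<close> and an error with bounded images, each
    iterate x_j is half of the next one.\<close>
  define x where "x j = (w ^^ j) v" for j
  have x1: "norm (x j) \<le> 1" for j
    by (induction j) (use v fw in \<open>auto simp: x_def\<close>)
  have xS: "x (Suc j) = w (x j)" for j by (simp add: x_def)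
  \<comment> \<open>The weight (1/2)^j is credited to the generator chosen at step j. As
    \<open>F\<close> is finite, only scalar series have to converge.\<close>
  define c where "c g j = (if f (x j) = g then (1/2)^j else (0::real))" for g j
  have c_le: "\<bar>c g j\<bar> \<le> (1/2)^j" for g j by (simp add: c_def)
  have geo: "summable (\<lambda>j. (1/2::real)^j)" by (rule summable_geometric) simp
  have summ: "summable (c g)" for g
    by (rule summable_comparison_test'[OF geo, of 0]) (use c_le in simp)
  define d where "d g = suminf (c g)" for g
  have d: "\<bar>d g\<bar> \<le> 2" for g
  proof -
    have s: "summable (\<lambda>j. norm (c g j))"
      by (rule summable_comparison_test'[OF geo, of 0]) (use c_le in simp)
    have "norm (d g) \<le> (\<Sum>j. norm (c g j))" unfolding d_def by (rule summable_norm[OF s])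
    also have "\<dots> \<le> (\<Sum>j. (1/2::real)^j)" by (rule suminf_le[OF _ s geo]) (use c_le in simp)
    also have "\<dots> = 2" by (subst suminf_geometric) auto
    finally show ?thesis by simp
  qed
  \<comment> \<open>The weighted sum of the errors. Its terms have images bounded by (1/2)^j K, and
    it telescopes to v plus a combination of \<open>F\<close>.\<close>
  define S where "S n = (\<Sum>j<n. (1/2)^j *\<^sub>R (x j + f (x j) - (1/2) *\<^sub>R x (Suc j)))" for n
  have S_eq: "S n = v - (1/2)^n *\<^sub>R x n + (\<Sum>g\<in>F. (\<Sum>j<n. c g j) *\<^sub>R g)" for n
  proof (induction n)
    case 0
    show ?case by (simp add: S_def x_def)
  next
    case (Suc n)
    have "(\<Sum>g\<in>F. c g n *\<^sub>R g) = (\<Sum>g\<in>F. if f (x n) = g then (1/2)^n *\<^sub>R g else 0)"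
      by (rule sum.cong) (auto simp: c_def)
    also have "\<dots> = (1/2)^n *\<^sub>R f (x n)"
      using fw[OF x1] fin by (simp add: sum.delta)
    finally have "(\<Sum>g\<in>F. c g n *\<^sub>R g) = (1/2)^n *\<^sub>R f (x n)" .
    then have "(\<Sum>g\<in>F. (\<Sum>j<Suc n. c g j) *\<^sub>R g)
        = (\<Sum>g\<in>F. (\<Sum>j<n. c g j) *\<^sub>R g) + (1/2)^n *\<^sub>R f (x n)"
      by (simp add: scaleR_add_left sum.distrib)
    moreover have "S (Suc n) = S n + (1/2)^n *\<^sub>R (x n + f (x n) - (1/2) *\<^sub>R x (Suc n))"
      by (simp add: S_def)
    ultimately show ?case using Suc by (simp add: algebra_simps)
  qed
  have lim: "S \<longlonglongrightarrow> v - 0 + (\<Sum>g\<in>F. d g *\<^sub>R g)"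
    unfolding S_eq
  proof (intro tendsto_intros)
    show "(\<lambda>n. (1/2)^n *\<^sub>R x n) \<longlonglongrightarrow> 0"
    proof (rule Lim_null_comparison)
      show "\<forall>\<^sub>F n in sequentially. norm ((1/2)^n *\<^sub>R x n) \<le> (1/2)^n"
        using x1 by (simp add: mult_left_le)
      show "(\<lambda>n. (1/2::real)^n) \<longlonglongrightarrow> 0" by (rule LIMSEQ_power_zero) simp
    qed
    show "(\<lambda>n. sum (c g) {..<n}) \<longlonglongrightarrow> d g" for g
      unfolding d_def by (rule summable_LIMSEQ[OF summ])
  qed
  have "norm (A i (v + (\<Sum>g\<in>F. d g *\<^sub>R g))) \<le> 2 * K" if i: "i \<in> I" for i
  proof -
    interpret bounded_linear "A i" using lin[OF i] .
    have "K \<ge> 0" using fw[OF v] i norm_ge_zero order_trans by blast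
    have "norm (A i (S n)) \<le> 2 * K" for n
    proof -
      have "norm (A i (S n)) \<le> (\<Sum>j<n. norm ((1/2)^j *\<^sub>R A i (x j + f (x j) - (1/2) *\<^sub>R x (Suc j))))"
        unfolding S_def sum scaleR by (rule norm_sum)
      also have "\<dots> \<le> (\<Sum>j<n. (1/2)^j * K)"
        using fw[OF x1] i by (intro sum_mono) (simp add: xS divide_right_mono)
      also have "\<dots> = (\<Sum>j<n. (1/2)^j) * K" by (simp add: sum_distrib_right)
      also have "\<dots> \<le> (\<Sum>j. (1/2)^j) * K"
        by (intro mult_right_mono sum_le_suminf geo \<open>K \<ge> 0\<close>) auto
      also have "\<dots> = 2 * K" by (subst suminf_geometric) auto
      finally show ?thesis .
    qed
    then have "norm (A i (v - 0 + (\<Sum>g\<in>F. d g *\<^sub>R g))) \<le> 2 * K"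
      by (rule Lim_norm_ubound[OF sequentially_bot tendsto[OF lim] always_eventually[OF allI]])
    then show ?thesis by simp
  qed
  with d show ?thesis by blast
qed

text \<open>
  There is no axiom \<open>T t t x = x\<close>: the evolution operators of the delay equation will act on all bounded
  continuous functions on the line, and \<open>T t t\<close> is then only a projection onto the functions that are
  constant on either side of \<open>[-r,0]\<close>.
\<close>

locale evolution_family =
  fixes T :: "real \<Rightarrow> real \<Rightarrow> 'a::real_normed_vector \<Rightarrow> 'a" and h G :: real
  assumes bl: "\<And>s t. 0 \<le> s \<Longrightarrow> s \<le> t \<Longrightarrow> bounded_linear (T t s)"
    and cocycle: "\<And>u s t x. 0 \<le> u \<Longrightarrow> u \<le> s \<Longrightarrow> s \<le> t \<Longrightarrow> T t s (T s u x) = T t u x"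
    and h_pos: "h > 0"
    and growth: "\<And>s t v. 0 \<le> s \<Longrightarrow> s \<le> t \<Longrightarrow> t \<le> s + h \<Longrightarrow> norm (T t s v) \<le> G * norm v"
    and G_ge_1: "G \<ge> 1"
begin

definition bounded_orbit :: "real \<Rightarrow> 'a \<Rightarrow> bool" where
  "bounded_orbit s v \<longleftrightarrow> (\<exists>B. \<forall>t\<ge>s. norm (T t s v) \<le> B)"

lemma T_add: "0 \<le> s \<Longrightarrow> s \<le> t \<Longrightarrow> T t s (x + y) = T t s x + T t s y"
  using bl by (simp add: linear_simps)

lemma T_diff: "0 \<le> s \<Longrightarrow> s \<le> t \<Longrightarrow> T t s (x - y) = T t s x - T t s y"
  using bl by (simp add: linear_simps)

lemma T_scaleR: "0 \<le> s \<Longrightarrow> s \<le> t \<Longrightarrow> T t s (c *\<^sub>R x) = c *\<^sub>R T t s x"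
  using bl by (simp add: linear_simps)

lemma T_minus: "0 \<le> s \<Longrightarrow> s \<le> t \<Longrightarrow> T t s (- x) = - T t s x"
  using bl by (simp add: linear_simps)

lemma T_zero: "0 \<le> s \<Longrightarrow> s \<le> t \<Longrightarrow> T t s 0 = 0"
  using bl by (simp add: linear_simps)

lemma bounded_orbit_subspace: "0 \<le> s \<Longrightarrow> subspace {v. bounded_orbit s v}"
  unfolding subspace_def
proof (intro conjI ballI allI)
  assume s: "0 \<le> s"
  show "0 \<in> {v. bounded_orbit s v}"
    using s by (auto simp: bounded_orbit_def T_zero)
  fix x y c assume "x \<in> {v. bounded_orbit s v}"
  then obtain B where B: "\<And>t. t \<ge> s \<Longrightarrow> norm (T t s x) \<le> B" by (auto simp: bounded_orbit_def)
  then show "c *\<^sub>R x \<in> {v. bounded_orbit s v}"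
    using s by (auto simp: bounded_orbit_def T_scaleR intro!: exI[of _ "\<bar>c\<bar> * B"] mult_left_mono)
  assume "y \<in> {v. bounded_orbit s v}"
  then obtain B' where B': "\<And>t. t \<ge> s \<Longrightarrow> norm (T t s y) \<le> B'" by (auto simp: bounded_orbit_def)
  show "x + y \<in> {v. bounded_orbit s v}"
    using s B B' by (auto simp: bounded_orbit_def T_add intro!: exI[of _ "B + B'"] norm_triangle_mono)
qed

lemma bounded_orbit_T:
  assumes "0 \<le> u" "u \<le> s" "bounded_orbit u v"
  shows "bounded_orbit s (T s u v)"
  using assms unfolding bounded_orbit_def by (metis cocycle order_trans)

lemma finite_complement:
  assumes fin: "finite F"
    and M: "\<And>v. \<exists>c. (\<forall>f\<in>F. \<bar>c f\<bar> \<le> M * norm v) \<and>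
              (\<forall>t\<ge>0. norm (T t 0 (v + (\<Sum>f\<in>F. c f *\<^sub>R f))) \<le> M * norm v)"
  shows "\<exists>Z M'. subspace Z \<and> (\<forall>z\<in>Z. bounded_orbit 0 z \<longrightarrow> z = 0) \<and>
    (\<forall>v. \<exists>z\<in>Z. \<forall>t\<ge>0. norm (T t 0 (v + z)) \<le> M' * norm v)"
proof -
  \<comment> \<open>A generating set of minimal cardinality is independent modulo the bounded orbits.\<close>
  define \<Phi> where "\<Phi> F \<longleftrightarrow> finite F \<and> (\<exists>M. \<forall>v. \<exists>c. (\<forall>f\<in>F. \<bar>c f\<bar> \<le> M * norm v) \<and>
              (\<forall>t\<ge>0. norm (T t 0 (v + (\<Sum>f\<in>F. c f *\<^sub>R f))) \<le> M * norm v))" for F :: "'a set"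
  have "\<Phi> F" unfolding \<Phi>_def using fin M by blast
  then obtain E where E: "\<Phi> E" and min: "\<And>F. \<Phi> F \<Longrightarrow> card E \<le> card F"
    using ex_has_least_nat[of \<Phi> F card] by blast
  from E obtain M' where finE: "finite E" and
    M': "\<And>v. \<exists>c. (\<forall>f\<in>E. \<bar>c f\<bar> \<le> M' * norm v) \<and>
              (\<forall>t\<ge>0. norm (T t 0 (v + (\<Sum>f\<in>E. c f *\<^sub>R f))) \<le> M' * norm v)"
    unfolding \<Phi>_def by blast
  have indep: "a g = 0" if g: "g \<in> E" and bo: "bounded_orbit 0 (\<Sum>f\<in>E. a f *\<^sub>R f)" for a g
  proof (rule ccontr)
    assume ag: "a g \<noteq> 0"
    define w where "w = (\<Sum>f\<in>E. a f *\<^sub>R f)"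
    obtain B where B: "\<And>t. t \<ge> 0 \<Longrightarrow> norm (T t 0 w) \<le> B"
      using bo by (auto simp: bounded_orbit_def w_def)
    have B0: "B \<ge> 0" using B[of 0] norm_ge_zero order_trans by blast
    \<comment> \<open>Eliminating \<open>g\<close> by means of \<open>w\<close> uses the multiple k
      = c g / a g, with |k| at most M' |v| / |a g|. This costs a factor 1 + |a f| / |a g| in the
      coefficients and 1 + B / |a g| in the orbit bound; \<open>R\<close> dominates both.\<close>
    define R where "R = (1 + (B + (\<Sum>f\<in>E. \<bar>a f\<bar>)) / \<bar>a g\<bar>)"
    have Ra: "1 + \<bar>a f\<bar> / \<bar>a g\<bar> \<le> R" if "f \<in> E" for f
    proof -
      have "\<bar>a f\<bar> \<le> (\<Sum>f\<in>E. \<bar>a f\<bar>)" by (rule member_le_sum) (use that finE in auto)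
      then show ?thesis using B0 by (auto simp: R_def intro!: divide_right_mono)
    qed
    have RB: "1 + B / \<bar>a g\<bar> \<le> R"
      by (auto simp: R_def intro!: divide_right_mono sum_nonneg)
    have "\<exists>c. (\<forall>f\<in>E - {g}. \<bar>c f\<bar> \<le> M' * R * norm v) \<and>
              (\<forall>t\<ge>0. norm (T t 0 (v + (\<Sum>f\<in>E - {g}. c f *\<^sub>R f))) \<le> M' * R * norm v)" for v
    proof -
      obtain c where c: "\<And>f. f \<in> E \<Longrightarrow> \<bar>c f\<bar> \<le> M' * norm v"
        and ct: "\<And>t. t \<ge> 0 \<Longrightarrow> norm (T t 0 (v + (\<Sum>f\<in>E. c f *\<^sub>R f))) \<le> M' * norm v"
        using M'[of v] by blast
      have Mv: "M' * norm v \<ge> 0" using ct[of 0] norm_ge_zero order_trans by blast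
      define k where "k = c g / a g"
      have k: "\<bar>k\<bar> * b \<le> M' * norm v * (b / \<bar>a g\<bar>)" if "b \<ge> 0" for b
        using c[OF g] ag that by (simp add: k_def divide_simps mult_right_mono)
      have eq: "v + (\<Sum>f\<in>E - {g}. (c f - k * a f) *\<^sub>R f) = (v + (\<Sum>f\<in>E. c f *\<^sub>R f)) - k *\<^sub>R w"
      proof -
        have "(\<Sum>f\<in>E - {g}. (c f - k * a f) *\<^sub>R f) = (\<Sum>f\<in>E. (c f - k * a f) *\<^sub>R f)"
          using g finE ag by (intro sum.mono_neutral_left) (auto simp: k_def)
        then show ?thesis
          by (simp add: w_def scaleR_diff_left sum_subtractf scaleR_sum_right)
      qed
      show ?thesis
      proof (intro exI[of _ "\<lambda>f. c f - k * a f"] conjI ballI allI impI)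
        fix f assume f: "f \<in> E - {g}"
        have "\<bar>c f - k * a f\<bar> \<le> \<bar>c f\<bar> + \<bar>k\<bar> * \<bar>a f\<bar>"
          by (metis abs_mult abs_triangle_ineq4)
        also have "\<dots> \<le> M' * norm v + M' * norm v * (\<bar>a f\<bar> / \<bar>a g\<bar>)"
          using c[of f] f k[of "\<bar>a f\<bar>"] by auto
        also have "\<dots> = M' * norm v * (1 + \<bar>a f\<bar> / \<bar>a g\<bar>)" by (simp add: algebra_simps)
        also have "\<dots> \<le> M' * norm v * R" by (intro mult_left_mono Ra Mv) (use f in auto)
        finally show "\<bar>c f - k * a f\<bar> \<le> M' * R * norm v" by (simp add: mult_ac)
      next
        fix t :: real assume t: "t \<ge> 0"
        have "norm (T t 0 (v + (\<Sum>f\<in>E. c f *\<^sub>R f) - k *\<^sub>R w))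
          = norm (T t 0 (v + (\<Sum>f\<in>E. c f *\<^sub>R f)) - k *\<^sub>R T t 0 w)"
          using t by (simp add: T_diff T_scaleR)
        also have "\<dots> \<le> M' * norm v + \<bar>k\<bar> * B"
          by (rule norm_triangle_le_diff)
            (use ct[OF t] B[OF t] in \<open>auto intro!: add_mono mult_left_mono\<close>)
        also have "\<dots> \<le> M' * norm v * (1 + B / \<bar>a g\<bar>)"
          using k[OF B0] by (simp add: algebra_simps)
        also have "\<dots> \<le> M' * norm v * R" by (intro mult_left_mono RB Mv)
        finally show "norm (T t 0 (v + (\<Sum>f\<in>E - {g}. (c f - k * a f) *\<^sub>R f))) \<le> M' * R * norm v"
          by (simp add: eq mult_ac)
      qed
    qed
    then have "\<Phi> (E - {g})" unfolding \<Phi>_def using finE by blast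
    from min[OF this] g finE show False
      by (metis card_Diff1_less not_le)
  qed
  show ?thesis
  proof (intro exI conjI ballI impI allI)
    show "subspace (span E)" by simp
    fix z assume z: "z \<in> span E" "bounded_orbit 0 z"
    then obtain a where "z = (\<Sum>f\<in>E. a f *\<^sub>R f)" using finE by (auto simp: span_finite)
    with indep z show "z = 0" by (auto intro!: sum.neutral)
  next
    fix v
    obtain c where "\<forall>t\<ge>0. norm (T t 0 (v + (\<Sum>f\<in>E. c f *\<^sub>R f))) \<le> M' * norm v"
      using M' by blast
    moreover have "(\<Sum>f\<in>E. c f *\<^sub>R f) \<in> span E" by (intro span_sum span_scale span_base)
    ultimately show "\<exists>z\<in>span E. \<forall>t\<ge>0. norm (T t 0 (v + z)) \<le> M' * norm v" by blast
  qed
qed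

end

text \<open>Centres are wanted in \<open>A\<close> itself, because \<open>perron_complement\<close>
  has to write each of them as \<open>T h 0 x\<close>. Moving a centre into \<open>A\<close> at most
  doubles the radius, hence the net at e/2.\<close>

lemma finite_net:
  fixes A :: "'a::metric_space set"
  assumes "compact C" "A \<subseteq> C" "e > 0"
  obtains F where "finite F" "F \<subseteq> A" "A \<subseteq> (\<Union>f\<in>F. ball f e)"
proof -
  obtain E where E: "finite E" "C \<subseteq> (\<Union>x\<in>E. ball x (e/2))"
    using seq_compact_imp_totally_bounded[of C] assms compact_imp_seq_compact half_gt_zero by metis
  define p where "p x = (SOME y. y \<in> A \<and> y \<in> ball x (e/2))" for x
  have p: "p x \<in> A \<and> p x \<in> ball x (e/2)" if "A \<inter> ball x (e/2) \<noteq> {}" for x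
    unfolding p_def by (rule someI_ex) (use that in blast)
  show thesis
  proof (rule that[of "p ` {x \<in> E. A \<inter> ball x (e/2) \<noteq> {}}"])
    show "finite (p ` {x \<in> E. A \<inter> ball x (e/2) \<noteq> {}})" using E by simp
    show "p ` {x \<in> E. A \<inter> ball x (e/2) \<noteq> {}} \<subseteq> A" using p by auto
    show "A \<subseteq> (\<Union>f\<in>p ` {x \<in> E. A \<inter> ball x (e/2) \<noteq> {}}. ball f e)"
    proof
      fix y assume y: "y \<in> A"
      then obtain x where x: "x \<in> E" "y \<in> ball x (e/2)" using E assms by blast
      with y have "A \<inter> ball x (e/2) \<noteq> {}" by blast
      moreover from p[OF this] x have "y \<in> ball (p x) e"
        using dist_triangle_half_r[of x "p x" e y] by auto
      ultimately show "y \<in> (\<Union>f\<in>p ` {x \<in> E. A \<inter> ball x (e/2) \<noteq> {}}. ball f e)"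
        using x by blast
    qed
  qed
qed

section \<open>Impulse responses and a complement of the bounded orbits\<close>

context evolution_family
begin

text \<open>The discrete variation-of-constants term for zero initial state. Impulses are spaced by
  h so that, for the delay equation, each one can be smoothed before the next arrives. The number
  \<open>N\<close> is finite, but all later bounds are uniform in it.\<close>

definition impulses :: "real \<Rightarrow> nat \<Rightarrow> (nat \<Rightarrow> 'a) \<Rightarrow> real \<Rightarrow> 'a" where
  "impulses a N e t = (\<Sum>k | k < N \<and> a + real k * h \<le> t. T t (a + real k * h) (e k))"

lemma growth_iterated:
  assumes "0 \<le> s" "s \<le> t" "t \<le> s + real (Suc n) * h"
  shows "norm (T t s v) \<le> G ^ Suc n * norm v"
  using assms
proof (induction n arbitrary: t)
  case 0
  then show ?case using growth[of s t v] by simp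
next
  case (Suc n)
  show ?case
  proof (cases "t \<le> s + real (Suc n) * h")
    case True
    have "norm (T t s v) \<le> 1 * (G ^ Suc n * norm v)"
      using Suc.IH[OF _ _ True] Suc.prems by simp
    also have "\<dots> \<le> G * (G ^ Suc n * norm v)"
      using G_ge_1 by (intro mult_right_mono) auto
    finally show ?thesis by simp
  next
    case False
    define u where "u = s + real (Suc n) * h"
    have u: "0 \<le> u" "s \<le> u" "u \<le> t" "t \<le> u + h"
      using False Suc.prems h_pos by (auto simp: u_def algebra_simps)
    have "norm (T t s v) = norm (T t u (T u s v))" using u Suc.prems by (simp add: cocycle)
    also have "\<dots> \<le> G * norm (T u s v)" by (rule growth) (use u in auto)
    also have "\<dots> \<le> G * (G ^ Suc n * norm v)"
      by (intro mult_left_mono Suc.IH) (use u Suc.prems G_ge_1 in \<open>auto simp: u_def\<close>)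
    finally show ?thesis by simp
  qed
qed

lemma growth_on_compact:
  assumes s: "0 \<le> s"
  obtains B where "B \<ge> 0" "\<And>t. s \<le> t \<Longrightarrow> t \<le> b \<Longrightarrow> norm (T t s v) \<le> B"
proof -
  obtain m where m: "b - s < real m * h"
    using reals_Archimedean3[OF h_pos] by blast
  show thesis
  proof (rule that)
    show "0 \<le> G ^ Suc m * norm v" using G_ge_1 by simp
    fix t assume "s \<le> t" "t \<le> b"
    moreover have "real m * h \<le> real (Suc m) * h" using h_pos by simp
    ultimately show "norm (T t s v) \<le> G ^ Suc m * norm v"
      using m s by (intro growth_iterated) auto
  qed
qed

lemma impulses_scaleR:
  assumes a: "a \<ge> 0"
  shows "impulses a N (\<lambda>k. c *\<^sub>R e k) t = c *\<^sub>R impulses a N e t"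
  using a h_pos by (auto simp: impulses_def scaleR_sum_right T_scaleR intro!: sum.cong)

lemma impulses_single:
  "impulses a (Suc 0) e t = (if a \<le> t then T t a (e 0) else 0)"
proof -
  have "{k. k < Suc 0 \<and> a + real k * h \<le> t} = (if a \<le> t then {0} else {})" by auto
  then show ?thesis by (simp add: impulses_def)
qed

text \<open>An impulse v at time h is answered by some x, so that v + T h 0 x has a bounded orbit,
  and T h 0 x lies in a relatively compact set independent of v. A finite net of that set therefore
  kills v up to a remainder of norm 1/2, and \<open>geometric_decomposition\<close> sums the
  remainders. Pulling the net back to time 0 gives the generators for
  \<open>finite_complement\<close>.\<close>

lemma perron_complement:
  assumes comp: "compact C" "T h 0 ` cball 0 1 \<subseteq> C"
    and perron: "\<And>a N e. a \<ge> 0 \<Longrightarrow> (\<And>k. k < N \<Longrightarrow> norm (e k) \<le> 1) \<Longrightarrow>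
      \<exists>x. \<forall>t\<ge>0. norm (T t 0 x + impulses a N e t) \<le> K"
  obtains Z K' where "subspace Z" "\<forall>z\<in>Z. bounded_orbit 0 z \<longrightarrow> z = 0" "K' \<ge> 1"
    "\<forall>a N e. a \<ge> 0 \<longrightarrow> (\<forall>k<N. norm (e k) \<le> 1) \<longrightarrow>
      (\<exists>z\<in>Z. \<forall>t\<ge>0. norm (T t 0 z + impulses a N e t) \<le> K')"
proof -
  have "K \<ge> 0" using perron[of 0 0 "\<lambda>_. 0"] norm_ge_zero order_trans by blast
  \<comment> \<open>Rescaling the unit ball to radius K + 1 rather than K keeps the factor
    invertible when K = 0.\<close>
  have "compact ((\<lambda>x. (K + 1) *\<^sub>R x) ` C)" using comp by (intro compact_scaling)
  moreover have "T h 0 ` cball 0 (K + 1) \<subseteq> (\<lambda>x. (K + 1) *\<^sub>R x) ` C"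
  proof (safe)
    fix x :: 'a assume x: "x \<in> cball 0 (K + 1)"
    have "T h 0 x = (K + 1) *\<^sub>R T h 0 ((1 / (K + 1)) *\<^sub>R x)"
      using \<open>K \<ge> 0\<close> h_pos by (simp add: T_scaleR)
    moreover have "(1 / (K + 1)) *\<^sub>R x \<in> cball 0 1" using x \<open>K \<ge> 0\<close> by (simp add: divide_simps)
    ultimately show "T h 0 x \<in> (\<lambda>x. (K + 1) *\<^sub>R x) ` C" using comp by blast
  qed
  ultimately obtain F where F: "finite F" "F \<subseteq> T h 0 ` cball 0 (K + 1)"
    "T h 0 ` cball 0 (K + 1) \<subseteq> (\<Union>f\<in>F. ball f (1/2))"
    using finite_net[of "(\<lambda>x. (K + 1) *\<^sub>R x) ` C" "T h 0 ` cball 0 (K + 1)" "1/2"] by auto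
  have step: "\<exists>f\<in>F. \<exists>w. norm w \<le> 1 \<and> (\<forall>t\<in>{h..}. norm (T t h (v + f - (1/2) *\<^sub>R w)) \<le> K)"
    if v: "norm v \<le> 1" for v
  proof -
    obtain x where x: "\<And>t. t \<ge> 0 \<Longrightarrow> norm (T t 0 x + impulses h (Suc 0) (\<lambda>_. v) t) \<le> K"
      using perron[of h "Suc 0" "\<lambda>_. v"] v h_pos by auto
    \<comment> \<open>No impulse has arrived at time 0, so the bound there controls the initial
      state itself. It controls only \<open>T 0 0 x\<close>, which has the same orbit as x.\<close>
    have "norm (T 0 0 x) \<le> K" using x[of 0] h_pos by (simp add: impulses_single)
    moreover have "T h 0 x = T h 0 (T 0 0 x)" using h_pos by (simp add: cocycle)
    ultimately have "T h 0 x \<in> T h 0 ` cball 0 (K + 1)" by auto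
    then obtain f where f: "f \<in> F" "dist f (T h 0 x) < 1/2" using F by auto
    define w where "w = 2 *\<^sub>R (f - T h 0 x)"
    have "norm w \<le> 1" using f by (simp add: w_def dist_norm)
    moreover have "norm (T t h (v + f - (1/2) *\<^sub>R w)) \<le> K" if "t \<ge> h" for t
      using x[of t] that h_pos by (simp add: w_def impulses_single T_add cocycle add.commute)
    ultimately show ?thesis using f by auto
  qed
  have "\<forall>f\<in>F. \<exists>x. T h 0 x = f" using F(2) by blast
  from bchoice[OF this] obtain g where g: "\<And>f. f \<in> F \<Longrightarrow> T h 0 (g f) = f" by blast
  have inj: "inj_on g F" using g by (metis inj_onI)
  \<comment> \<open>The three terms serve the coefficients, the orbit after time h, and the orbit
    before h, where only \<open>growth\<close> is available.\<close>
  define M where "M = 2 * G + 2 * K * G + G * (1 + (\<Sum>f\<in>F. 2 * G * norm (g f)))"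
  have decomp: "\<exists>c. (\<forall>f\<in>g ` F. \<bar>c f\<bar> \<le> M * norm v) \<and>
              (\<forall>t\<ge>0. norm (T t 0 (v + (\<Sum>f\<in>g ` F. c f *\<^sub>R f))) \<le> M * norm v)" for v
  proof (cases "v = 0")
    case True
    then show ?thesis by (intro exI[of _ "\<lambda>_. 0"]) (simp add: T_zero)
  next
    case False
    \<comment> \<open>Decomposition happens at time h: the state \<open>T h 0 v\<close>, of norm at
      most G |v|, is normalised to the unit ball.\<close>
    define u where "u = (1 / (G * norm v)) *\<^sub>R T h 0 v"
    have Gv: "G * norm v > 0" using False G_ge_1 by simp
    have "norm u \<le> 1"
      using growth[of 0 h v] h_pos Gv by (simp add: u_def divide_simps)
    then have "\<exists>c. (\<forall>f\<in>F. \<bar>c f\<bar> \<le> 2) \<and>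
        (\<forall>t\<in>{h..}. norm (T t h (u + (\<Sum>f\<in>F. c f *\<^sub>R f))) \<le> 2 * K)"
      by (intro geometric_decomposition F(1) step bl) (use h_pos in auto)
    then obtain c where c: "\<And>f. f \<in> F \<Longrightarrow> \<bar>c f\<bar> \<le> 2"
      and ct: "\<And>t. t \<ge> h \<Longrightarrow> norm (T t h (u + (\<Sum>f\<in>F. c f *\<^sub>R f))) \<le> 2 * K"
      by auto
    \<comment> \<open>A generator \<open>g f\<close> at time 0 takes the coefficient of its image
      \<open>f\<close> at time h.\<close>
    define d where "d x = G * norm v * c (T h 0 x)" for x
    have reidx: "(\<Sum>f\<in>g ` F. d f *\<^sub>R f) = (\<Sum>f\<in>F. (G * norm v * c f) *\<^sub>R g f)"
      using inj g by (simp add: sum.reindex d_def)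
    have nn: "0 \<le> (\<Sum>f\<in>F. 2 * G * norm (g f))" using G_ge_1 by (intro sum_nonneg) auto
    have dM: "\<bar>d (g f)\<bar> \<le> 2 * G * norm v" if "f \<in> F" for f
    proof -
      have "\<bar>d (g f)\<bar> = G * norm v * \<bar>c f\<bar>"
        using g[OF that] G_ge_1 by (simp add: d_def abs_mult)
      also have "\<dots> \<le> G * norm v * 2" using c[OF that] Gv by (intro mult_left_mono) auto
      finally show ?thesis by simp
    qed
    have MG: "2 * G \<le> M" "2 * K * G \<le> M" "G * (1 + (\<Sum>f\<in>F. 2 * G * norm (g f))) \<le> M"
      using G_ge_1 \<open>K \<ge> 0\<close> nn by (auto simp: M_def)
    show ?thesis
    proof (intro exI[of _ d] conjI ballI allI impI)
      fix f assume "f \<in> g ` F"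
      then show "\<bar>d f\<bar> \<le> M * norm v"
        using dM mult_right_mono[OF MG(1) norm_ge_zero, of v] by force
    next
      fix t :: real assume t: "t \<ge> 0"
      define y where "y = v + (\<Sum>f\<in>g ` F. d f *\<^sub>R f)"
      show "norm (T t 0 (v + (\<Sum>f\<in>g ` F. d f *\<^sub>R f))) \<le> M * norm v"
      proof (cases "t \<ge> h")
        case True
        have "T h 0 y = (G * norm v) *\<^sub>R (u + (\<Sum>f\<in>F. c f *\<^sub>R f))"
          using h_pos Gv g bl[of 0 h] G_ge_1
          by (simp add: y_def reidx u_def linear_simps T_add T_scaleR scaleR_add_right scaleR_sum_right
                linear_sum[OF bounded_linear.linear])
        then have "norm (T t 0 y) = G * norm v * norm (T t h (u + (\<Sum>f\<in>F. c f *\<^sub>R f)))"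
          using True h_pos Gv G_ge_1 cocycle[of 0 h t y, symmetric] by (simp add: T_scaleR)
        also have "\<dots> \<le> G * norm v * (2 * K)" using ct[OF True] Gv by (intro mult_left_mono) auto
        also have "\<dots> \<le> M * norm v" using mult_right_mono[OF MG(2), of "norm v"] by (simp add: mult_ac)
        finally show ?thesis by (simp add: y_def)
      next
        case False
        have *: "norm (T t 0 y) \<le> G * norm y" by (rule growth) (use t False in auto)
        have "norm y \<le> norm v + (\<Sum>f\<in>F. norm ((G * norm v * c f) *\<^sub>R g f))"
          unfolding y_def reidx by (intro norm_triangle_mono norm_sum order_refl)
        also have "\<dots> \<le> norm v + (\<Sum>f\<in>F. (2 * G * norm v) * norm (g f))"
          using dM g by (intro add_left_mono sum_mono) (auto simp: d_def intro!: mult_right_mono)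
        also have "\<dots> = (1 + (\<Sum>f\<in>F. 2 * G * norm (g f))) * norm v"
          by (simp add: algebra_simps sum_distrib_left)
        finally have "G * norm y \<le> G * ((1 + (\<Sum>f\<in>F. 2 * G * norm (g f))) * norm v)"
          using G_ge_1 by (intro mult_left_mono) auto
        with * have "norm (T t 0 y) \<le> G * ((1 + (\<Sum>f\<in>F. 2 * G * norm (g f))) * norm v)"
          by (rule order_trans)
        also have "G * ((1 + (\<Sum>f\<in>F. 2 * G * norm (g f))) * norm v)
            = (G * (1 + (\<Sum>f\<in>F. 2 * G * norm (g f)))) * norm v" by (simp only: mult.assoc)
        also have "\<dots> \<le> M * norm v" by (intro mult_right_mono MG(3)) simp
        finally show ?thesis by (simp add: y_def)
      qed
    qed
  qed
  obtain Z M' where Z: "subspace Z" "\<forall>z\<in>Z. bounded_orbit 0 z \<longrightarrow> z = 0"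
    and M': "\<forall>v. \<exists>z\<in>Z. \<forall>t\<ge>0. norm (T t 0 (v + z)) \<le> M' * norm v"
    using finite_complement[OF finite_imageI[OF F(1), of g] decomp] by metis
  \<comment> \<open>K bounds the response of x. Replacing x by an element of \<open>Z\<close> costs
    |M'| times the size of \<open>T 0 0 x\<close>, which is at most K + G because an impulse may sit
    exactly at time 0. The 1 secures K' >= 1.\<close>
  define K' where "K' = 1 + K + \<bar>M'\<bar> * (K + G)"
  show thesis
  proof (rule that[OF Z, of K'])
    show "K' \<ge> 1" using \<open>K \<ge> 0\<close> G_ge_1 by (simp add: K'_def)
    show "\<forall>a N e. a \<ge> 0 \<longrightarrow> (\<forall>k<N. norm (e k) \<le> 1) \<longrightarrow>
      (\<exists>z\<in>Z. \<forall>t\<ge>0. norm (T t 0 z + impulses a N e t) \<le> K')"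
    proof (intro allI impI)
      fix a :: real and N :: nat and e :: "nat \<Rightarrow> 'a"
      assume a: "a \<ge> 0" and e: "\<forall>k<N. norm (e k) \<le> 1"
      have "\<exists>x. \<forall>t\<ge>0. norm (T t 0 x + impulses a N e t) \<le> K"
        by (rule perron[OF a]) (use e in auto)
      then obtain x where x: "\<forall>t\<ge>0. norm (T t 0 x + impulses a N e t) \<le> K" by blast
      have "norm (impulses a N e 0) \<le> G"
      proof (cases "a = 0 \<and> N > 0")
        case True
        then have "{k. k < N \<and> a + real k * h \<le> 0} = {0}"
          using h_pos by (auto simp: mult_le_0_iff)
        then have "norm (impulses a N e 0) = norm (T 0 0 (e 0))" using True by (simp add: impulses_def)
        also have "\<dots> \<le> G * norm (e 0)" by (rule growth) (use h_pos in auto)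
        also have "\<dots> \<le> G" using e True G_ge_1 by (simp add: mult_left_le)
        finally show ?thesis .
      next
        case False
        have "a + real k * h > 0" if "k < N" for k
          using False that a h_pos by (cases "a = 0") (auto simp: add_pos_nonneg)
        then have *: "{k. k < N \<and> a + real k * h \<le> 0} = {}" by fastforce
        show ?thesis unfolding impulses_def * using G_ge_1 by simp
      qed
      with x have x0: "norm (T 0 0 x) \<le> K + G"
        by (smt (verit) norm_triangle_ineq4 add_diff_cancel_right' order_refl)
      \<comment> \<open>Since \<open>T 0 0 x + z\<close> has a bounded orbit, -z answers the
        impulses as well as x does, up to that orbit.\<close>
      obtain z where z: "z \<in> Z" "\<forall>t\<ge>0. norm (T t 0 (T 0 0 x + z)) \<le> M' * norm (T 0 0 x)"
        using M' by blast
      show "\<exists>z\<in>Z. \<forall>t\<ge>0. norm (T t 0 z + impulses a N e t) \<le> K'"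
      proof (intro bexI[of _ "-z"] allI impI)
        show "-z \<in> Z" using z Z by (simp add: subspace_neg)
        fix t :: real assume t: "t \<ge> 0"
        have "T t 0 (-z) + impulses a N e t = (T t 0 x + impulses a N e t) - T t 0 (T 0 0 x + z)"
          using t by (simp add: T_add T_minus cocycle)
        also have "norm \<dots> \<le> K + M' * norm (T 0 0 x)"
          using x z(2) t by (intro norm_triangle_le_diff add_mono) auto
        also have "M' * norm (T 0 0 x) \<le> \<bar>M'\<bar> * (K + G)"
          using x0 by (intro mult_mono) auto
        finally show "norm (T t 0 (-z) + impulses a N e t) \<le> K'" by (simp add: K'_def)
      qed
    qed
  qed
qed

end

section \<open>Exponential decay from bounded response\<close>

locale perron_splitting = evolution_family T h G
  for T :: "real \<Rightarrow> real \<Rightarrow> 'a::real_normed_vector \<Rightarrow> 'a" and h G :: real +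
  fixes Z :: "'a set" and K :: real
  assumes Z: "subspace Z"
    and Z_orbit: "\<And>z. z \<in> Z \<Longrightarrow> bounded_orbit 0 z \<Longrightarrow> z = 0"
    and K_ge_1: "K \<ge> 1"
    and perron: "\<And>a N e. a \<ge> 0 \<Longrightarrow> \<forall>k<N. norm (e k) \<le> 1 \<Longrightarrow>
      \<exists>z\<in>Z. \<forall>t\<ge>0. norm (T t 0 z + impulses a N e t) \<le> K"
begin

lemma bounded_orbit_start:
  assumes s: "s \<ge> 0" and bo: "bounded_orbit s (T s 0 v)"
  shows "bounded_orbit 0 v"
proof -
  obtain B where B: "\<And>t. t \<ge> s \<Longrightarrow> norm (T t s (T s 0 v)) \<le> B"
    using bo by (auto simp: bounded_orbit_def)
  obtain B' where B': "\<And>t. 0 \<le> t \<Longrightarrow> t \<le> s \<Longrightarrow> norm (T t 0 v) \<le> B'"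
    using growth_on_compact[of 0 s v] by auto
  have "norm (T t 0 v) \<le> max B B'" if "t \<ge> 0" for t
    using B[of t] B'[of t] that s by (cases "t \<le> s") (auto simp: cocycle le_max_iff_disj)
  then show ?thesis by (auto simp: bounded_orbit_def)
qed

text \<open>Two bounded responses to the same impulses that start in \<open>Z\<close> differ by a
  bounded orbit from \<open>Z\<close>, hence coincide. So any bounded response is the one provided
  by \<open>perron\<close>, and the crude bound \<open>B\<close> improves to K E.\<close>

lemma bounded_response:
  assumes a: "a \<ge> 0" and E: "E \<ge> 0" and e: "\<And>k. k < N \<Longrightarrow> norm (e k) \<le> E"
    and z: "z \<in> Z" and B: "\<And>t. t \<ge> 0 \<Longrightarrow> norm (T t 0 z + impulses a N e t) \<le> B"
    and t: "t \<ge> 0"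
  shows "norm (T t 0 z + impulses a N e t) \<le> K * E"
proof -
  have *: "norm (T t 0 z + impulses a N e t) \<le> K * E'" if E': "E' > 0" "E' \<ge> E" for E'
  proof -
    have "\<forall>k<N. norm ((1 / E') *\<^sub>R e k) \<le> 1"
      using e E' by (fastforce simp: divide_simps)
    from perron[OF a this] obtain y where y: "y \<in> Z"
      "\<forall>t\<ge>0. norm (T t 0 y + impulses a N (\<lambda>k. (1 / E') *\<^sub>R e k) t) \<le> K" by blast
    define w where "w = E' *\<^sub>R y"
    have w: "norm (T t 0 w + impulses a N e t) \<le> K * E'" if "t \<ge> 0" for t
    proof -
      have "T t 0 w + impulses a N e t
          = E' *\<^sub>R (T t 0 y + impulses a N (\<lambda>k. (1 / E') *\<^sub>R e k) t)"
        using that E' a by (simp add: w_def T_scaleR impulses_scaleR scaleR_add_right)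
      then have "norm (T t 0 w + impulses a N e t)
          = E' * norm (T t 0 y + impulses a N (\<lambda>k. (1 / E') *\<^sub>R e k) t)"
        using E' by simp
      also have "\<dots> \<le> E' * K" using y that E' by (intro mult_left_mono) auto
      finally show ?thesis by (simp add: mult.commute)
    qed
    have "bounded_orbit 0 (z - w)"
      unfolding bounded_orbit_def
    proof (intro exI allI impI)
      fix t :: real assume "t \<ge> 0"
      then have "T t 0 (z - w) = (T t 0 z + impulses a N e t) - (T t 0 w + impulses a N e t)"
        by (simp add: T_diff)
      also have "norm \<dots> \<le> B + K * E'"
        using B w \<open>t \<ge> 0\<close> by (intro norm_triangle_le_diff add_mono) auto
      finally show "norm (T t 0 (z - w)) \<le> B + K * E'" .
    qed
    moreover have "z - w \<in> Z" using z y Z by (simp add: w_def subspace_diff subspace_scale)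
    ultimately have "z = w" using Z_orbit[of "z - w"] by simp
    then show ?thesis using w t by simp
  qed
  \<comment> \<open>Letting E' decrease to E includes E = 0, where the impulses cannot be
    normalised.\<close>
  have "norm (T t 0 z + impulses a N e t) \<le> K * E + \<epsilon>" if "\<epsilon> > 0" for \<epsilon>
  proof -
    have "\<epsilon> / K > 0" using that K_ge_1 by simp
    then show ?thesis using *[of "E + \<epsilon> / K"] E K_ge_1 by (simp add: algebra_simps)
  qed
  then show ?thesis by (rule field_le_epsilon)
qed

text \<open>The unstable projection at time s, recorded at time 0: \<open>T s 0 (lift s v)\<close>
  is Q(s) v and \<open>v - T s 0 (lift s v)\<close> is P(s) v. For t < s,
  \<open>T t 0 (lift s v)\<close> is the backward continuation T(t,s) Q(s) v, so no inverse operator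
  is needed.\<close>

definition lift :: "real \<Rightarrow> 'a \<Rightarrow> 'a" where
  "lift s v = (THE z. z \<in> Z \<and> bounded_orbit s (v - T s 0 z))"

lemma lift_unique:
  assumes s: "s \<ge> 0" and x: "x \<in> Z" "bounded_orbit s (v - T s 0 x)"
    and y: "y \<in> Z" "bounded_orbit s (v - T s 0 y)"
  shows "x = y"
proof -
  have "bounded_orbit s ((v - T s 0 x) - (v - T s 0 y))"
    using subspace_diff[OF bounded_orbit_subspace[OF s], of "v - T s 0 x" "v - T s 0 y"] x y
    by (simp only: mem_Collect_eq)
  then have "bounded_orbit s (T s 0 (y - x))" using s by (simp add: T_diff)
  from bounded_orbit_start[OF s this] Z_orbit[of "y - x"] show ?thesis
    using x y Z by (simp add: subspace_diff)
qed

lemma lift_exists: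
  assumes s: "s \<ge> 0"
  shows "\<exists>z\<in>Z. bounded_orbit s (v - T s 0 z)"
proof -
  define c where "c = norm v + 1"
  have c: "c > 0" "norm v \<le> c" by (auto simp: c_def add_pos_nonneg add_nonneg_pos)
  have "\<forall>k<Suc 0. norm ((1 / c) *\<^sub>R v) \<le> 1"
    using c by (simp add: divide_simps)
  from perron[OF s this] obtain z where z: "z \<in> Z"
    "\<And>t. t \<ge> 0 \<Longrightarrow> norm (T t 0 z + impulses s (Suc 0) (\<lambda>_. (1 / c) *\<^sub>R v) t) \<le> K" by blast
  have "bounded_orbit s (v - T s 0 (- c *\<^sub>R z))"
    unfolding bounded_orbit_def
  proof (intro exI allI impI)
    fix t assume t: "t \<ge> s"
    have "T t s (v - T s 0 (- c *\<^sub>R z)) = c *\<^sub>R (T t 0 z + impulses s (Suc 0) (\<lambda>_. (1 / c) *\<^sub>R v) t)"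
      using t s c by (simp add: impulses_single T_diff T_scaleR T_minus T_add cocycle algebra_simps)
    then show "norm (T t s (v - T s 0 (- c *\<^sub>R z))) \<le> c * K"
      using z(2)[of t] t s c by simp
  qed
  moreover have "- c *\<^sub>R z \<in> Z" using z Z by (metis subspace_scale)
  ultimately show ?thesis by blast
qed

lemma lift_works:
  assumes s: "s \<ge> 0"
  shows "lift s v \<in> Z" "bounded_orbit s (v - T s 0 (lift s v))"
proof -
  have "\<exists>!z. z \<in> Z \<and> bounded_orbit s (v - T s 0 z)"
    using lift_exists[OF s, of v] lift_unique[OF s, of _ v] by blast
  from theI'[OF this] show "lift s v \<in> Z" "bounded_orbit s (v - T s 0 (lift s v))"
    by (auto simp: lift_def)
qed

lemma lift_eqI:
  assumes "s \<ge> 0" "z \<in> Z" "bounded_orbit s (v - T s 0 z)"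
  shows "lift s v = z"
  using lift_unique[OF assms(1) lift_works[OF assms(1)] assms(2,3)] .

lemma lift_add:
  assumes s: "s \<ge> 0"
  shows "lift s (v + w) = lift s v + lift s w"
proof (rule lift_eqI[OF s])
  show "lift s v + lift s w \<in> Z" using lift_works[OF s] Z by (simp add: subspace_add)
  have "bounded_orbit s ((v - T s 0 (lift s v)) + (w - T s 0 (lift s w)))"
    using subspace_add[OF bounded_orbit_subspace[OF s]] lift_works[OF s] by simp
  then show "bounded_orbit s (v + w - T s 0 (lift s v + lift s w))"
    using s by (simp add: T_add algebra_simps)
qed

lemma lift_scaleR:
  assumes s: "s \<ge> 0"
  shows "lift s (c *\<^sub>R v) = c *\<^sub>R lift s v"
proof (rule lift_eqI[OF s])
  show "c *\<^sub>R lift s v \<in> Z" using lift_works[OF s] Z by (simp add: subspace_scale)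
  have "bounded_orbit s (c *\<^sub>R (v - T s 0 (lift s v)))"
    using subspace_scale[OF bounded_orbit_subspace[OF s]] lift_works[OF s] by simp
  then show "bounded_orbit s (c *\<^sub>R v - T s 0 (c *\<^sub>R lift s v))"
    using s by (simp add: T_scaleR algebra_simps)
qed

text \<open>Evolution preserves bounded orbits and leaves the initial value of the unstable part
  unchanged. This is the commutation of the projections with the evolution.\<close>

lemma lift_T:
  assumes s: "0 \<le> s" "s \<le> t"
  shows "lift t (T t s v) = lift s v"
proof (rule lift_eqI)
  show "t \<ge> 0" "lift s v \<in> Z" using s lift_works by auto
  have "bounded_orbit t (T t s (v - T s 0 (lift s v)))"
    using bounded_orbit_T[OF s] lift_works(2)[OF s(1)] by simp
  then show "bounded_orbit t (T t s v - T t 0 (lift s v))"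
    using s by (simp add: T_diff cocycle)
qed

lemma lift_T0:
  assumes "s \<ge> 0" "z \<in> Z"
  shows "lift s (T s 0 z) = z"
  using assms bounded_orbit_subspace[of s] by (intro lift_eqI) (auto simp: subspace_def)

text \<open>The response to the single impulse v at time s with initial value
  \<open>- lift s v\<close> is the stable component of v after s and minus the backward continuation
  of the unstable one before s. Both bounds are thus one instance of
  \<open>bounded_response\<close>. At t = s the impulse already counts, hence the strict inequality
  in the second.\<close>

lemma lift_bounds:
  assumes s: "s \<ge> 0"
  shows "t \<ge> s \<Longrightarrow> norm (T t s (v - T s 0 (lift s v))) \<le> K * norm v"
    and "0 \<le> t \<Longrightarrow> t < s \<Longrightarrow> norm (T t 0 (lift s v)) \<le> K * norm v"
proof -
  define z where "z = - lift s v"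
  have z: "z \<in> Z" using lift_works[OF s] Z by (simp add: z_def subspace_neg)
  have after: "T t 0 z + impulses s (Suc 0) (\<lambda>_. v) t = T t s (v - T s 0 (lift s v))" if "t \<ge> s" for t
    using that s by (simp add: impulses_single z_def T_minus T_diff cocycle)
  have before: "T t 0 z + impulses s (Suc 0) (\<lambda>_. v) t = - T t 0 (lift s v)" if "0 \<le> t" "t < s" for t
    using that s by (simp add: impulses_single z_def T_minus)
  obtain B where B: "\<And>t. t \<ge> s \<Longrightarrow> norm (T t s (v - T s 0 (lift s v))) \<le> B"
    using lift_works(2)[OF s] by (auto simp: bounded_orbit_def)
  obtain B' where B': "\<And>t. 0 \<le> t \<Longrightarrow> t \<le> s \<Longrightarrow> norm (T t 0 (lift s v)) \<le> B'"
    using growth_on_compact[of 0 s "lift s v"] by auto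
  have "norm (T t 0 z + impulses s (Suc 0) (\<lambda>_. v) t) \<le> max B B'" if "t \<ge> 0" for t
  proof (cases "t \<ge> s")
    case True
    then show ?thesis using after[OF True] B[OF True] by simp
  next
    case False
    then show ?thesis using before[of t] B'[of t] that by simp
  qed
  then have resp: "norm (T t 0 z + impulses s (Suc 0) (\<lambda>_. v) t) \<le> K * norm v" if "t \<ge> 0" for t
    by (intro bounded_response[OF s norm_ge_zero _ z _ that]) auto
  show "t \<ge> s \<Longrightarrow> norm (T t s (v - T s 0 (lift s v))) \<le> K * norm v"
    using resp[of t] after[of t] s by simp
  show "0 \<le> t \<Longrightarrow> t < s \<Longrightarrow> norm (T t 0 (lift s v)) \<le> K * norm v"
    using resp[of t] before[of t] by simp
qed

lemma stable_bound:
  assumes s: "0 \<le> s" "s \<le> t" and v: "bounded_orbit s v"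
  shows "norm (T t s v) \<le> K * norm v"
proof -
  have "lift s v = 0"
    using v s Z by (intro lift_eqI) (auto simp: T_zero subspace_0)
  then show ?thesis using lift_bounds(1)[of s t v] s by (simp add: T_zero)
qed

lemma unstable_bound:
  assumes "0 \<le> t" "t \<le> s" and z: "z \<in> Z"
  shows "norm (T t 0 z) \<le> K * norm (T s 0 z)"
proof (cases "t = s")
  case True
  then show ?thesis using K_ge_1 mult_right_mono[of 1 K "norm (T s 0 z)"] by simp
next
  case False
  then show ?thesis using lift_bounds(2)[of s t "T s 0 z"] lift_T0[of s z] assms by simp
qed

text \<open>Enough impulses for the estimate n x <= K^2 y to give x <= y / 2; one factor K bounds
  the impulses, the other the response to them.\<close>

definition period :: nat where "period = nat \<lceil>2 * K\<^sup>2\<rceil>"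

lemma period: "real period \<ge> 2 * K\<^sup>2" "period > 0"
proof -
  show *: "real period \<ge> 2 * K\<^sup>2" unfolding period_def by linarith
  have "1 \<le> K\<^sup>2" using K_ge_1 by (simp add: one_le_power)
  with * have "real period > 0" by linarith
  then show "period > 0" by simp
qed

lemma halving:
  assumes "real period * x \<le> K * (K * y)" "y \<ge> 0"
  shows "x \<le> y / 2"
proof (rule ccontr)
  assume "\<not> x \<le> y / 2"
  then have x: "y < 2 * x" by simp
  then have "2 * K\<^sup>2 * x \<le> real period * x" using period(1) assms(2) by (intro mult_right_mono) auto
  also have "\<dots> \<le> K\<^sup>2 * y" using assms(1) by (simp add: power2_eq_square mult.assoc)
  finally have "K\<^sup>2 * (2 * x) \<le> K\<^sup>2 * y" by simp
  moreover have "K\<^sup>2 > 0" using K_ge_1 by simp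
  ultimately show False using x by (simp add: mult_le_cancel_left)
qed

text \<open>Feeding an orbit back as impulses makes its response grow linearly in time,
  so its boundedness by a constant forces the orbit to decay.\<close>

lemma stable_halving:
  assumes s: "0 \<le> s" and v: "bounded_orbit s v" and t: "t \<ge> s + real period * h"
  shows "norm (T t s v) \<le> norm v / 2"
proof (rule halving)
  define e where "e k = T (s + real k * h) s v" for k :: nat
  have ts: "s \<le> t"
    using t h_pos mult_nonneg_nonneg[of "real period" h] by linarith
  have imp: "impulses s period e \<tau> = real (card {k. k < period \<and> s + real k * h \<le> \<tau>}) *\<^sub>R T \<tau> s v" for \<tau>
  proof -
    have "impulses s period e \<tau> = (\<Sum>k | k < period \<and> s + real k * h \<le> \<tau>. T \<tau> s v)"
      unfolding impulses_def e_def using s h_pos by (intro sum.cong) (auto simp: cocycle)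
    then show ?thesis by (simp add: sum_constant_scaleR)
  qed
  have "{k. k < period \<and> s + real k * h \<le> t} = {..<period}"
  proof safe
    fix k assume "k < period"
    then have "real k * h \<le> real period * h" using h_pos by (intro mult_right_mono) auto
    with t show "s + real k * h \<le> t" by linarith
  qed
  \<comment> \<open>The correction from \<open>Z\<close> is 0: the orbit of v is bounded, so the
    finitely many copies of it already form a bounded response.\<close>
  then have "real period * norm (T t s v) = norm (T t 0 0 + impulses s period e t)"
    using s ts by (simp add: imp T_zero)
  also have "\<dots> \<le> K * (K * norm v)"
  proof (rule bounded_response[OF s])
    show "0 \<le> K * norm v" using K_ge_1 by simp
    show "norm (e k) \<le> K * norm v" for k
      unfolding e_def by (rule stable_bound) (use s v h_pos in auto)
    show "0 \<in> Z" using Z by (rule subspace_0)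
    show "t \<ge> 0" using s ts by simp
    fix \<tau> :: real assume \<tau>: "\<tau> \<ge> 0"
    show "norm (T \<tau> 0 0 + impulses s period e \<tau>) \<le> real period * (K * norm v)"
    proof (cases "\<tau> \<ge> s")
      case True
      have "card {k. k < period \<and> s + real k * h \<le> \<tau>} \<le> card {..<period}"
        by (intro card_mono) auto
      then have "real (card {k. k < period \<and> s + real k * h \<le> \<tau>}) * norm (T \<tau> s v) \<le> real period * (K * norm v)"
        using stable_bound[OF s True v] by (intro mult_mono) auto
      then show ?thesis using \<tau> by (simp add: imp T_zero)
    next
      case False
      have "s + real k * h > \<tau>" for k using False h_pos mult_nonneg_nonneg[of "real k" h] by linarith
      then have "{k. k < period \<and> s + real k * h \<le> \<tau>} = {}" by (auto simp: not_le[symmetric])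
      then show ?thesis using \<tau> K_ge_1 by (simp only: imp T_zero) simp
    qed
  qed
  finally show "real period * norm (T t s v) \<le> K * (K * norm v)" .
qed (rule norm_ge_zero)

text \<open>The mirror image: \<open>period\<close> copies of the orbit of z start at time 0 and
  each impulse removes one of them. From time s on nothing is left, so the response is bounded
  although the orbit need not be.\<close>

lemma unstable_halving:
  assumes t: "0 \<le> t" "t + real period * h \<le> s" and z: "z \<in> Z"
  shows "norm (T t 0 z) \<le> norm (T s 0 z) / 2"
proof (rule halving)
  \<comment> \<open>The last of the impulses, with index period - 1, falls exactly on s. The first
    still comes after t, since t + period h <= s, so all copies are present at t.\<close>
  define a where "a = s - real (period - 1) * h"
  have ph: "real period * h = real (period - 1) * h + h"
    using period(2) by (simp add: of_nat_diff algebra_simps)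
  have a: "a > t" "a \<ge> 0" "s = a + real (period - 1) * h"
    using t h_pos ph by (auto simp: a_def)
  have ak: "a + real k * h \<le> s" if "k < period" for k
    using that h_pos unfolding a(3) by (intro add_left_mono mult_right_mono) auto
  define e where "e k = - T (a + real k * h) 0 z" for k :: nat
  define c where "c \<tau> = card {k. k < period \<and> a + real k * h \<le> \<tau>}" for \<tau>
  have resp: "T \<tau> 0 (real period *\<^sub>R z) + impulses a period e \<tau>
      = (real period - real (c \<tau>)) *\<^sub>R T \<tau> 0 z" if "\<tau> \<ge> 0" for \<tau>
  proof -
    have "impulses a period e \<tau> = (\<Sum>k | k < period \<and> a + real k * h \<le> \<tau>. - T \<tau> 0 z)"
      unfolding impulses_def e_def using a h_pos by (intro sum.cong) (auto simp: cocycle T_minus)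
    then show ?thesis using that by (simp add: sum_constant_scaleR T_scaleR c_def scaleR_diff_left sum_negf)
  qed
  have c_le: "c \<tau> \<le> period" for \<tau>
    unfolding c_def using card_mono[of "{..<period}" "{k. k < period \<and> a + real k * h \<le> \<tau>}"] by auto
  have c_late: "c \<tau> = period" if "\<tau> \<ge> s" for \<tau>
  proof -
    have "{k. k < period \<and> a + real k * h \<le> \<tau>} = {..<period}"
      using ak that by (auto intro: order_trans)
    then show ?thesis by (simp add: c_def)
  qed
  have c_early: "c t = 0"
  proof -
    have "a + real k * h > t" for k using a h_pos mult_nonneg_nonneg[of "real k" h] by linarith
    then have "{k. k < period \<and> a + real k * h \<le> t} = {}" by (auto simp: not_le[symmetric])
    then show ?thesis unfolding c_def by (simp only: card.empty)
  qed
  have "real period * norm (T t 0 z) = norm (T t 0 (real period *\<^sub>R z) + impulses a period e t)"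
    using t by (simp add: resp c_early)
  also have "\<dots> \<le> K * (K * norm (T s 0 z))"
  proof (rule bounded_response[OF a(2)])
    show "0 \<le> K * norm (T s 0 z)" using K_ge_1 by simp
    show "norm (e k) \<le> K * norm (T s 0 z)" if "k < period" for k
      unfolding e_def norm_minus_cancel by (rule unstable_bound) (use a ak[OF that] z h_pos in auto)
    show "real period *\<^sub>R z \<in> Z" using Z z by (simp add: subspace_scale)
    show "t \<ge> 0" using t by simp
    fix \<tau> :: real assume \<tau>: "\<tau> \<ge> 0"
    show "norm (T \<tau> 0 (real period *\<^sub>R z) + impulses a period e \<tau>) \<le> real period * (K * norm (T s 0 z))"
    proof (cases "\<tau> \<ge> s")
      case True
      then show ?thesis using \<tau> K_ge_1 by (simp add: resp c_late)
    next
      case False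
      then have "norm (T \<tau> 0 z) \<le> K * norm (T s 0 z)" using \<tau> z by (intro unstable_bound) auto
      moreover have "\<bar>real period - real (c \<tau>)\<bar> \<le> real period" using c_le[of \<tau>] by simp
      ultimately have "\<bar>real period - real (c \<tau>)\<bar> * norm (T \<tau> 0 z) \<le> real period * (K * norm (T s 0 z))"
        by (intro mult_mono) auto
      then show ?thesis using \<tau> by (simp add: resp)
    qed
  qed
  finally show "real period * norm (T t 0 z) \<le> K * (K * norm (T s 0 z))" .
qed (rule norm_ge_zero)

lemma stable_geometric:
  assumes "0 \<le> s" "bounded_orbit s v" "t \<ge> s + real n * (real period * h)"
  shows "norm (T t s v) \<le> K * (1/2)^n * norm v"
  using assms
proof (induction n arbitrary: s v)
  case 0
  then show ?case using stable_bound[of s t v] by simp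
next
  case (Suc n)
  define u where "u = s + real period * h"
  have u: "u \<ge> s" "u \<ge> 0" "u + real n * (real period * h) \<le> t"
    using Suc.prems h_pos by (auto simp: u_def algebra_simps)
  have "0 \<le> real n * (real period * h)" using h_pos by simp
  with u have ut: "u \<le> t" by linarith
  have "norm (T t s v) = norm (T t u (T u s v))" using u ut Suc.prems by (simp add: cocycle)
  also have "\<dots> \<le> K * (1/2)^n * norm (T u s v)"
    using Suc.prems u by (intro Suc.IH bounded_orbit_T) auto
  also have "\<dots> \<le> K * (1/2)^n * (norm v / 2)"
    using Suc.prems K_ge_1 by (intro mult_left_mono stable_halving) (auto simp: u_def)
  finally show ?case by simp
qed

lemma unstable_geometric:
  assumes "0 \<le> t" "z \<in> Z" "t + real n * (real period * h) \<le> s"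
  shows "norm (T t 0 z) \<le> K * (1/2)^n * norm (T s 0 z)"
  using assms
proof (induction n arbitrary: t)
  case 0
  then show ?case using unstable_bound[of t s z] by simp
next
  case (Suc n)
  define u where "u = t + real period * h"
  have u: "u \<ge> 0" "u + real n * (real period * h) \<le> s"
    using Suc.prems h_pos by (auto simp: u_def algebra_simps)
  have "norm (T t 0 z) \<le> norm (T u 0 z) / 2"
    by (rule unstable_halving) (use Suc.prems in \<open>auto simp: u_def\<close>)
  also have "\<dots> \<le> (K * (1/2)^n * norm (T s 0 z)) / 2"
    using Suc.prems u by (intro divide_right_mono Suc.IH) auto
  finally show ?case by simp
qed

definition rate :: real where "rate = ln 2 / (real period * h)"

lemma rate_pos: "rate > 0"
  using period h_pos by (simp add: rate_def)

text \<open>Rounding d down to a multiple of period h loses at most one halving, which is the factor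
  2.\<close>

lemma geometric_to_exp:
  assumes "\<And>n. real n * (real period * h) \<le> d \<Longrightarrow> x \<le> K * (1/2)^n * y" "d \<ge> 0" "y \<ge> 0"
  shows "x \<le> 2 * K * exp (- rate * d) * y"
proof -
  define p where "p = real period * h"
  have p: "p > 0" using period h_pos by (simp add: p_def)
  define n where "n = nat \<lfloor>d / p\<rfloor>"
  have n: "real n \<le> d / p" "d / p < real n + 1"
    using assms(2) p of_int_floor_le[of "d / p"] floor_correct[of "d / p"]
    by (auto simp: n_def le_floor_iff)
  have "x \<le> K * (1/2)^n * y"
  proof (rule assms(1))
    show "real n * (real period * h) \<le> d"
      unfolding p_def[symmetric] using n(1) p by (simp add: field_simps)
  qed
  also have "(1/2::real)^n \<le> 2 * exp (- rate * d)"
  proof -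
    have "(1/2::real)^n = exp (- (ln 2 * real n))"
      by (simp add: exp_minus exp_of_nat2_mult power_one_over inverse_eq_divide)
    also have "\<dots> \<le> exp (ln 2 + - rate * d)"
    proof -
      have "ln 2 * (d / p) \<le> ln 2 * (real n + 1)" using n(2) by (intro mult_left_mono) auto
      then show ?thesis unfolding rate_def p_def[symmetric] by (simp add: algebra_simps)
    qed
    also have "\<dots> = 2 * exp (- rate * d)" by (simp add: exp_diff exp_minus divide_inverse)
    finally show ?thesis .
  qed
  finally show ?thesis using assms(3) K_ge_1 by (simp add: mult_left_mono mult_right_mono mult.assoc)
qed

theorem splitting_dichotomy:
  obtains D \<mu> where "D > 0" "\<mu> > 0"
    "\<And>s t v. 0 \<le> s \<Longrightarrow> s \<le> t \<Longrightarrow>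
       norm (T t s (v - T s 0 (lift s v))) \<le> D * exp (- \<mu> * (t - s)) * norm v"
    "\<And>s t v. 0 \<le> t \<Longrightarrow> t \<le> s \<Longrightarrow>
       norm (T t 0 (lift s v)) \<le> D * exp (- \<mu> * (s - t)) * norm v"
proof -
  \<comment> \<open>The unstable part is \<open>T s s v\<close> minus the stable part;
    \<open>T s s\<close> need not be the identity, and G is its bound.\<close>
  have Q: "norm (T s 0 (lift s v)) \<le> (K + G) * norm v" if s: "s \<ge> 0" for s v
  proof -
    have "T s 0 (lift s v) = T s s v - T s s (v - T s 0 (lift s v))"
      using s by (simp add: T_diff cocycle)
    also have "norm \<dots> \<le> G * norm v + K * norm v"
      using growth[of s s v] lift_bounds(1)[of s s v] s h_pos
      by (intro norm_triangle_le_diff add_mono) auto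
    finally show ?thesis by (simp add: algebra_simps)
  qed
  \<comment> \<open>2 K comes from \<open>geometric_to_exp\<close>; 1 + K + G bounds both components
    of v in terms of v.\<close>
  define D where "D = 2 * K * (1 + K + G)"
  have D: "D > 0" using K_ge_1 G_ge_1 by (simp add: D_def)
  show thesis
  proof (rule that[OF D rate_pos])
    fix s t v assume st: "(0::real) \<le> s" "s \<le> t"
    define w where "w = v - T s 0 (lift s v)"
    have "norm w \<le> (1 + K + G) * norm v"
      unfolding w_def by (rule norm_triangle_le_diff) (use Q[OF st(1), of v] in \<open>simp add: algebra_simps\<close>)
    moreover have "norm (T t s w) \<le> 2 * K * exp (- rate * (t - s)) * norm w"
      using st lift_works(2)[OF st(1)]
      by (intro geometric_to_exp stable_geometric) (auto simp: w_def)
    moreover have "2 * K * exp (- rate * (t - s)) * norm w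
        \<le> 2 * K * exp (- rate * (t - s)) * ((1 + K + G) * norm v)"
      using calculation(1) K_ge_1 by (intro mult_left_mono) auto
    ultimately have "norm (T t s w) \<le> 2 * K * exp (- rate * (t - s)) * ((1 + K + G) * norm v)"
      by linarith
    then show "norm (T t s (v - T s 0 (lift s v))) \<le> D * exp (- rate * (t - s)) * norm v"
      unfolding D_def w_def by (simp only: mult_ac)
  next
    fix s t v assume st: "(0::real) \<le> t" "t \<le> s"
    have "norm (T t 0 (lift s v)) \<le> 2 * K * exp (- rate * (s - t)) * norm (T s 0 (lift s v))"
      using st lift_works(1)[of s v] by (intro geometric_to_exp unstable_geometric) auto
    also have "\<dots> \<le> 2 * K * exp (- rate * (s - t)) * ((1 + K + G) * norm v)"
    proof (rule mult_left_mono)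
      have "1 * norm v + norm (T s 0 (lift s v)) \<le> 1 * norm v + (K + G) * norm v"
        using Q[of s v] st by simp
      then show "norm (T s 0 (lift s v)) \<le> (1 + K + G) * norm v"
        using norm_ge_zero[of v] unfolding distrib_right by linarith
    qed (use K_ge_1 in simp)
    finally show "norm (T t 0 (lift s v)) \<le> D * exp (- rate * (s - t)) * norm v"
      unfolding D_def by (simp only: mult_ac)
  qed
qed

end

section \<open>Linear delay equations on bounded continuous functions\<close>

text \<open>Clamping the argument to [-r, 0] places histories for every real r inside one Banach
  type. The expression \<open>history r (apply_bcontfun f) 0\<close>, frequent below, is the
  projection of f onto the clamped functions.\<close>

definition history :: "real \<Rightarrow> (real \<Rightarrow> 'b::real_normed_vector) \<Rightarrow> real \<Rightarrow> (real \<Rightarrow>\<^sub>C 'b)" where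
  "history r x t = Bcontfun (\<lambda>\<theta>. x (t + max (- r) (min 0 \<theta>)))"

lemma history_cong:
  assumes "r \<ge> 0" "\<And>u. t - r \<le> u \<Longrightarrow> u \<le> t \<Longrightarrow> x u = y u"
  shows "history r x t = history r y t"
proof -
  have "(\<lambda>\<theta>. x (t + max (- r) (min 0 \<theta>))) = (\<lambda>\<theta>. y (t + max (- r) (min 0 \<theta>)))"
    using assms by (intro ext) auto
  then show ?thesis by (simp add: history_def)
qed

lemma apply_history:
  assumes r: "r \<ge> 0" and x: "continuous_on {t - r..t} x"
  shows "apply_bcontfun (history r x t) \<theta> = x (t + max (- r) (min 0 \<theta>))"
proof -
  have rng: "t + max (- r) (min 0 \<theta>) \<in> {t - r..t}" for \<theta> using r by auto
  have "continuous_on UNIV (\<lambda>\<theta>. x (t + max (- r) (min 0 \<theta>)))"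
    by (rule continuous_on_compose2[OF x]) (use rng in \<open>auto intro!: continuous_intros\<close>)
  moreover have "bounded (range (\<lambda>\<theta>. x (t + max (- r) (min 0 \<theta>))))"
    by (rule bounded_subset[OF compact_imp_bounded[OF compact_continuous_image[OF x]]])
      (use rng in auto)
  ultimately show ?thesis
    unfolding history_def by (subst Bcontfun_inverse) (auto simp: bcontfun_def)
qed

lemma apply_history_shift:
  assumes r: "r \<ge> 0" and x: "continuous_on {t - r..t} x" and u: "t - r \<le> u" "u \<le> t"
  shows "apply_bcontfun (history r x t) (u - t) = x u"
  using u by (simp add: apply_history[OF r x] min_def max_def)

lemma norm_history_le:
  assumes r: "r \<ge> 0" and x: "continuous_on {t - r..t} x"
    and B: "\<And>u. t - r \<le> u \<Longrightarrow> u \<le> t \<Longrightarrow> norm (x u) \<le> B"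
  shows "norm (history r x t) \<le> B"
  by (rule norm_bound) (use r in \<open>auto simp: apply_history[OF r x] intro!: B\<close>)

lemma norm_history_ge:
  assumes r: "r \<ge> 0" and x: "continuous_on {t - r..t} x" and u: "t - r \<le> u" "u \<le> t"
  shows "norm (x u) \<le> norm (history r x t)"
  using norm_bounded[of "history r x t" "u - t"] apply_history_shift[OF assms] by simp

lemma history_apply:
  assumes "r \<ge> 0"
  shows "apply_bcontfun (history r (apply_bcontfun f) 0) \<theta> = apply_bcontfun f (max (- r) (min 0 \<theta>))"
  by (simp add: apply_history[OF assms])

lemma history_history:
  assumes r: "r \<ge> 0" and x: "continuous_on {t - r..t} x"
  shows "history r (apply_bcontfun (history r x t)) 0 = history r x t"
  by (rule bcontfun_eqI) (use r in \<open>auto simp: history_apply apply_history[OF r x]\<close>)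

lemma norm_history_apply_le:
  assumes "r \<ge> 0"
  shows "norm (history r (apply_bcontfun f) 0) \<le> norm f"
  using assms by (intro norm_history_le norm_bounded) auto

lemma history_add:
  assumes r: "r \<ge> 0" and x: "continuous_on {t - r..t} x" and y: "continuous_on {t - r..t} y"
  shows "history r (\<lambda>u. x u + y u) t = history r x t + history r y t"
  by (rule bcontfun_eqI)
    (simp add: apply_history[OF r x] apply_history[OF r y] apply_history[OF r continuous_on_add[OF x y]])

lemma history_diff:
  assumes r: "r \<ge> 0" and x: "continuous_on {t - r..t} x" and y: "continuous_on {t - r..t} y"
  shows "history r (\<lambda>u. x u - y u) t = history r x t - history r y t"
  by (rule bcontfun_eqI)
    (simp add: apply_history[OF r x] apply_history[OF r y] apply_history[OF r continuous_on_diff[OF x y]])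

lemma history_scaleR:
  assumes r: "r \<ge> 0" and x: "continuous_on {t - r..t} x"
  shows "history r (\<lambda>u. c *\<^sub>R x u) t = c *\<^sub>R history r x t"
  by (rule bcontfun_eqI)
    (simp add: apply_history[OF r x] apply_history[OF r continuous_on_scaleR[OF continuous_on_const x]])

lemma history_sum:
  assumes r: "r \<ge> 0" and x: "\<And>i. i \<in> I \<Longrightarrow> continuous_on {t - r..t} (x i)"
  shows "history r (\<lambda>u. \<Sum>i\<in>I. x i u) t = (\<Sum>i\<in>I. history r (x i) t)"
  using x
proof (induction I rule: infinite_finite_induct)
  case (insert i I)
  then show ?case
    by (simp add: history_add[OF r] continuous_on_sum)
qed (auto intro!: bcontfun_eqI simp: apply_history[OF r] continuous_on_const)

text \<open>Uniform continuity of x on compact intervals makes its translates vary continuously in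
  the supremum norm. This is what makes the right-hand side of the equation continuous in
  time.\<close>

lemma continuous_on_history:
  assumes r: "r \<ge> 0" and x: "continuous_on {a..} x"
  shows "continuous_on {a + r..} (history r x)"
  unfolding continuous_on_iff
proof (intro ballI allI impI)
  fix t e :: real assume t: "t \<in> {a + r..}" and e: "e > 0"
  have "uniformly_continuous_on {a..t + 1} x"
    by (intro compact_uniformly_continuous continuous_on_subset[OF x]) auto
  then obtain d where d: "d > 0"
    "\<And>u v. u \<in> {a..t + 1} \<Longrightarrow> v \<in> {a..t + 1} \<Longrightarrow> dist v u < d \<Longrightarrow> dist (x v) (x u) < e / 2"
    unfolding uniformly_continuous_on_def using e by (meson half_gt_zero)
  show "\<exists>d>0. \<forall>t'\<in>{a + r..}. dist t' t < d \<longrightarrow> dist (history r x t') (history r x t) < e"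
  proof (intro exI[of _ "min d 1"] conjI ballI impI)
    show "min d 1 > 0" using d by simp
    fix t' assume t': "t' \<in> {a + r..}" "dist t' t < min d 1"
    have c: "continuous_on {u - r..u} x" if "u \<ge> a + r" for u
      by (rule continuous_on_subset[OF x]) (use that in auto)
    have "dist (history r x t') (history r x t) \<le> e / 2"
    proof (rule dist_bound)
      fix \<theta>
      have "dist (x (t' + max (- r) (min 0 \<theta>))) (x (t + max (- r) (min 0 \<theta>))) < e / 2"
        using t t' r by (intro d(2)) (auto simp: dist_real_def)
      then show "dist (apply_bcontfun (history r x t') \<theta>) (apply_bcontfun (history r x t) \<theta>) \<le> e / 2"
        using t t' by (simp add: apply_history[OF r c])
    qed
    then show "dist (history r x t') (history r x t) < e" using e by simp
  qed
qed

section \<open>Derivatives on a half-line and exponential comparison\<close>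

lemma has_vector_derivative_Ici_at:
  fixes a t :: real
  assumes "(x has_vector_derivative x') (at t within {a..})" "a < t"
  shows "(x has_vector_derivative x') (at t)"
  using assms by (simp add: at_within_interior[of t "{a..}"] interior_Ici[of "a - 1" a])

text \<open>Integrating an exponential weight gains the factor 1 / l. With l large against the
  Lipschitz constant, this gain closes both the a priori estimate and the contraction argument
  below.\<close>

lemma exp_derivative_bound:
  fixes x :: "real \<Rightarrow> 'b::real_normed_vector"
  assumes x: "\<And>t. a \<le> t \<Longrightarrow> t \<le> b \<Longrightarrow> (x has_vector_derivative x' t) (at t within {a..})"
    and bd: "\<And>t. a \<le> t \<Longrightarrow> t \<le> b \<Longrightarrow> norm (x' t) \<le> C * exp (l * (t - a))"
    and l: "l > 0" and ab: "a \<le> b" and C: "C \<ge> 0"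
  shows "norm (x b - x a) \<le> C / l * exp (l * (b - a))"
proof (cases "a = b")
  case True
  then show ?thesis using l C by simp
next
  case False
  have "norm (x b - x a) \<le> C / l * exp (l * (b - a)) - C / l * exp (l * (a - a))"
  proof (rule differentiable_bound_general[where f' = x' and \<phi>' = "\<lambda>t. C * exp (l * (t - a))"])
    show "a < b" using False ab by simp
    show "continuous_on {a..b} x"
      unfolding continuous_on_eq_continuous_within
    proof
      fix t assume t: "t \<in> {a..b}"
      then have "continuous (at t within {a..}) x"
        using x[of t] by (auto intro: has_vector_derivative_continuous)
      then show "continuous (at t within {a..b}) x" by (rule continuous_within_subset) auto
    qed
    show "continuous_on {a..b} (\<lambda>t. C / l * exp (l * (t - a)))" by (intro continuous_intros)
    fix t assume t: "a < t" "t < b"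
    show "(x has_vector_derivative x' t) (at t)"
      using x[of t] t by (intro has_vector_derivative_Ici_at[of x _ t a]) auto
    show "((\<lambda>t. C / l * exp (l * (t - a))) has_vector_derivative C * exp (l * (t - a))) (at t)"
      unfolding has_real_derivative_iff_has_vector_derivative[symmetric]
      using l by (auto intro!: derivative_eq_intros)
    show "norm (x' t) \<le> C * exp (l * (t - a))" using bd t by simp
  qed
  also have "\<dots> \<le> C / l * exp (l * (b - a))" using l C by simp
  finally show ?thesis .
qed

lemma integral_has_vector_derivative_Ici:
  fixes f :: "real \<Rightarrow> 'b::banach"
  assumes f: "continuous_on {a..} f" and t: "t \<ge> a"
  shows "((\<lambda>u. integral {a..u} f) has_vector_derivative f t) (at t within {a..})"
proof -
  have "((\<lambda>u. integral {a..u} f) has_vector_derivative f t) (at t within {a..t + 1})"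
    by (rule integral_has_vector_derivative) (use t in \<open>auto intro: continuous_on_subset[OF f]\<close>)
  moreover have "at t within {a..t + 1} = at t within {a..}"
    by (rule at_within_nhd[of _ "{t - 1<..<t + 1}"]) auto
  ultimately show ?thesis by simp
qed

locale delay_equation =
  fixes r :: real and L :: "real \<Rightarrow> (real \<Rightarrow>\<^sub>C 'b::euclidean_space) \<Rightarrow>\<^sub>L 'b" and M :: real
  assumes r_nonneg: "r \<ge> 0"
    and L_cont: "continuous_on {0..} L"
    and L_bound: "\<And>t. t \<ge> 0 \<Longrightarrow> norm (L t) \<le> M"
begin

definition solution :: "real \<Rightarrow> (real \<Rightarrow> 'b) \<Rightarrow> bool" where
  "solution s x \<longleftrightarrow> continuous_on {s - r..} x \<and>
     (\<forall>t\<ge>s. (x has_vector_derivative L t (history r x t)) (at t within {s..}))"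

lemma M_nonneg: "M \<ge> 0"
  using L_bound[of 0] norm_ge_zero order_trans by blast

text \<open>More than twice \<open>M\<close>, so that M / (2 M + 1) < 1/2 is the norm of the
  weighted integral operator; the 1 keeps the rate positive when M = 0.\<close>

definition growth_rate :: real where "growth_rate = 2 * M + 1"

lemma growth_rate_pos: "growth_rate > 0"
  using M_nonneg by (simp add: growth_rate_def)

lemma norm_L_le: "t \<ge> 0 \<Longrightarrow> norm (L t f) \<le> M * norm f"
  using norm_blinfun[of "L t" f] L_bound[of t] by (meson mult_right_mono norm_ge_zero order_trans)

text \<open>Let m be the maximum of |w(t)| exp(- l (t - s)) on [s, b]. The weight increases with
  time, so the delayed values satisfy the same bound as the current one, and the delay costs
  nothing. Integrating the equation up to the maximum point returns m with a factor below 1/2, which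
  is absorbed.\<close>

lemma gronwall:
  assumes s: "s \<ge> 0" and \<delta>: "\<delta> \<ge> 0" and w: "continuous_on {s - r..} w"
    and w': "\<And>t. t \<ge> s \<Longrightarrow> (w has_vector_derivative w' t) (at t within {s..})"
    and res: "\<And>t. t \<ge> s \<Longrightarrow> norm (w' t - L t (history r w t)) \<le> \<delta>"
    and b: "b \<ge> s"
  shows "norm (history r w b) \<le> (3 * norm (history r w s) + 2 * \<delta>) * exp (growth_rate * (b - s))"
proof -
  define l where "l = growth_rate"
  have l: "l > 0" "l = 2 * M + 1" using growth_rate_pos by (auto simp: l_def growth_rate_def)
  define W where "W = norm (history r w s)"
  have cont: "continuous_on {t - r..t} w" if "t \<ge> s" for t
    by (rule continuous_on_subset[OF w]) (use that in auto)
  have W: "norm (w u) \<le> W" if "s - r \<le> u" "u \<le> s" for u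
    unfolding W_def by (rule norm_history_ge[OF r_nonneg cont]) (use that in auto)
  have "W \<ge> 0" by (simp add: W_def)
  have g_cont: "continuous_on {s..b} (\<lambda>t. norm (w t) * exp (- l * (t - s)))"
    by (intro continuous_intros continuous_on_subset[OF w]) (use r_nonneg in auto)
  have "{s..b} \<noteq> {}" using b by simp
  from continuous_attains_sup[OF compact_Icc this g_cont] obtain t0 where t0: "t0 \<in> {s..b}"
    "\<forall>t\<in>{s..b}. norm (w t) * exp (- l * (t - s)) \<le> norm (w t0) * exp (- l * (t0 - s))"
    by blast
  define m where "m = norm (w t0) * exp (- l * (t0 - s))"
  have "m \<ge> 0" by (simp add: m_def)
  have m: "norm (w t) \<le> m * exp (l * (t - s))" if "t \<in> {s..b}" for t
  proof -
    have "norm (w t) = norm (w t) * exp (- l * (t - s)) * exp (l * (t - s))"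
      by (simp add: exp_minus)
    also have "\<dots> \<le> m * exp (l * (t - s))" using t0 that by (intro mult_right_mono) (auto simp: m_def)
    finally show ?thesis .
  qed
  have ge1: "exp (l * (t - s)) \<ge> 1" if "t \<ge> s" for t using that l by simp
  have hist: "norm (history r w t) \<le> max W (m * exp (l * (t - s)))" if t: "t \<in> {s..b}" for t
  proof (rule norm_history_le[OF r_nonneg cont])
    fix u assume u: "t - r \<le> u" "u \<le> t"
    show "norm (w u) \<le> max W (m * exp (l * (t - s)))"
    proof (cases "u \<le> s")
      case True
      then show ?thesis using W[of u] u t by (simp add: le_max_iff_disj)
    next
      case False
      then have "norm (w u) \<le> m * exp (l * (u - s))" using u t by (intro m) auto
      also have "\<dots> \<le> m * exp (l * (t - s))" using u l \<open>m \<ge> 0\<close> by (intro mult_left_mono) auto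
      finally show ?thesis by (simp add: le_max_iff_disj)
    qed
  qed (use t in auto)
  have hist': "norm (history r w t) \<le> (W + m) * exp (l * (t - s))" if t: "t \<in> {s..b}" for t
  proof -
    have "W \<le> W * exp (l * (t - s))" using ge1[of t] t \<open>W \<ge> 0\<close> by (simp add: mult_le_cancel_left1)
    moreover have "0 \<le> m * exp (l * (t - s))" "0 \<le> W * exp (l * (t - s))"
      using \<open>m \<ge> 0\<close> \<open>W \<ge> 0\<close> by auto
    ultimately have "max W (m * exp (l * (t - s))) \<le> W * exp (l * (t - s)) + m * exp (l * (t - s))"
      by (intro max.boundedI) linarith+
    then show ?thesis using hist[OF t] unfolding distrib_right by linarith
  qed
  have bd: "norm (w' t) \<le> (M * (W + m) + \<delta>) * exp (l * (t - s))" if t: "t \<in> {s..b}" for t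
  proof -
    have "norm (w' t) \<le> norm (L t (history r w t)) + norm (w' t - L t (history r w t))"
      by (rule norm_triangle_sub)
    also have "\<dots> \<le> M * ((W + m) * exp (l * (t - s))) + \<delta> * exp (l * (t - s))"
    proof (rule add_mono)
      have "norm (L t (history r w t)) \<le> M * norm (history r w t)" using t s by (intro norm_L_le) auto
      also have "\<dots> \<le> M * ((W + m) * exp (l * (t - s)))"
        using hist'[OF t] M_nonneg by (rule mult_left_mono)
      finally show "norm (L t (history r w t)) \<le> M * ((W + m) * exp (l * (t - s)))" .
      have "norm (w' t - L t (history r w t)) \<le> \<delta>" using res t by auto
      also have "\<delta> \<le> \<delta> * exp (l * (t - s))" using ge1[of t] t \<delta> by (simp add: mult_le_cancel_left1)
      finally show "norm (w' t - L t (history r w t)) \<le> \<delta> * exp (l * (t - s))" .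
    qed
    finally show ?thesis by (simp add: algebra_simps)
  qed
  define c where "c = (M * (W + m) + \<delta>) / l"
  have "norm (w t0 - w s) \<le> c * exp (l * (t0 - s))"
    unfolding c_def
    by (rule exp_derivative_bound[where x' = w'])
      (use t0 w' bd l M_nonneg \<delta> \<open>W \<ge> 0\<close> \<open>m \<ge> 0\<close> in auto)
  moreover have "norm (w t0) \<le> norm (w s) + norm (w t0 - w s)" by (rule norm_triangle_sub)
  moreover have "norm (w s) \<le> W * exp (l * (t0 - s))"
  proof -
    have "norm (w s) \<le> W" using W[of s] r_nonneg by simp
    also have "\<dots> \<le> W * exp (l * (t0 - s))" using ge1[of t0] t0 \<open>W \<ge> 0\<close> by (simp add: mult_le_cancel_left1)
    finally show ?thesis .
  qed
  moreover have "norm (w t0) = m * exp (l * (t0 - s))" by (simp add: m_def exp_minus)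
  ultimately have "m * exp (l * (t0 - s)) \<le> (W + c) * exp (l * (t0 - s))"
    unfolding distrib_right by linarith
  then have "m \<le> W + c" by simp
  then have "l * m \<le> l * (W + c)" using l by (intro mult_left_mono) auto
  also have "\<dots> = l * W + (M * (W + m) + \<delta>)"
  proof -
    have "l * c = M * (W + m) + \<delta>" using l(1) by (simp add: c_def)
    then show ?thesis unfolding distrib_left[of l W c] by simp
  qed
  finally have "(2 * M + 1) * m \<le> (2 * M + 1) * W + (M * (W + m) + \<delta>)" by (simp add: l)
  \<comment> \<open>Absorbing M m leaves (3 M + 1) W + \<delta> on the right, rounded up to (M + 1)
    (3 W + 2 \<delta>). Here the constants 3 and 2 arise.\<close>
  then have "(M + 1) * m \<le> (M + 1) * (3 * W + 2 * \<delta>)"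
    using \<delta> \<open>W \<ge> 0\<close> mult_nonneg_nonneg[OF M_nonneg \<delta>] mult_nonneg_nonneg[OF M_nonneg \<open>W \<ge> 0\<close>]
    by (simp add: algebra_simps)
  then have "m \<le> 3 * W + 2 * \<delta>" using M_nonneg by (simp add: mult_le_cancel_left)
  then have "m * exp (l * (b - s)) \<le> (3 * W + 2 * \<delta>) * exp (l * (b - s))" by simp
  moreover have "W \<le> (3 * W + 2 * \<delta>) * exp (l * (b - s))"
  proof -
    have "W * 1 \<le> (3 * W + 2 * \<delta>) * exp (l * (b - s))"
      using ge1[OF b] \<open>W \<ge> 0\<close> \<delta> by (intro mult_mono) auto
    then show ?thesis by simp
  qed
  ultimately have "max W (m * exp (l * (b - s))) \<le> (3 * W + 2 * \<delta>) * exp (l * (b - s))"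
    by (rule max.boundedI[rotated])
  with hist[of b] b show ?thesis unfolding W_def l_def by (meson atLeastAtMost_iff order_refl order_trans)
qed

lemma solution_continuous: "solution s x \<Longrightarrow> t \<ge> s \<Longrightarrow> continuous_on {t - r..t} x"
  unfolding solution_def by (auto intro: continuous_on_subset)

lemma solution_diff:
  assumes "solution s x" "solution s y"
  shows "solution s (\<lambda>t. x t - y t)"
  using assms solution_continuous[OF assms(1)] solution_continuous[OF assms(2)]
  unfolding solution_def
  by (auto intro!: continuous_intros derivative_eq_intros simp: history_diff[OF r_nonneg] blinfun.diff_right)

lemma solution_add:
  assumes "solution s x" "solution s y"
  shows "solution s (\<lambda>t. x t + y t)"
  using assms solution_continuous[OF assms(1)] solution_continuous[OF assms(2)]
  unfolding solution_def
  by (auto intro!: continuous_intros derivative_eq_intros simp: history_add[OF r_nonneg] blinfun.add_right)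

lemma solution_scaleR:
  assumes "solution s x"
  shows "solution s (\<lambda>t. c *\<^sub>R x t)"
  using assms solution_continuous[OF assms(1)]
  unfolding solution_def
  by (auto intro!: continuous_intros derivative_eq_intros simp: history_scaleR[OF r_nonneg] blinfun.scaleR_right)

lemma solution_growth:
  assumes "s \<ge> 0" "solution s x" "t \<ge> s"
  shows "norm (history r x t) \<le> 3 * exp (growth_rate * (t - s)) * norm (history r x s)"
proof -
  have "norm (history r x t) \<le> (3 * norm (history r x s) + 2 * 0) * exp (growth_rate * (t - s))"
    using assms unfolding solution_def by (intro gronwall[where w' = "\<lambda>t. L t (history r x t)"]) auto
  then show ?thesis by (simp add: mult_ac)
qed

lemma solution_unique:
  assumes s: "s \<ge> 0" and x: "solution s x" and y: "solution s y"
    and eq: "history r x s = history r y s" and u: "u \<ge> s - r"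
  shows "x u = y u"
proof -
  note c = solution_continuous[OF x] solution_continuous[OF y]
  define t where "t = max s u"
  have t: "t \<ge> s" "t - r \<le> u" "u \<le> t" using u r_nonneg by (auto simp: t_def)
  have "norm (history r (\<lambda>t. x t - y t) t)
      \<le> 3 * exp (growth_rate * (t - s)) * norm (history r (\<lambda>t. x t - y t) s)"
    by (rule solution_growth[OF s solution_diff[OF x y] t(1)])
  also have "\<dots> = 0" using eq by (simp add: history_diff[OF r_nonneg] c)
  finally have "norm (x u - y u) \<le> 0"
    using norm_history_ge[OF r_nonneg _ t(2,3), of "\<lambda>t. x t - y t"] c t
    by (fastforce intro: continuous_on_diff)
  then show ?thesis by simp
qed

lemma solution_restrict:
  assumes "solution u x" "u \<le> s"
  shows "solution s x"
  unfolding solution_def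
proof (intro conjI allI impI)
  show "continuous_on {s - r..} x"
    by (rule continuous_on_subset[of "{u - r..}"]) (use assms in \<open>auto simp: solution_def\<close>)
  fix t assume "t \<ge> s"
  then show "(x has_vector_derivative L t (history r x t)) (at t within {s..})"
    using assms by (auto simp: solution_def intro: has_vector_derivative_within_subset[where S = "{u..}"])
qed

text \<open>A fixed point argument in an exponentially weighted norm: the unknown is b with x =
  \<phi> + exp(l (t - s)) b, sought among the bounded continuous functions on the whole line. The
  weight makes the integral operator a contraction globally, so no continuation from interval to
  interval is needed.\<close>

lemma solution_exists:
  assumes s: "s \<ge> 0"
  shows "\<exists>x. solution s x \<and> history r x s = history r (apply_bcontfun f) 0"
proof -
  define l where "l = growth_rate"
  have l: "l > 0" "l = 2 * M + 1" using growth_rate_pos by (auto simp: l_def growth_rate_def)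
  \<comment> \<open>The initial history, frozen at its end values on both sides.\<close>
  define \<phi> where "\<phi> t = apply_bcontfun f (max (- r) (min 0 (t - s)))" for t
  define xb where "xb b t = \<phi> t + exp (l * (t - s)) *\<^sub>R apply_bcontfun b t" for b :: "real \<Rightarrow>\<^sub>C 'b" and t
  define F where "F b t = L t (history r (xb b) t)" for b t
  \<comment> \<open>\<open>max s t\<close> makes the integral vanish to the left of s, so a fixed
    point keeps the prescribed history there.\<close>
  define g where "g b t = exp (- l * (max s t - s)) *\<^sub>R integral {s..max s t} (F b)" for b t
  have \<phi>_cont: "continuous_on A \<phi>" for A
    unfolding \<phi>_def
    by (rule continuous_on_compose2[OF continuous_on_apply_bcontfun[of UNIV]]) (auto intro!: continuous_intros)
  have xb_cont: "continuous_on A (xb b)" for A b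
    unfolding xb_def by (intro continuous_intros \<phi>_cont continuous_on_apply_bcontfun)
  have F_cont: "continuous_on {s..} (F b)" for b
  proof -
    have "continuous_on {s - r + r..} (history r (xb b))"
      by (rule continuous_on_history[OF r_nonneg xb_cont])
    then show ?thesis
      unfolding F_def using s by (intro continuous_intros continuous_on_subset[OF L_cont]) auto
  qed
  define I where "I b t = integral {s..t} (F b)" for b t
  have I_deriv: "(I b has_vector_derivative F b t) (at t within {s..})" if "t \<ge> s" for b t
    unfolding I_def by (rule integral_has_vector_derivative_Ici[OF F_cont that])
  have I_s: "I b s = 0" for b by (simp add: I_def)
  have I_cont: "continuous_on {s..} (I b)" for b
    unfolding continuous_on_eq_continuous_within
    using I_deriv has_vector_derivative_continuous by blast
  have g_eq: "g b t = exp (- l * (max s t - s)) *\<^sub>R I b (max s t)" for b t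
    by (simp add: g_def I_def)
  have g_cont: "continuous_on UNIV (g b)" for b
    unfolding g_eq by (intro continuous_intros continuous_on_compose2[OF I_cont]) auto
  have ge1: "exp (l * (t - s)) \<ge> 1" if "t \<ge> s" for t using that l by simp
  have hist_le: "norm (history r (xb b) t) \<le> (norm f + norm b) * exp (l * (t - s))" if t: "t \<ge> s" for b t
  proof (rule norm_history_le[OF r_nonneg xb_cont])
    fix u assume u: "t - r \<le> u" "u \<le> t"
    have "norm (xb b u) \<le> norm (\<phi> u) + exp (l * (u - s)) * norm (apply_bcontfun b u)"
      unfolding xb_def by (rule order_trans[OF norm_triangle_ineq]) simp
    also have "\<dots> \<le> norm f * exp (l * (t - s)) + exp (l * (t - s)) * norm b"
    proof (rule add_mono)
      have "norm (\<phi> u) \<le> norm f * 1" by (simp add: \<phi>_def norm_bounded)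
      also have "\<dots> \<le> norm f * exp (l * (t - s))" using ge1[OF t] by (intro mult_left_mono) auto
      finally show "norm (\<phi> u) \<le> norm f * exp (l * (t - s))" .
      show "exp (l * (u - s)) * norm (apply_bcontfun b u) \<le> exp (l * (t - s)) * norm b"
        using u l by (intro mult_mono norm_bounded) auto
    qed
    finally show "norm (xb b u) \<le> (norm f + norm b) * exp (l * (t - s))" by (simp add: algebra_simps)
  qed
  have hist_diff: "norm (history r (xb b) t - history r (xb b') t) \<le> norm (b - b') * exp (l * (t - s))"
    if t: "t \<ge> s" for b b' t
  proof -
    have "history r (xb b) t - history r (xb b') t = history r (\<lambda>u. xb b u - xb b' u) t"
      by (simp add: history_diff[OF r_nonneg xb_cont xb_cont])
    also have "norm \<dots> \<le> norm (b - b') * exp (l * (t - s))"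
    proof (rule norm_history_le[OF r_nonneg continuous_on_diff[OF xb_cont xb_cont]])
      fix u assume u: "t - r \<le> u" "u \<le> t"
      have "norm (xb b u - xb b' u) = exp (l * (u - s)) * norm (apply_bcontfun (b - b') u)"
        by (simp add: xb_def scaleR_diff_right[symmetric])
      also have "\<dots> \<le> exp (l * (t - s)) * norm (b - b')"
        using u l by (intro mult_mono norm_bounded) auto
      finally show "norm (xb b u - xb b' u) \<le> norm (b - b') * exp (l * (t - s))"
        by (simp add: mult.commute)
    qed
    finally show ?thesis .
  qed
  have I_le: "norm (I b t) \<le> M * (norm f + norm b) / l * exp (l * (t - s))" if t: "t \<ge> s" for b t
  proof -
    have "norm (I b t - I b s) \<le> M * (norm f + norm b) / l * exp (l * (t - s))"
    proof (rule exp_derivative_bound[where x' = "F b"])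
      fix u assume u: "s \<le> u" "u \<le> t"
      then show "(I b has_vector_derivative F b u) (at u within {s..})" by (intro I_deriv)
      have "norm (F b u) \<le> M * norm (history r (xb b) u)"
        unfolding F_def using u s by (intro norm_L_le) auto
      also have "\<dots> \<le> M * ((norm f + norm b) * exp (l * (u - s)))"
        using u M_nonneg by (intro mult_left_mono hist_le) auto
      finally show "norm (F b u) \<le> M * (norm f + norm b) * exp (l * (u - s))" by (simp add: mult.assoc)
    qed (use t l M_nonneg in auto)
    then show ?thesis by (simp add: I_s)
  qed
  have I_diff: "norm (I b t - I b' t) \<le> M * norm (b - b') / l * exp (l * (t - s))" if t: "t \<ge> s" for b b' t
  proof -
    have "norm ((I b t - I b' t) - (I b s - I b' s)) \<le> M * norm (b - b') / l * exp (l * (t - s))"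
    proof (rule exp_derivative_bound[where x' = "\<lambda>u. F b u - F b' u" and x = "\<lambda>t. I b t - I b' t"])
      fix u assume u: "s \<le> u" "u \<le> t"
      then show "((\<lambda>t. I b t - I b' t) has_vector_derivative F b u - F b' u) (at u within {s..})"
        by (intro derivative_intros I_deriv)
      have "norm (F b u - F b' u) = norm (L u (history r (xb b) u - history r (xb b') u))"
        unfolding F_def by (simp add: blinfun.diff_right)
      also have "\<dots> \<le> M * norm (history r (xb b) u - history r (xb b') u)"
        using u s by (intro norm_L_le) auto
      also have "\<dots> \<le> M * (norm (b - b') * exp (l * (u - s)))"
        using u M_nonneg by (intro mult_left_mono hist_diff) auto
      finally show "norm (F b u - F b' u) \<le> M * norm (b - b') * exp (l * (u - s))" by (simp add: mult.assoc)
    qed (use t l M_nonneg in auto)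
    then show ?thesis by (simp add: I_s)
  qed
  have exp_cancel: "exp (- l * (u - s)) * (c * exp (l * (u - s))) = c" for c u
    by (simp add: exp_minus)
  have g_le: "norm (g b t) \<le> M * (norm f + norm b) / l" for b t
  proof -
    have "norm (g b t) = exp (- l * (max s t - s)) * norm (I b (max s t))" by (simp add: g_eq)
    also have "\<dots> \<le> exp (- l * (max s t - s)) * (M * (norm f + norm b) / l * exp (l * (max s t - s)))"
      by (intro mult_left_mono I_le) auto
    finally show ?thesis by (simp only: exp_cancel)
  qed
  have g_bcont: "g b \<in> bcontfun" for b by (rule bcontfun_normI[OF g_cont g_le])
  have app: "apply_bcontfun (Bcontfun (g b)) = g b" for b by (rule Bcontfun_inverse[OF g_bcont])
  have "\<exists>!b. Bcontfun (g b) = b"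
  proof (rule banach_fix_type[of "1/2"])
    show "\<forall>b b'. dist (Bcontfun (g b)) (Bcontfun (g b')) \<le> 1/2 * dist b b'"
    proof (intro allI dist_bound)
      fix b b' t
      have "norm (g b t - g b' t) = exp (- l * (max s t - s)) * norm (I b (max s t) - I b' (max s t))"
        by (simp add: g_eq scaleR_diff_right[symmetric])
      also have "\<dots> \<le> exp (- l * (max s t - s)) * (M * norm (b - b') / l * exp (l * (max s t - s)))"
        by (intro mult_left_mono I_diff) auto
      also have "\<dots> = (M / l) * norm (b - b')" by (simp only: exp_cancel) simp
      also have "\<dots> \<le> 1/2 * norm (b - b')"
        using M_nonneg by (intro mult_right_mono) (auto simp: l divide_simps)
      finally show "dist (apply_bcontfun (Bcontfun (g b)) t) (apply_bcontfun (Bcontfun (g b')) t) \<le> 1/2 * dist b b'"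
        by (simp add: app dist_norm)
    qed
  qed auto
  then obtain b where "Bcontfun (g b) = b" by blast
  then have b: "apply_bcontfun b t = g b t" for t using app[of b] by metis
  have xb: "xb b t = (if t \<ge> s then apply_bcontfun f 0 + I b t else \<phi> t)" for t
  proof (cases "t \<ge> s")
    case True
    then have "max s t = t" by simp
    with True r_nonneg show ?thesis by (simp add: xb_def b g_eq \<phi>_def exp_minus)
  next
    case False
    then have "max s t = s" by simp
    with False show ?thesis by (simp add: xb_def b g_eq I_s)
  qed
  show ?thesis
  proof (intro exI conjI)
    show "solution s (xb b)"
      unfolding solution_def
    proof (intro conjI xb_cont allI impI)
      fix t assume t: "t \<ge> s"
      have "((\<lambda>u. apply_bcontfun f 0 + I b u) has_vector_derivative 0 + F b t) (at t within {s..})"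
        by (intro derivative_intros I_deriv t)
      then have "(xb b has_vector_derivative 0 + F b t) (at t within {s..})"
        by (rule has_vector_derivative_transform[rotated 2]) (use t in \<open>auto simp: xb\<close>)
      then show "(xb b has_vector_derivative L t (history r (xb b) t)) (at t within {s..})"
        by (simp add: F_def)
    qed
    have "history r (xb b) s = history r \<phi> s"
      by (rule history_cong[OF r_nonneg]) (auto simp: xb I_s \<phi>_def r_nonneg)
    also have "\<dots> = history r (apply_bcontfun f) 0"
      by (rule bcontfun_eqI)
        (use r_nonneg in \<open>simp add: history_apply apply_history[OF r_nonneg \<phi>_cont] \<phi>_def\<close>)
    finally show "history r (xb b) s = history r (apply_bcontfun f) 0" .
  qed
qed

text \<open>The choice is immaterial: two candidates agree on [s - r, \<infinity>), and only
  histories at times from s on are read off.\<close>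

definition flow :: "real \<Rightarrow> (real \<Rightarrow>\<^sub>C 'b) \<Rightarrow> real \<Rightarrow> 'b" where
  "flow s f = (SOME x. solution s x \<and> history r x s = history r (apply_bcontfun f) 0)"

definition evolution :: "real \<Rightarrow> real \<Rightarrow> (real \<Rightarrow>\<^sub>C 'b) \<Rightarrow> (real \<Rightarrow>\<^sub>C 'b)" where
  "evolution t s f = history r (flow s f) t"

lemma flow:
  assumes "s \<ge> 0"
  shows "solution s (flow s f)" "history r (flow s f) s = history r (apply_bcontfun f) 0"
  using someI_ex[OF solution_exists[OF assms, of f]] by (auto simp: flow_def)

lemma evolution_eqI:
  assumes s: "0 \<le> s" "s \<le> t" and x: "solution s x" "history r x s = history r (apply_bcontfun f) 0"
  shows "evolution t s f = history r x t"
  unfolding evolution_def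
proof (rule history_cong[OF r_nonneg])
  fix u assume "t - r \<le> u" "u \<le> t"
  then show "flow s f u = x u"
    using s x flow[OF s(1), of f] by (intro solution_unique[OF s(1)]) auto
qed

lemma evolution_solution:
  assumes "0 \<le> s" "s \<le> t" "solution s x"
  shows "evolution t s (history r x s) = history r x t"
  using assms history_history[OF r_nonneg solution_continuous[OF assms(3)], of s]
  by (intro evolution_eqI) auto

lemma evolution_norm:
  assumes "0 \<le> s" "s \<le> t"
  shows "norm (evolution t s f) \<le> 3 * exp (growth_rate * (t - s)) * norm f"
proof -
  have "norm (evolution t s f) \<le> 3 * exp (growth_rate * (t - s)) * norm (history r (flow s f) s)"
    unfolding evolution_def using assms by (intro solution_growth flow) auto
  also have "\<dots> \<le> 3 * exp (growth_rate * (t - s)) * norm f"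
    using assms by (intro mult_left_mono) (auto simp: flow norm_history_apply_le[OF r_nonneg])
  finally show ?thesis .
qed

lemma evolution_add:
  assumes "0 \<le> s" "s \<le> t"
  shows "evolution t s (f + g) = evolution t s f + evolution t s g"
proof -
  note fg = flow[OF assms(1), of f] flow[OF assms(1), of g]
  have c: "continuous_on {u - r..u} (flow s f)" "continuous_on {u - r..u} (flow s g)" if "u \<ge> s" for u
    using fg that by (auto intro: solution_continuous)
  have "evolution t s (f + g) = history r (\<lambda>u. flow s f u + flow s g u) t"
  proof (rule evolution_eqI[OF assms solution_add[OF fg(1) fg(3)]])
    have "history r (\<lambda>u. flow s f u + flow s g u) s
        = history r (apply_bcontfun f) 0 + history r (apply_bcontfun g) 0"
      using fg by (simp add: history_add[OF r_nonneg c])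
    also have "\<dots> = history r (apply_bcontfun (f + g)) 0"
      by (rule bcontfun_eqI)
        (use history_apply[OF r_nonneg, of "f + g"] in \<open>simp add: history_apply[OF r_nonneg]\<close>)
    finally show "history r (\<lambda>u. flow s f u + flow s g u) s = history r (apply_bcontfun (f + g)) 0" .
  qed
  then show ?thesis using assms by (simp add: history_add[OF r_nonneg c] evolution_def)
qed

lemma evolution_scaleR:
  assumes "0 \<le> s" "s \<le> t"
  shows "evolution t s (c *\<^sub>R f) = c *\<^sub>R evolution t s f"
proof -
  note f = flow[OF assms(1), of f]
  have cont: "continuous_on {u - r..u} (flow s f)" if "u \<ge> s" for u
    using f that by (auto intro: solution_continuous)
  have "evolution t s (c *\<^sub>R f) = history r (\<lambda>u. c *\<^sub>R flow s f u) t"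
  proof (rule evolution_eqI[OF assms solution_scaleR[OF f(1)]])
    have "history r (\<lambda>u. c *\<^sub>R flow s f u) s = c *\<^sub>R history r (apply_bcontfun f) 0"
      using f by (simp add: history_scaleR[OF r_nonneg cont])
    also have "\<dots> = history r (apply_bcontfun (c *\<^sub>R f)) 0"
      by (rule bcontfun_eqI)
        (use history_apply[OF r_nonneg, of "c *\<^sub>R f"] in \<open>simp add: history_apply[OF r_nonneg]\<close>)
    finally show "history r (\<lambda>u. c *\<^sub>R flow s f u) s = history r (apply_bcontfun (c *\<^sub>R f)) 0" .
  qed
  then show ?thesis using assms by (simp add: history_scaleR[OF r_nonneg cont] evolution_def)
qed

lemma evolution_cocycle:
  assumes "0 \<le> u" "u \<le> s" "s \<le> t"
  shows "evolution t s (evolution s u f) = evolution t u f"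
  unfolding evolution_def[of _ u f]
  by (rule evolution_solution) (use assms flow[OF assms(1), of f] solution_restrict in auto)

lemma evolution_evolution_family:
  assumes "h > 0"
  shows "evolution_family evolution h (3 * exp (growth_rate * h))"
proof (rule evolution_family.intro)
  fix s t :: real assume st: "0 \<le> s" "s \<le> t"
  show "bounded_linear (evolution t s)"
    using st evolution_norm[OF st]
    by (intro bounded_linear_intro[where K = "3 * exp (growth_rate * (t - s))"])
      (auto simp: evolution_add evolution_scaleR mult.commute)
next
  fix s t v assume st: "(0::real) \<le> s" "s \<le> t" "t \<le> s + h"
  have "norm (evolution t s v) \<le> 3 * exp (growth_rate * (t - s)) * norm v"
    by (rule evolution_norm[OF st(1,2)])
  also have "\<dots> \<le> 3 * exp (growth_rate * h) * norm v"
    using st growth_rate_pos by (intro mult_right_mono mult_left_mono) auto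
  finally show "norm (evolution t s v) \<le> 3 * exp (growth_rate * h) * norm v" .
next
  have "exp (growth_rate * h) \<ge> 1" using assms growth_rate_pos by simp
  then show "1 \<le> 3 * exp (growth_rate * h)" by linarith
qed (use assms evolution_cocycle in auto)

end

section \<open>Compactness of the evolution operators\<close>

text \<open>Arzela-Ascoli gives uniform convergence on [-r, 0]. Clamped functions carry no further
  information, so the last condition extends it to the whole line, where equicontinuity alone would
  not suffice.\<close>

lemma compact_lipschitz_histories:
  fixes r B :: real
  assumes r: "r \<ge> 0"
  shows "compact {f :: real \<Rightarrow>\<^sub>C 'b::euclidean_space. norm f \<le> B \<and>
    (\<forall>\<theta> \<theta>'. norm (apply_bcontfun f \<theta> - apply_bcontfun f \<theta>') \<le> B * \<bar>\<theta> - \<theta>'\<bar>) \<and>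
    history r (apply_bcontfun f) 0 = f}" (is "compact ?C")
proof (unfold compact_eq_seq_compact_metric seq_compact_def, intro allI impI)
  fix \<F> :: "nat \<Rightarrow> (real \<Rightarrow>\<^sub>C 'b)" assume "\<forall>n. \<F> n \<in> ?C"
  then have \<F>: "norm (\<F> n) \<le> B" "norm (apply_bcontfun (\<F> n) \<theta> - apply_bcontfun (\<F> n) \<theta>') \<le> B * \<bar>\<theta> - \<theta>'\<bar>"
    "history r (apply_bcontfun (\<F> n)) 0 = \<F> n" for n \<theta> \<theta>'
    by auto
  have B0: "B \<ge> 0" using \<F>(1)[of 0] norm_ge_zero order_trans by blast
  obtain g k where g: "continuous_on {-r..0} g" and k: "strict_mono (k :: nat \<Rightarrow> nat)"
    and lim: "\<And>e. 0 < e \<Longrightarrow>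
      \<exists>N. \<forall>n x. n \<ge> N \<and> x \<in> {-r..0} \<longrightarrow> norm (apply_bcontfun (\<F> (k n)) x - g x) < e"
  proof (rule Arzela_Ascoli[of "{-r..0}" "\<lambda>n. apply_bcontfun (\<F> n)" B])
    show "norm (apply_bcontfun (\<F> n) x) \<le> B" for n x
      using norm_bounded[of "\<F> n" x] \<F>(1)[of n] by linarith
    fix x e :: real assume e: "e > 0"
    show "\<exists>d>0. \<forall>n y. y \<in> {-r..0} \<and> norm (x - y) < d \<longrightarrow>
        norm (apply_bcontfun (\<F> n) x - apply_bcontfun (\<F> n) y) < e"
    proof (intro exI[of _ "e / (B + 1)"] conjI allI impI)
      show "e / (B + 1) > 0" using e B0 by simp
      fix n y assume y: "y \<in> {-r..0} \<and> norm (x - y) < e / (B + 1)"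
      have "norm (apply_bcontfun (\<F> n) x - apply_bcontfun (\<F> n) y) \<le> B * \<bar>x - y\<bar>" by (rule \<F>(2))
      also have "\<dots> \<le> (B + 1) * \<bar>x - y\<bar>" by (intro mult_right_mono) auto
      also have "\<dots> < e" using y B0 by (simp add: field_simps)
      finally show "norm (apply_bcontfun (\<F> n) x - apply_bcontfun (\<F> n) y) < e" .
    qed
  qed auto
  define l where "l = history r g 0"
  have l: "apply_bcontfun l \<theta> = g (max (- r) (min 0 \<theta>))" for \<theta>
    unfolding l_def using apply_history[of r 0 g \<theta>] r g by simp
  have \<F>_clamp: "apply_bcontfun (\<F> n) \<theta> = apply_bcontfun (\<F> n) (max (- r) (min 0 \<theta>))" for n \<theta>
    using history_apply[OF r, of "\<F> n" \<theta>] \<F>(3)[of n] by simp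
  have conv: "(\<lambda>n. \<F> (k n)) \<longlonglongrightarrow> l"
  proof (rule LIMSEQ_I)
    fix e :: real assume "e > 0"
    then obtain N where N: "\<And>n x. n \<ge> N \<Longrightarrow> x \<in> {-r..0} \<Longrightarrow>
        norm (apply_bcontfun (\<F> (k n)) x - g x) < e / 2"
      using lim[of "e / 2"] by auto
    have "norm (\<F> (k n) - l) < e" if n: "n \<ge> N" for n
    proof -
      have "norm (\<F> (k n) - l) \<le> e / 2"
      proof (rule norm_bound)
        fix \<theta>
        have "max (- r) (min 0 \<theta>) \<in> {-r..0}" using r by auto
        from N[OF n this] show "norm (apply_bcontfun (\<F> (k n) - l) \<theta>) \<le> e / 2"
          using \<F>_clamp[of "k n" \<theta>] by (simp add: l)
      qed
      then show ?thesis using \<open>e > 0\<close> by simp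
    qed
    then show "\<exists>N. \<forall>n\<ge>N. norm (\<F> (k n) - l) < e" by blast
  qed
  have pt: "(\<lambda>n. apply_bcontfun (\<F> (k n)) \<theta>) \<longlonglongrightarrow> apply_bcontfun l \<theta>" for \<theta>
    by (rule tendsto_uniform_limitI[OF tendsto_bcontfun_uniform_limit[OF conv] UNIV_I])
  have "l \<in> ?C"
  proof (intro CollectI conjI allI)
    show "norm l \<le> B"
      by (rule Lim_norm_ubound[OF sequentially_bot conv]) (simp add: \<F>)
    show "norm (apply_bcontfun l \<theta> - apply_bcontfun l \<theta>') \<le> B * \<bar>\<theta> - \<theta>'\<bar>" for \<theta> \<theta>'
      by (rule Lim_norm_ubound[OF sequentially_bot tendsto_diff[OF pt pt]]) (simp add: \<F>)
    show "history r (apply_bcontfun l) 0 = l"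
      unfolding l_def using g by (intro history_history[OF r]) simp
  qed
  then show "\<exists>l\<in>?C. \<exists>k. strict_mono k \<and> (\<F> \<circ> k) \<longlonglongrightarrow> l"
    using k conv by (auto simp: o_def)
qed

context delay_equation
begin

lemma solution_lipschitz:
  assumes s: "s \<ge> 0" and x: "solution s x" and B: "\<And>t. t \<in> {s..b} \<Longrightarrow> norm (history r x t) \<le> B"
    and uv: "u \<in> {s..b}" "v \<in> {s..b}"
  shows "norm (x u - x v) \<le> M * B * \<bar>u - v\<bar>"
proof -
  have "norm (x u - x v) \<le> (M * B) * norm (u - v)"
  proof (rule differentiable_bound[where f' = "\<lambda>t \<tau>. \<tau> *\<^sub>R L t (history r x t)"])
    fix t assume t: "t \<in> {s..b}"
    then show "(x has_derivative (\<lambda>\<tau>. \<tau> *\<^sub>R L t (history r x t))) (at t within {s..b})"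
      using x unfolding solution_def has_vector_derivative_def
      by (auto intro: has_derivative_subset[where s = "{s..}"])
    have "norm (L t (history r x t)) \<le> M * norm (history r x t)" using t s by (intro norm_L_le) auto
    also have "\<dots> \<le> M * B" using B[OF t] M_nonneg by (rule mult_left_mono)
    finally show "onorm (\<lambda>\<tau>. \<tau> *\<^sub>R L t (history r x t)) \<le> M * B"
      by (intro onorm_le) (simp add: mult.commute mult_left_mono)
  qed (use uv in auto)
  then show ?thesis by simp
qed

text \<open>After time h >= r the delay window contains only times at which the equation holds.
  There the derivative is bounded by M B, so histories are uniformly Lipschitz, however rough the
  initial function was.\<close>

lemma evolution_compact:
  assumes h: "h \<ge> r" "h > 0"
  obtains C where "compact C" "evolution h 0 ` cball 0 1 \<subseteq> C"
proof -
  define B where "B = 3 * exp (growth_rate * h)"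
  define B' where "B' = B + M * B"
  have B: "B \<ge> 0" "B \<le> B'" "M * B \<le> B'" using M_nonneg by (auto simp: B_def B'_def)
  show thesis
  proof (rule that[OF compact_lipschitz_histories[OF r_nonneg, of B']], safe)
    fix f :: "real \<Rightarrow>\<^sub>C 'b" assume f: "f \<in> cball 0 1"
    define x where "x = flow 0 f"
    have x: "solution 0 x" "evolution t 0 f = history r x t" for t
      using flow(1)[of 0 f] by (auto simp: x_def evolution_def)
    have cont: "continuous_on {h - r..h} x" using x(1) h by (auto intro: solution_continuous)
    have le: "norm (history r x t) \<le> B" if "t \<in> {0..h}" for t
    proof -
      have "norm (evolution t 0 f) \<le> 3 * exp (growth_rate * (t - 0)) * norm f"
        using that by (intro evolution_norm) auto
      also have "\<dots> \<le> 3 * exp (growth_rate * h) * 1"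
        using that f growth_rate_pos by (intro mult_mono) auto
      finally show ?thesis by (simp add: x B_def)
    qed
    show "norm (evolution h 0 f) \<le> B'" using le[of h] h B by (simp add: x)
    show "history r (apply_bcontfun (evolution h 0 f)) 0 = evolution h 0 f"
      unfolding x by (rule history_history[OF r_nonneg cont])
    fix \<theta> \<theta>' :: real
    define c where "c \<theta> = max (- r) (min 0 \<theta>)" for \<theta> :: real
    have "norm (x (h + c \<theta>) - x (h + c \<theta>')) \<le> M * B * \<bar>(h + c \<theta>) - (h + c \<theta>')\<bar>"
      by (rule solution_lipschitz[OF _ x(1) le]) (use h r_nonneg in \<open>auto simp: c_def\<close>)
    also have "\<dots> \<le> B' * \<bar>\<theta> - \<theta>'\<bar>"
      using B M_nonneg by (intro mult_mono) (auto simp: c_def)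
    finally show "norm (apply_bcontfun (evolution h 0 f) \<theta> - apply_bcontfun (evolution h 0 f) \<theta>')
        \<le> B' * \<bar>\<theta> - \<theta>'\<bar>"
      by (simp add: x apply_history[OF r_nonneg cont] c_def)
  qed
qed

end

section \<open>A continuously differentiable switch\<close>

definition ramp :: "real \<Rightarrow> real" where "ramp u = (max 0 u)\<^sup>2"

lemma ramp_derivative: "(ramp has_real_derivative 2 * max 0 u) (at u)"
proof -
  consider "u > 0" | "u < 0" | "u = 0" by linarith
  then show ?thesis
  proof cases
    case 1
    have "((\<lambda>u. u\<^sup>2) has_real_derivative 2 * max 0 u) (at u)"
      using 1 by (auto intro!: derivative_eq_intros)
    then show ?thesis
      by (rule has_field_derivative_transform_within_open[of _ _ _ "{0<..}"])
        (use 1 in \<open>auto simp: ramp_def\<close>)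
  next
    case 2
    have "((\<lambda>u. 0) has_real_derivative 2 * max 0 u) (at u)"
      using 2 by (auto intro!: derivative_eq_intros)
    then show ?thesis
      by (rule has_field_derivative_transform_within_open[of _ _ _ "{..<0}"])
        (use 2 in \<open>auto simp: ramp_def\<close>)
  next
    case 3
    have "((\<lambda>v. (ramp v - ramp 0) / (v - 0)) \<longlongrightarrow> 0) (at 0)"
    proof (rule Lim_null_comparison)
      show "\<forall>\<^sub>F v in at 0. norm ((ramp v - ramp 0) / (v - 0)) \<le> \<bar>v\<bar>"
        by (intro always_eventually allI)
          (auto simp: ramp_def power2_eq_square divide_simps max_def)
      show "((\<lambda>v. \<bar>v\<bar>) \<longlongrightarrow> (0::real)) (at 0)" by (rule tendsto_eq_intros refl | simp)+
    qed
    then show ?thesis using 3 by (simp add: has_field_derivative_iff)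
  qed
qed

text \<open>A quadratic spline: a \<open>C\<^sup>1\<close> step from 0 (on the negative axis) to 1 (from time 1 on).\<close>

definition cutoff :: "real \<Rightarrow> real" where
  "cutoff u = 2 * ramp u - 4 * ramp (u - 1/2) + 2 * ramp (u - 1)"

text \<open>The tent of height 2 over [0, 1]; it is continuous, as the derivative of an approximate
  solution has to be.\<close>

definition cutoff' :: "real \<Rightarrow> real" where
  "cutoff' u = 4 * max 0 u - 8 * max 0 (u - 1/2) + 4 * max 0 (u - 1)"

lemma cutoff_derivative: "(cutoff has_real_derivative cutoff' u) (at u)"
proof -
  have shift: "((\<lambda>u. ramp (u - a)) has_real_derivative 2 * max 0 (u - a)) (at u)" for a
    using DERIV_shift[of ramp "2 * max 0 (u - a)" u "- a"] ramp_derivative[of "u - a"] by simp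
  show ?thesis
    unfolding cutoff_def[abs_def]
    by (auto intro!: derivative_eq_intros ramp_derivative shift simp: cutoff'_def)
qed

lemma cutoff_nonpos: "u \<le> 0 \<Longrightarrow> cutoff u = 0" "u \<le> 0 \<Longrightarrow> cutoff' u = 0"
  by (auto simp: cutoff_def cutoff'_def ramp_def max_def)

lemma cutoff_ge_1: "u \<ge> 1 \<Longrightarrow> cutoff u = 1" "u \<ge> 1 \<Longrightarrow> cutoff' u = 0"
  by (auto simp: cutoff_def cutoff'_def ramp_def max_def power2_eq_square field_simps)

lemma cutoff'_bounds: "0 \<le> cutoff' u" "cutoff' u \<le> 2"
  by (auto simp: cutoff'_def max_def)

lemma cutoff_bounds: "0 \<le> cutoff u" "cutoff u \<le> 1"
proof -
  have mono: "cutoff u \<le> cutoff v" if "u \<le> v" for u v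
    using that by (rule DERIV_nonneg_imp_nondecreasing) (use cutoff_derivative cutoff'_bounds in blast)
  show "0 \<le> cutoff u" using mono[of "min 0 u" u] cutoff_nonpos(1)[of "min 0 u"] by simp
  show "cutoff u \<le> 1" using mono[of u "max 1 u"] cutoff_ge_1(1)[of "max 1 u"] by simp
qed

lemma cutoff_continuous: "continuous_on A cutoff" "continuous_on A cutoff'"
  using cutoff_derivative DERIV_isCont continuous_at_imp_continuous_on
  by (blast, auto simp: cutoff'_def[abs_def] intro!: continuous_intros)

section \<open>From shadowing to bounded response\<close>

lemma has_vector_derivative_Un:
  assumes "(f has_vector_derivative f') (at x within S)" "(f has_vector_derivative f') (at x within T)"
  shows "(f has_vector_derivative f') (at x within (S \<union> T))"
  using assms unfolding has_vector_derivative_def has_derivative_within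
  by (auto intro: Lim_Un)

text \<open>Disjoint time windows enter through this bound, which does not grow with the number of
  summands.\<close>

lemma norm_sum_single_support:
  fixes f :: "'i \<Rightarrow> 'b::real_normed_vector"
  assumes "finite I" "B \<ge> 0" and bd: "\<And>i. i \<in> I \<Longrightarrow> norm (f i) \<le> B"
    and single: "\<And>i j. i \<in> I \<Longrightarrow> j \<in> I \<Longrightarrow> f i \<noteq> 0 \<Longrightarrow> f j \<noteq> 0 \<Longrightarrow> i = j"
  shows "norm (sum f I) \<le> B"
proof (cases "\<exists>i\<in>I. f i \<noteq> 0")
  case True
  then obtain i where i: "i \<in> I" "f i \<noteq> 0" by blast
  have "sum f I = sum f {i}"
    using assms(1) i single by (intro sum.mono_neutral_right) auto
  then show ?thesis using bd[OF i(1)] by simp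
next
  case False
  then show ?thesis using assms(2) by simp
qed

context delay_equation
begin

text \<open>The orbit of f switched on during [a, a + 1]. Freezing the flow to the left of a - r,
  where it is unspecified, makes the product continuous on the line; the cutoff vanishes there
  anyway.\<close>

definition pulse :: "real \<Rightarrow> (real \<Rightarrow>\<^sub>C 'b) \<Rightarrow> real \<Rightarrow> 'b" where
  "pulse a f u = cutoff (u - a) *\<^sub>R flow a f (max (a - r) u)"

definition pulse' :: "real \<Rightarrow> (real \<Rightarrow>\<^sub>C 'b) \<Rightarrow> real \<Rightarrow> 'b" where
  "pulse' a f u = cutoff' (u - a) *\<^sub>R flow a f (max (a - r) u)
     + cutoff (u - a) *\<^sub>R L u (history r (\<lambda>v. flow a f (max (a - r) v)) u)"

context
  fixes a :: real and f :: "real \<Rightarrow>\<^sub>C 'b"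
  assumes a: "a \<ge> 0"
begin

lemma flow_max_continuous: "continuous_on A (\<lambda>u. flow a f (max (a - r) u))"
proof -
  have "continuous_on {a - r..} (flow a f)" using flow(1)[OF a] by (auto simp: solution_def)
  then show ?thesis
    by (rule continuous_on_compose2) (auto intro!: continuous_intros)
qed

lemma history_flow_max:
  assumes "t \<ge> a"
  shows "history r (\<lambda>u. flow a f (max (a - r) u)) t = history r (flow a f) t"
  using assms by (intro history_cong[OF r_nonneg]) (auto simp: max_def)

lemma pulse_continuous: "continuous_on A (pulse a f)"
  unfolding pulse_def
  by (intro continuous_intros flow_max_continuous continuous_on_compose2[OF cutoff_continuous(1)]) auto

lemma pulse'_continuous: "continuous_on {0..} (pulse' a f)"
proof -
  have "continuous_on {- r + r..} (history r (\<lambda>u. flow a f (max (a - r) u)))"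
    by (rule continuous_on_history[OF r_nonneg flow_max_continuous])
  then show ?thesis
    unfolding pulse'_def
    by (intro continuous_intros L_cont flow_max_continuous
        continuous_on_compose2[OF cutoff_continuous(1)] continuous_on_compose2[OF cutoff_continuous(2)]) auto
qed

lemma pulse_zero: "u \<le> a \<Longrightarrow> pulse a f u = 0" "u \<le> a \<Longrightarrow> pulse' a f u = 0"
  by (auto simp: pulse_def pulse'_def cutoff_nonpos)

lemma pulse_derivative: "(pulse a f has_vector_derivative pulse' a f t) (at t)"
proof -
  have right: "(pulse a f has_vector_derivative pulse' a f t) (at t within {a..})" if t: "t \<ge> a" for t
  proof -
    have "(flow a f has_vector_derivative L t (history r (flow a f) t)) (at t within {a..})"
      using flow(1)[OF a] t by (auto simp: solution_def)
    then have fl: "((\<lambda>u. flow a f (max (a - r) u)) has_vector_derivative L t (history r (flow a f) t)) (at t within {a..})"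
      by (rule has_vector_derivative_transform[rotated 2]) (use t r_nonneg in \<open>auto simp: max_def\<close>)
    have "((\<lambda>u. cutoff (u - a)) has_real_derivative cutoff' (t - a)) (at t within {a..})"
      using DERIV_shift[of cutoff "cutoff' (t - a)" t "- a"] cutoff_derivative[of "t - a"]
      by (simp add: has_field_derivative_at_within)
    from has_vector_derivative_scaleR[OF this fl]
    show ?thesis
      unfolding pulse_def[abs_def] pulse'_def history_flow_max[OF t] by (simp add: add.commute)
  qed
  have left: "(pulse a f has_vector_derivative pulse' a f t) (at t within {..a})" if t: "t \<le> a" for t
  proof -
    have "((\<lambda>u. 0) has_vector_derivative pulse' a f t) (at t within {..a})"
      using t by (simp add: pulse_zero)
    then show ?thesis
      by (rule has_vector_derivative_transform[rotated 2]) (use t in \<open>auto simp: pulse_zero\<close>)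
  qed
  consider "t > a" | "t < a" | "t = a" by linarith
  then show ?thesis
  proof cases
    case 1
    then show ?thesis using right[of t] by (auto intro: has_vector_derivative_Ici_at)
  next
    case 2
    then show ?thesis
      using left[of t] at_within_interior[of t "{..a}"] by (simp add: interior_Iic[of "a + 1" a])
  next
    case 3
    \<comment> \<open>At the seam both one-sided derivatives are 0, because \<open>cutoff\<close>
      and \<open>cutoff'\<close> vanish at 0.\<close>
    have "{..a} \<union> {a..} = (UNIV :: real set)" by auto
    then show ?thesis using has_vector_derivative_Un[OF left right, of t] 3 by simp
  qed
qed

lemma pulse_history_zero:
  assumes "t \<le> a"
  shows "history r (pulse a f) t = 0"
proof -
  have "norm (history r (pulse a f) t) \<le> 0"
    by (rule norm_history_le[OF r_nonneg pulse_continuous]) (use assms in \<open>simp add: pulse_zero\<close>)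
  then show ?thesis by simp
qed

text \<open>From a + (r + 1) on, the whole delay window lies where the cutoff is 1, so the pulse is
  indistinguishable from the orbit.\<close>

lemma pulse_history_late:
  assumes "t \<ge> a + (r + 1)"
  shows "history r (pulse a f) t = evolution t a f"
  unfolding evolution_def
  by (rule history_cong[OF r_nonneg])
    (use assms in \<open>auto simp: pulse_def cutoff_ge_1 max_def\<close>)

lemma flow_bound:
  assumes u: "a - r \<le> u" "u \<le> a + (r + 1)"
  shows "norm (flow a f u) \<le> 3 * exp (growth_rate * (r + 1)) * norm f"
proof -
  define t where "t = max a u"
  have t: "a \<le> t" "t \<le> a + (r + 1)" "t - r \<le> u" "u \<le> t" using u r_nonneg by (auto simp: t_def)
  have "norm (flow a f u) \<le> norm (history r (flow a f) t)"
    using t by (intro norm_history_ge[OF r_nonneg solution_continuous[OF flow(1)[OF a]]]) auto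
  also have "\<dots> \<le> 3 * exp (growth_rate * (t - a)) * norm f"
    using evolution_norm[OF a t(1), of f] by (simp add: evolution_def)
  also have "\<dots> \<le> 3 * exp (growth_rate * (r + 1)) * norm f"
    using t growth_rate_pos by (intro mult_right_mono mult_left_mono) auto
  finally show ?thesis .
qed

lemma evolution_bound:
  assumes "a \<le> t" "t \<le> a + (r + 1)"
  shows "norm (evolution t a f) \<le> 3 * exp (growth_rate * (r + 1)) * norm f"
  unfolding evolution_def
  by (rule norm_history_le[OF r_nonneg solution_continuous[OF flow(1)[OF a]]])
    (use assms in \<open>auto intro!: flow_bound\<close>)

lemma pulse_history_bound:
  assumes t: "t \<le> a + (r + 1)"
  shows "norm (history r (pulse a f) t) \<le> 3 * exp (growth_rate * (r + 1)) * norm f"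
proof (rule norm_history_le[OF r_nonneg pulse_continuous])
  fix u assume u: "t - r \<le> u" "u \<le> t"
  have "norm (pulse a f u) \<le> 1 * norm (flow a f (max (a - r) u))"
    unfolding pulse_def norm_scaleR using cutoff_bounds by (intro mult_right_mono) auto
  also have "\<dots> \<le> 3 * exp (growth_rate * (r + 1)) * norm f"
    using u t r_nonneg unfolding mult_1 by (intro flow_bound) auto
  finally show "norm (pulse a f u) \<le> 3 * exp (growth_rate * (r + 1)) * norm f" .
qed

lemma pulse_residual_zero:
  assumes "t \<le> a \<or> t \<ge> a + (r + 1)"
  shows "pulse' a f t - L t (history r (pulse a f) t) = 0"
  using assms
proof
  assume "t \<le> a"
  then show ?thesis by (simp add: pulse_zero pulse_history_zero)
next
  assume "t \<ge> a + (r + 1)"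
  then have "pulse' a f t = L t (evolution t a f)"
    using r_nonneg by (simp add: pulse'_def history_flow_max cutoff_ge_1 evolution_def)
  with \<open>t \<ge> a + (r + 1)\<close> show ?thesis by (simp add: pulse_history_late)
qed

text \<open>The product rule contributes the slope 2 of the cutoff and one M; evaluating
  \<open>L\<close> on the pulse itself contributes the other M.\<close>

lemma pulse_residual_bound:
  assumes t: "t \<ge> 0"
  shows "norm (pulse' a f t - L t (history r (pulse a f) t))
    \<le> (2 + 2 * M) * (3 * exp (growth_rate * (r + 1)) * norm f)"
proof (cases "t \<le> a \<or> t \<ge> a + (r + 1)")
  case True
  then show ?thesis using pulse_residual_zero[OF True] M_nonneg by simp
next
  case False
  define B where "B = 3 * exp (growth_rate * (r + 1)) * norm f"
  have B: "B \<ge> 0" by (simp add: B_def)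
  have 1: "norm (cutoff' (t - a) *\<^sub>R flow a f (max (a - r) t)) \<le> 2 * B"
    unfolding norm_scaleR B_def
    using False r_nonneg cutoff'_bounds[of "t - a"] by (intro mult_mono flow_bound) auto
  have "norm (cutoff (t - a) *\<^sub>R L t (evolution t a f)) \<le> 1 * (M * B)"
    unfolding norm_scaleR
  proof (rule mult_mono)
    have "norm (L t (evolution t a f)) \<le> M * norm (evolution t a f)" by (rule norm_L_le[OF t])
    also have "\<dots> \<le> M * B"
      unfolding B_def using False M_nonneg by (intro mult_left_mono evolution_bound) auto
    finally show "norm (L t (evolution t a f)) \<le> M * B" .
  qed (use cutoff_bounds[of "t - a"] in auto)
  then have 2: "norm (cutoff (t - a) *\<^sub>R L t (history r (\<lambda>v. flow a f (max (a - r) v)) t)) \<le> M * B"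
    using False by (simp add: history_flow_max evolution_def)
  have "norm (L t (history r (pulse a f) t)) \<le> M * norm (history r (pulse a f) t)" by (rule norm_L_le[OF t])
  also have "\<dots> \<le> M * B"
    unfolding B_def using False M_nonneg by (intro mult_left_mono pulse_history_bound) auto
  finally have 3: "norm (L t (history r (pulse a f) t)) \<le> M * B" .
  have "norm (pulse' a f t - L t (history r (pulse a f) t)) \<le> (2 * B + M * B) + M * B"
    unfolding pulse'_def by (intro norm_triangle_le_diff add_mono norm_triangle_mono 1 2 3)
  then show ?thesis unfolding B_def[symmetric] by (simp add: algebra_simps)
qed

end

definition shadowing :: "real \<Rightarrow> bool" where
  "shadowing K \<longleftrightarrow> (\<forall>y y'. continuous_on {-r..} y \<longrightarrow> continuous_on {0..} y' \<longrightarrow>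
     (\<forall>t\<ge>0. (y has_vector_derivative y' t) (at t within {0..})) \<longrightarrow>
     (\<forall>t\<ge>0. norm (y' t - L t (history r y t)) \<le> 1) \<longrightarrow>
     (\<exists>x. solution 0 x \<and> (\<forall>t\<ge>0. norm (history r x t - history r y t) \<le> K)))"

text \<open>The sum of pulses switches on the orbits of the impulses one after another. Its residual
  lives on disjoint time windows, hence is bounded uniformly in the number of impulses.\<close>

lemma shadowing_imp_perron:
  assumes sh: "shadowing K"
  shows "\<exists>K'. \<forall>a N e. a \<ge> 0 \<longrightarrow> (\<forall>k<N. norm (e k) \<le> 1) \<longrightarrow>
    (\<exists>x. \<forall>t\<ge>0. norm (evolution t 0 x + evolution_family.impulses evolution (r + 1) a N e t) \<le> K')"
proof -
  have h: "r + 1 > 0" using r_nonneg by simp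
  interpret evolution_family evolution "r + 1" "3 * exp (growth_rate * (r + 1))"
    by (rule evolution_evolution_family[OF h])
  define B where "B = 3 * exp (growth_rate * (r + 1))"
  \<comment> \<open>The residual of a unit pulse; dividing by \<open>c\<close> below brings the
    glued function to residual at most 1.\<close>
  define c where "c = (2 + 2 * M) * B"
  have B: "B \<ge> 1" using G_ge_1 by (simp add: B_def)
  have c: "c > 0" using B M_nonneg by (simp add: c_def add_pos_nonneg)
  have "\<exists>x. \<forall>t\<ge>0. norm (evolution t 0 x + impulses a N e t) \<le> c * K + 2 * B"
    if a: "a \<ge> 0" and e: "\<forall>k<N. norm (e k) \<le> 1" for a N e
  proof -
    define \<tau> where "\<tau> k = a + real k * (r + 1)" for k
    have \<tau>: "\<tau> k \<ge> 0" for k using a r_nonneg by (simp add: \<tau>_def)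
    \<comment> \<open>The windows are half-open of length r + 1, equal to the spacing of the
      impulses, hence disjoint.\<close>
    have window: "i = j" if "\<tau> i \<le> t" "t < \<tau> i + (r + 1)" "\<tau> j \<le> t" "t < \<tau> j + (r + 1)" for i j t
    proof -
      have "i \<le> j" if "\<tau> i \<le> t" "t < \<tau> j + (r + 1)" for i j
      proof (rule ccontr)
        assume "\<not> i \<le> j"
        then have "(real j + 1) * (r + 1) \<le> real i * (r + 1)"
          using h by (intro mult_right_mono) auto
        then show False using that by (simp add: \<tau>_def algebra_simps)
      qed
      then show ?thesis using that by (metis order_antisym)
    qed
    define p where "p k = pulse (\<tau> k) (e k)" for k
    define p' where "p' k = pulse' (\<tau> k) (e k)" for k
    define y where "y u = (1 / c) *\<^sub>R (\<Sum>k<N. p k u)" for u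
    define y' where "y' u = (1 / c) *\<^sub>R (\<Sum>k<N. p' k u)" for u
    have p_cont: "continuous_on A (p k)" for A k unfolding p_def by (rule pulse_continuous[OF \<tau>])
    have hist_y: "history r y t = (1 / c) *\<^sub>R (\<Sum>k<N. history r (p k) t)" for t
      unfolding y_def[abs_def]
      by (simp add: history_scaleR[OF r_nonneg] history_sum[OF r_nonneg] p_cont continuous_on_sum)
    have "\<exists>x. solution 0 x \<and> (\<forall>t\<ge>0. norm (history r x t - history r y t) \<le> K)"
    proof (rule sh[unfolded shadowing_def, rule_format])
      show "continuous_on {-r..} y" unfolding y_def[abs_def] by (intro continuous_intros p_cont)
      show "continuous_on {0..} y'"
        unfolding y'_def[abs_def] p'_def by (intro continuous_intros pulse'_continuous[OF \<tau>])
      fix t :: real assume t: "t \<ge> 0"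
      have "(y has_vector_derivative y' t) (at t)"
        unfolding y_def[abs_def] y'_def p_def p'_def
        by (intro bounded_linear.has_vector_derivative[OF bounded_linear_scaleR_right]
            has_vector_derivative_sum pulse_derivative[OF \<tau>])
      then show "(y has_vector_derivative y' t) (at t within {0..})"
        by (rule has_vector_derivative_at_within)
      have "norm (\<Sum>k<N. p' k t - L t (history r (p k) t)) \<le> c"
      proof (rule norm_sum_single_support)
        show "norm (p' k t - L t (history r (p k) t)) \<le> c" if "k \<in> {..<N}" for k
        proof -
          have "norm (p' k t - L t (history r (p k) t)) \<le> (2 + 2 * M) * (B * norm (e k))"
            unfolding p_def p'_def B_def by (rule pulse_residual_bound[OF \<tau> t])
          also have "\<dots> \<le> (2 + 2 * M) * (B * 1)"
            using e that B M_nonneg by (intro mult_left_mono) auto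
          finally show ?thesis by (simp add: c_def)
        qed
        have "\<tau> k \<le> t \<and> t < \<tau> k + (r + 1)" if "p' k t - L t (history r (p k) t) \<noteq> 0" for k
          using that pulse_residual_zero[OF \<tau>, of t k "e k"] unfolding p_def p'_def by (meson le_less_linear linear)
        then show "i = j" if "p' i t - L t (history r (p i) t) \<noteq> 0" "p' j t - L t (history r (p j) t) \<noteq> 0" for i j
          using that window by blast
      qed (use c in auto)
      moreover have "y' t - L t (history r y t) = (1 / c) *\<^sub>R (\<Sum>k<N. p' k t - L t (history r (p k) t))"
        by (simp add: y'_def hist_y blinfun.scaleR_right blinfun.sum_right sum_subtractf scaleR_diff_right)
      ultimately show "norm (y' t - L t (history r y t)) \<le> 1" using c by (simp add: divide_simps)
    qed
    then obtain x where x: "solution 0 x" "\<forall>t\<ge>0. norm (history r x t - history r y t) \<le> K" by blast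
    show ?thesis
    \<comment> \<open>The sum of the pulses is c y, and x shadows y, so subtracting the orbit c x
      from the pulses leaves at most c K. Hence the initial value - c x_0.\<close>
    proof (intro exI[of _ "- c *\<^sub>R history r x 0"] allI impI)
      fix t :: real assume t: "t \<ge> 0"
      \<comment> \<open>The discrepancy between a jump and its smoothing. It lives in one window, so
        the total discrepancy is at most 2 B whatever \<open>N\<close> is.\<close>
      define q where "q k = (if \<tau> k \<le> t then evolution t (\<tau> k) (e k) else 0) - history r (p k) t" for k
      have imp: "impulses a N e t = (\<Sum>k<N. if \<tau> k \<le> t then evolution t (\<tau> k) (e k) else 0)"
      proof -
        have "impulses a N e t = (\<Sum>k\<in>{k \<in> {..<N}. \<tau> k \<le> t}. evolution t (\<tau> k) (e k))"
          by (simp add: impulses_def \<tau>_def)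
        also have "\<dots> = (\<Sum>k<N. if \<tau> k \<le> t then evolution t (\<tau> k) (e k) else 0)"
          by (rule sum.inter_filter) simp
        finally show ?thesis .
      qed
      have "norm (\<Sum>k<N. q k) \<le> 2 * B"
      proof (rule norm_sum_single_support)
        have q: "q k = 0" if "\<not> (\<tau> k \<le> t \<and> t < \<tau> k + (r + 1))" for k
          using that pulse_history_zero[OF \<tau>, of t k "e k"] pulse_history_late[OF \<tau>, of k t "e k"] r_nonneg
          by (auto simp: q_def p_def)
        then show "i = j" if "q i \<noteq> 0" "q j \<noteq> 0" for i j
          using that window by blast
        show "norm (q k) \<le> 2 * B" if k: "k \<in> {..<N}" for k
        proof (cases "\<tau> k \<le> t \<and> t < \<tau> k + (r + 1)")
          case True
          have "norm (q k) \<le> B * norm (e k) + B * norm (e k)"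
            unfolding q_def p_def B_def using True
            by (intro norm_triangle_le_diff add_mono pulse_history_bound[OF \<tau>])
              (auto intro!: evolution_bound[OF \<tau>])
          also have "\<dots> \<le> B * 1 + B * 1" using e k B by (intro add_mono mult_left_mono) auto
          finally show ?thesis by simp
        next
          case False
          then show ?thesis using q[OF False] B by simp
        qed
      qed (use B in auto)
      moreover have "evolution t 0 (- c *\<^sub>R history r x 0) + impulses a N e t
          = (\<Sum>k<N. q k) - c *\<^sub>R (history r x t - history r y t)"
      proof -
        have "evolution t 0 (- c *\<^sub>R history r x 0) = - c *\<^sub>R history r x t"
          using evolution_solution[OF order_refl t x(1)] t by (simp only: T_scaleR)
        moreover have "c *\<^sub>R history r y t = (\<Sum>k<N. history r (p k) t)" using c by (simp add: hist_y)
        ultimately show ?thesis by (simp add: imp q_def sum_subtractf scaleR_diff_right)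
      qed
      moreover have "norm (c *\<^sub>R (history r x t - history r y t)) \<le> c * K"
        using x(2) t c by (simp add: mult_left_mono)
      ultimately show "norm (evolution t 0 (- c *\<^sub>R history r x 0) + impulses a N e t) \<le> c * K + 2 * B"
        using norm_triangle_ineq4[of "\<Sum>k<N. q k" "c *\<^sub>R (history r x t - history r y t)"] by simp
    qed
  qed
  then show ?thesis by blast
qed

lemma shadowing_imp_splitting:
  assumes "shadowing K"
  obtains Z K' where "perron_splitting evolution (r + 1) (3 * exp (growth_rate * (r + 1))) Z K'"
proof -
  have h: "r + 1 > 0" "r + 1 \<ge> r" using r_nonneg by auto
  interpret evolution_family evolution "r + 1" "3 * exp (growth_rate * (r + 1))"
    by (rule evolution_evolution_family[OF h(1)])
  obtain C where C: "compact C" "evolution (r + 1) 0 ` cball 0 1 \<subseteq> C"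
    using evolution_compact[OF h(2,1)] by blast
  obtain K1 where K1: "\<forall>a N e. a \<ge> 0 \<longrightarrow> (\<forall>k<N. norm (e k) \<le> 1) \<longrightarrow>
      (\<exists>x. \<forall>t\<ge>0. norm (evolution t 0 x + impulses a N e t) \<le> K1)"
    using shadowing_imp_perron[OF assms] by blast
  show thesis
  proof (rule perron_complement[OF C])
    show "\<exists>x. \<forall>t\<ge>0. norm (evolution t 0 x + impulses a N e t) \<le> K1"
      if "a \<ge> 0" "\<And>k. k < N \<Longrightarrow> norm (e k) \<le> 1" for a N e
      using K1 that by blast
    fix Z K' assume Z: "subspace Z" "\<forall>z\<in>Z. bounded_orbit 0 z \<longrightarrow> z = 0" "K' \<ge> 1"
      "\<forall>a N e. a \<ge> 0 \<longrightarrow> (\<forall>k<N. norm (e k) \<le> 1) \<longrightarrow>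
      (\<exists>z\<in>Z. \<forall>t\<ge>0. norm (evolution t 0 z + impulses a N e t) \<le> K')"
    have "perron_splitting evolution (r + 1) (3 * exp (growth_rate * (r + 1))) Z K'"
      by unfold_locales (use Z in auto)
    then show thesis by (rule that)
  qed
qed

end

section \<open>From Green operators to shadowing\<close>

text \<open>Completeness lets the absolutely convergent series of Green responses below have a
  sum.\<close>

instance bcontfun :: (metric_space, banach) banach ..

text \<open>With truncated subtraction the exponent is the distance |n - k|; each side contributes
  at most 1 / (1 - q).\<close>

lemma two_sided_geometric:
  fixes q :: real
  assumes q: "0 \<le> q" "q < 1"
  shows "summable (\<lambda>k. q ^ ((n - k) + (k - n)))" "(\<Sum>k. q ^ ((n - k) + (k - n))) \<le> 2 / (1 - q)"
proof -
  let ?a = "\<lambda>k. q ^ ((n - k) + (k - n))"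
  have geo: "summable (\<lambda>k. q ^ k)" "(\<Sum>k. q ^ k) = 1 / (1 - q)"
    using q by (auto simp: summable_geometric suminf_geometric)
  show summ: "summable ?a"
    using summable_iff_shift[of ?a n] geo by simp
  have "(\<Sum>k<n. ?a k) = (\<Sum>k<n. q ^ Suc k)"
    by (subst sum.nat_diff_reindex[symmetric]) (auto intro!: sum.cong simp: Suc_diff_Suc)
  also have "\<dots> \<le> (\<Sum>k<n. q ^ k)" using q by (intro sum_mono) (simp add: mult_left_le_one_le)
  also have "\<dots> \<le> 1 / (1 - q)" unfolding geo(2)[symmetric] using q by (intro sum_le_suminf geo) auto
  finally have "(\<Sum>k<n. ?a k) \<le> 1 / (1 - q)" .
  moreover have "suminf ?a = (\<Sum>k. ?a (k + n)) + (\<Sum>k<n. ?a k)"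
    by (rule suminf_split_initial_segment[OF summ])
  ultimately show "suminf ?a \<le> 2 / (1 - q)" using geo by simp
qed

context delay_equation
begin

lemma segment_defect:
  assumes s: "0 \<le> s" and \<delta>: "\<delta> \<ge> 0" and y: "continuous_on {- r..} y"
    and y': "\<And>t. t \<ge> 0 \<Longrightarrow> (y has_vector_derivative y' t) (at t within {0..})"
    and res: "\<And>t. t \<ge> 0 \<Longrightarrow> norm (y' t - L t (history r y t)) \<le> \<delta>"
    and x: "solution s x" and t: "s \<le> t"
  shows "norm (history r x t - history r y t)
    \<le> (3 * norm (history r x s - history r y s) + 2 * \<delta>) * exp (growth_rate * (t - s))"
proof -
  have cy: "continuous_on {u - r..u} y" if "u \<ge> s" for u
    by (rule continuous_on_subset[OF y]) (use that s in auto)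
  note cx = solution_continuous[OF x]
  have diff: "history r (\<lambda>u. x u - y u) u = history r x u - history r y u" if "u \<ge> s" for u
    using that by (intro history_diff[OF r_nonneg] cx cy)
  have "norm (history r (\<lambda>u. x u - y u) t)
      \<le> (3 * norm (history r (\<lambda>u. x u - y u) s) + 2 * \<delta>) * exp (growth_rate * (t - s))"
  proof (rule gronwall[OF s \<delta> _ _ _ t])
    show "continuous_on {s - r..} (\<lambda>u. x u - y u)"
      by (intro continuous_intros continuous_on_subset[OF y]) (use x s in \<open>auto simp: solution_def\<close>)
    fix u assume u: "u \<ge> s"
    have "(y has_vector_derivative y' u) (at u within {s..})"
      by (rule has_vector_derivative_within_subset[OF y']) (use u s in auto)
    then show "((\<lambda>u. x u - y u) has_vector_derivative L u (history r x u) - y' u) (at u within {s..})"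
      using x u unfolding solution_def by (intro derivative_intros) auto
    have "L u (history r x u) - y' u - L u (history r (\<lambda>u. x u - y u) u) = - (y' u - L u (history r y u))"
      using u by (simp add: diff blinfun.diff_right)
    then show "norm (L u (history r x u) - y' u - L u (history r (\<lambda>u. x u - y u) u)) \<le> \<delta>"
      using res[of u] u s by (simp only: norm_minus_cancel)
  qed
  then show ?thesis using t by (simp add: diff)
qed

text \<open>\<open>g k f\<close> is the decaying response on the integer grid to an impulse f at
  time k. Summing the responses to the one-step defects \<open>e k\<close> gives a bounded z with
  the same defects as the sampled approximate solution, so their difference is an exact orbit. No
  linearity of \<open>g\<close> in f is asked for, only estimates for clamped f of norm at most
  \<open>c\<close>; the approximate solution is scaled down to fit.\<close>

lemma green_imp_shadowing:
  fixes g :: "nat \<Rightarrow> (real \<Rightarrow>\<^sub>C 'b) \<Rightarrow> nat \<Rightarrow> (real \<Rightarrow>\<^sub>C 'b)"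
  assumes q: "0 \<le> q" "q < 1" and c: "c > 0" and D: "D \<ge> 0"
    and step: "\<And>k f n. k > 0 \<Longrightarrow> norm f \<le> c \<Longrightarrow> history r (apply_bcontfun f) 0 = f \<Longrightarrow>
      g k f (Suc n) = evolution (real (Suc n)) (real n) (g k f n) + (if k = Suc n then f else 0)"
    and bound: "\<And>k f n. k > 0 \<Longrightarrow> norm f \<le> c \<Longrightarrow> history r (apply_bcontfun f) 0 = f \<Longrightarrow>
      norm (g k f n) \<le> D * q ^ ((n - k) + (k - n))"
  shows "\<exists>K. shadowing K"
proof -
  \<comment> \<open>Over one unit of time a residual \<delta> produces a defect of at most 2
    \<delta> exp(growth_rate), which is \<open>c\<close>.\<close>
  define \<delta> where "\<delta> = c / (2 * exp growth_rate)"
  have \<delta>: "\<delta> > 0" using c by (simp add: \<delta>_def)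
  define Z where "Z = D * (2 / (1 - q))"
  \<comment> \<open>The distance at grid points is at most 3 Z, and \<open>segment_defect\<close>
    carries it across one unit of time.\<close>
  define K where "K = (9 * Z + 2 * \<delta>) * exp growth_rate"
  have "Z \<ge> 0" using D q by (simp add: Z_def)
  have "\<exists>x. solution 0 x \<and> (\<forall>t\<ge>0. norm (history r x t - history r y t) \<le> K / \<delta>)"
    if y0: "continuous_on {-r..} y"
      and y0': "\<forall>t\<ge>0. (y has_vector_derivative y' t) (at t within {0..})"
      and res0: "\<forall>t\<ge>0. norm (y' t - L t (history r y t)) \<le> 1" for y y'
  proof -
    define w where "w u = \<delta> *\<^sub>R y u" for u
    have cy: "continuous_on {u - r..u} y" if "u \<ge> 0" for u
      by (rule continuous_on_subset[OF y0]) (use that in auto)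
    have hist_w: "history r w u = \<delta> *\<^sub>R history r y u" if "u \<ge> 0" for u
      unfolding w_def[abs_def] by (rule history_scaleR[OF r_nonneg cy[OF that]])
    have w: "continuous_on {- r..} w" unfolding w_def[abs_def] by (intro continuous_intros y0)
    have cw: "continuous_on {u - r..u} w" if "u \<ge> 0" for u
      by (rule continuous_on_subset[OF w]) (use that in auto)
    have w': "(w has_vector_derivative \<delta> *\<^sub>R y' t) (at t within {0..})" if "t \<ge> 0" for t
      unfolding w_def[abs_def] using y0' that
      by (intro bounded_linear.has_vector_derivative[OF bounded_linear_scaleR_right]) auto
    have res: "norm (\<delta> *\<^sub>R y' t - L t (history r w t)) \<le> \<delta>" if "t \<ge> 0" for t
    proof -
      have "\<delta> *\<^sub>R y' t - L t (history r w t) = \<delta> *\<^sub>R (y' t - L t (history r y t))"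
        using that by (simp add: hist_w blinfun.scaleR_right scaleR_diff_right)
      then show ?thesis using res0 that \<delta> by (simp add: mult_left_le)
    qed
    define e where "e n = history r w (real n) - evolution (real n) (real (n - 1)) (history r w (real (n - 1)))" for n
    have e: "norm (e n) \<le> c" "history r (apply_bcontfun (e n)) 0 = e n" if n: "n > 0" for n
    proof -
      define s where "s = real (n - 1)"
      have s: "s \<ge> 0" "s \<le> real n" "real n - s = 1" using n by (auto simp: s_def)
      define x where "x = flow s (history r w s)"
      have x: "solution s x" "history r x s = history r w s"
        using flow[OF s(1), of "history r w s"] history_history[OF r_nonneg cw[OF s(1)]]
        by (auto simp: x_def)
      have e_eq: "e n = history r w (real n) - history r x (real n)"
        by (simp add: e_def x_def evolution_def s_def)
      have "norm (history r x (real n) - history r w (real n))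
          \<le> (3 * norm (history r x s - history r w s) + 2 * \<delta>) * exp (growth_rate * (real n - s))"
        using \<delta> by (intro segment_defect[OF s(1) _ w w' res x(1) s(2)]) auto
      also have "\<dots> = c" by (simp add: x s \<delta>_def)
      finally show "norm (e n) \<le> c" by (simp add: e_eq norm_minus_commute)
      have "e n = history r (\<lambda>u. w u - x u) (real n)"
        unfolding e_eq using s x by (intro history_diff[OF r_nonneg, symmetric] cw solution_continuous) auto
      moreover have "continuous_on {real n - r..real n} (\<lambda>u. w u - x u)"
        using s by (intro continuous_intros cw solution_continuous[OF x(1)]) auto
      ultimately show "history r (apply_bcontfun (e n)) 0 = e n"
        using history_history[OF r_nonneg] by metis
    qed
    \<comment> \<open>No step leads into time 0, so \<open>e 0\<close> is not a defect and index 0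
      is suppressed.\<close>
    define G where "G k n = (if k = 0 then 0 else g k (e k) n)" for k n
    define a where "a n k = q ^ ((n - k) + (k - n))" for n k
    have G_le: "norm (G k n) \<le> D * a n k" for k n
      using bound[of k "e k" n] e[of k] D q by (simp add: G_def a_def)
    have a: "summable (\<lambda>k. D * a n k)" "(\<Sum>k. D * a n k) \<le> Z" for n
    proof -
      show "summable (\<lambda>k. D * a n k)"
        unfolding a_def by (intro summable_mult two_sided_geometric q)
      have "(\<Sum>k. D * a n k) = D * (\<Sum>k. a n k)"
        unfolding a_def by (intro suminf_mult two_sided_geometric q)
      also have "\<dots> \<le> Z"
        unfolding Z_def a_def using D by (intro mult_left_mono two_sided_geometric q)
      finally show "(\<Sum>k. D * a n k) \<le> Z" .
    qed
    have G_summable: "summable (\<lambda>k. norm (G k n))" for n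
      by (rule summable_comparison_test'[OF a(1)[of n], of 0]) (use G_le in simp)
    define z where "z n = (\<Sum>k. G k n)" for n
    have z_le: "norm (z n) \<le> Z" for n
    proof -
      have "norm (z n) \<le> (\<Sum>k. norm (G k n))" unfolding z_def by (rule summable_norm[OF G_summable])
      also have "\<dots> \<le> (\<Sum>k. D * a n k)" by (intro suminf_le G_le G_summable a)
      also have "\<dots> \<le> Z" by (rule a)
      finally show ?thesis .
    qed
    have z_sums: "(\<lambda>k. G k n) sums z n" for n
      unfolding z_def by (rule summable_sums[OF summable_norm_cancel[OF G_summable]])
    have ev_lin: "bounded_linear (evolution t s)" if "0 \<le> s" "s \<le> t" for s t
    proof -
      interpret evolution_family evolution 1 "3 * exp (growth_rate * 1)"
        by (rule evolution_evolution_family) simp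
      show ?thesis by (rule bl[OF that])
    qed
    have z_step: "z (Suc n) = evolution (real (Suc n)) (real n) (z n) + e (Suc n)" for n
    proof -
      have "(\<lambda>k. evolution (real (Suc n)) (real n) (G k n) + (if k = Suc n then e k else 0))
          sums (evolution (real (Suc n)) (real n) (z n) + e (Suc n))"
        by (intro sums_add bounded_linear.sums[OF ev_lin] z_sums sums_single) auto
      moreover have "evolution (real (Suc n)) (real n) (G k n) + (if k = Suc n then e k else 0) = G k (Suc n)" for k
        using step[of k "e k" n] e[of k] linear_0[OF bounded_linear.linear[OF ev_lin], of "real n" "real (Suc n)"]
        by (auto simp: G_def)
      ultimately show ?thesis using sums_unique2[OF z_sums] by simp
    qed
    \<comment> \<open>Subtracting z cancels the defects.\<close>
    define u where "u n = history r w (real n) - z n" for n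
    have u_step: "u (Suc n) = evolution (real (Suc n)) (real n) (u n)" for n
      using linear_diff[OF bounded_linear.linear[OF ev_lin], of "real n" "real (Suc n)"]
      by (simp add: u_def z_step e_def)
    define x where "x = flow 0 (u 0)"
    have x: "solution 0 x" unfolding x_def by (rule flow) simp
    have hist_x: "history r x t = evolution t 0 (u 0)" for t by (simp add: x_def evolution_def)
    have x_late: "history r x (real (Suc n)) = u (Suc n)" for n
    proof (induction n)
      case 0
      show ?case using u_step[of 0] by (simp add: hist_x)
    next
      case (Suc n)
      have "history r x (real (Suc (Suc n)))
          = evolution (real (Suc (Suc n))) (real (Suc n)) (evolution (real (Suc n)) 0 (u 0))"
        unfolding hist_x by (rule evolution_cocycle[symmetric]) auto
      also have "\<dots> = u (Suc (Suc n))" using Suc u_step[of "Suc n"] by (simp only: hist_x)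
      finally show ?case .
    qed
    have x_grid: "norm (history r x (real n) - history r w (real n)) \<le> 3 * Z" for n
    proof (cases n)
      \<comment> \<open>The value \<open>z 0\<close> need not be clamped, and x starts from the
        clamped version of \<open>u 0\<close>. So at time 0 the distance is that of
        \<open>evolution 0 0 (z 0)\<close>, with the constant 3 of
        \<open>evolution_norm\<close>.\<close>
      case 0
      have "history r x 0 - history r w 0 = - evolution 0 0 (z 0)"
      proof -
        have "evolution 0 0 (history r w 0) = history r w 0"
          using flow(2)[of 0 "history r w 0"] history_history[OF r_nonneg cw[of 0]]
          by (simp add: evolution_def)
        then show ?thesis
          using linear_diff[OF bounded_linear.linear[OF ev_lin], of 0 0] by (simp add: hist_x u_def)
      qed
      then show ?thesis using evolution_norm[of 0 0 "z 0"] z_le[of 0] 0 by simp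
    next
      case (Suc m)
      have "norm (history r x (real n) - history r w (real n)) = norm (z n)"
        unfolding Suc x_late by (simp add: u_def)
      then show ?thesis using z_le[of n] \<open>Z \<ge> 0\<close> by simp
    qed
    have x_all: "norm (history r x t - history r w t) \<le> K" if t: "t \<ge> 0" for t
    proof -
      define n where "n = nat \<lfloor>t\<rfloor>"
      have n: "real n \<le> t" "t - real n \<le> 1" using t by (auto simp: n_def) linarith
      have "norm (history r x t - history r w t)
          \<le> (3 * norm (history r x (real n) - history r w (real n)) + 2 * \<delta>) * exp (growth_rate * (t - real n))"
        using \<delta> by (intro segment_defect[OF _ _ w w' res solution_restrict[OF x] n(1)]) auto
      also have "\<dots> \<le> (3 * (3 * Z) + 2 * \<delta>) * exp growth_rate"
        using x_grid[of n] \<delta> n growth_rate_pos \<open>Z \<ge> 0\<close>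
        by (intro mult_mono add_mono mult_left_mono) (auto simp: mult_left_le)
      finally show ?thesis by (simp add: K_def)
    qed
    show ?thesis
    proof (intro exI conjI allI impI)
      show "solution 0 (\<lambda>u. (1 / \<delta>) *\<^sub>R x u)" by (rule solution_scaleR[OF x])
      fix t :: real assume t: "t \<ge> 0"
      have "history r (\<lambda>u. (1 / \<delta>) *\<^sub>R x u) t - history r y t = (1 / \<delta>) *\<^sub>R (history r x t - history r w t)"
        using \<delta> t by (simp add: history_scaleR[OF r_nonneg solution_continuous[OF x]] hist_w scaleR_diff_right)
      then show "norm (history r (\<lambda>u. (1 / \<delta>) *\<^sub>R x u) t - history r y t) \<le> K / \<delta>"
        using x_all[OF t] \<delta> by (simp add: divide_right_mono)
    qed
  qed
  then have "shadowing (K / \<delta>)" unfolding shadowing_def by blast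
  then show ?thesis by blast
qed

end

section \<open>Transfer to the space of initial segments\<close>

lemma is_norm_equivalent:
  fixes N :: "real ^ 'n \<Rightarrow> real"
  assumes N: "is_norm N"
  obtains \<alpha> \<beta> where "\<alpha> > 0" "\<beta> > 0" "\<And>v. \<alpha> * norm v \<le> N v" "\<And>v. N v \<le> \<beta> * norm v"
proof -
  have N0: "N v = 0 \<longleftrightarrow> v = 0" and N_scale: "N (c *\<^sub>R v) = \<bar>c\<bar> * N v"
    and N_tri: "N (v + w) \<le> N v + N w" for v w c
    using N by (auto simp: is_norm_def)
  have N_minus: "N (- v) = N v" for v using N_scale[of "-1" v] by simp
  \<comment> \<open>Nonnegativity follows from 0 = N(v - v) <= 2 N(v).\<close>
  have N_nonneg: "N v \<ge> 0" for v using N_tri[of v "- v"] N0[of 0] N_minus[of v] by simp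
  have Nz: "N 0 = 0" using N0 by blast
  have N_sum: "N (sum f I) \<le> (\<Sum>i\<in>I. N (f i))" if "finite I" for f :: "'n \<Rightarrow> real ^ 'n" and I
    using that
  proof (induction I)
    case (insert i I)
    then show ?case using N_tri[of "f i" "sum f I"] by simp
  qed (simp add: Nz)
  define \<beta> where "\<beta> = 1 + (\<Sum>i\<in>UNIV. N (axis i 1))"
  have \<beta>: "\<beta> > 0" using N_nonneg by (simp add: \<beta>_def add_pos_nonneg sum_nonneg)
  have upper: "N v \<le> \<beta> * norm v" for v
  proof -
    have "v = (\<Sum>i\<in>UNIV. (v $ i) *\<^sub>R axis i 1)"
      by (simp add: vec_eq_iff axis_def if_distrib cong: if_cong)
    then have "N v \<le> (\<Sum>i\<in>UNIV. N ((v $ i) *\<^sub>R axis i 1))"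
      using N_sum[of UNIV "\<lambda>i. (v $ i) *\<^sub>R axis i 1"] by simp
    also have "\<dots> \<le> (\<Sum>i\<in>UNIV. norm v * N (axis i 1))"
      unfolding N_scale by (intro sum_mono mult_right_mono component_le_norm_cart N_nonneg)
    also have "\<dots> \<le> \<beta> * norm v"
      by (simp add: \<beta>_def sum_distrib_left[symmetric] algebra_simps)
    finally show ?thesis .
  qed
  have "continuous_on (sphere 0 1) N"
    unfolding continuous_on_iff
  proof (intro ballI allI impI)
    fix v and e :: real assume e: "e > 0"
    have "\<bar>N w - N v\<bar> \<le> \<beta> * dist w v" for w
    proof -
      have "N w \<le> N v + N (w - v)" using N_tri[of v "w - v"] by simp
      moreover have "N v \<le> N w + N (w - v)" using N_tri[of w "v - w"] N_minus[of "w - v"] by simp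
      ultimately show ?thesis using upper[of "w - v"] by (simp add: dist_norm)
    qed
    then have "dist (N w) (N v) < e" if "dist w v < e / \<beta>" for w
      using that \<beta> by (smt (verit) dist_real_def mult.commute pos_less_divide_eq)
    then show "\<exists>d>0. \<forall>w\<in>sphere 0 1. dist w v < d \<longrightarrow> dist (N w) (N v) < e"
      using e \<beta> by (intro exI[of _ "e / \<beta>"]) auto
  qed
  then obtain u where u: "u \<in> sphere 0 1" "\<forall>v\<in>sphere 0 1. N u \<le> N v"
    using continuous_attains_inf[of "sphere 0 1" N] vector_choose_size[of 1]
    by (metis compact_sphere dist_0_norm empty_iff mem_sphere zero_le_one)
  have "u \<noteq> 0" using u by auto
  then have pos: "N u > 0" using N0[of u] N_nonneg[of u] by simp
  have lower: "N u * norm v \<le> N v" for v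
  proof (cases "v = 0")
    case False
    then have "N u \<le> N ((1 / norm v) *\<^sub>R v)" using u(2) by simp
    then show ?thesis using False by (simp add: N_scale field_simps)
  qed (simp add: Nz)
  show thesis by (rule that[OF pos \<beta> lower upper])
qed

lemma segment_in_hist_space:
  assumes "continuous_on {t - r..t} x"
  shows "segment r x t \<in> hist_space r"
proof -
  have "continuous_on {-r..0} (\<lambda>\<theta>. x (t + \<theta>))"
    by (rule continuous_on_compose2[OF assms]) (auto intro!: continuous_intros)
  then have "continuous_on {-r..0} (segment r x t)"
    by (rule continuous_on_eq) (simp add: segment_def)
  then show ?thesis by (auto simp: hist_space_def segment_def)
qed

lemma history_segment:
  assumes "r \<ge> 0"
  shows "history r (segment r x t) 0 = history r x t"
proof -
  have "(\<lambda>\<theta>. segment r x t (0 + max (- r) (min 0 \<theta>))) = (\<lambda>\<theta>. x (t + max (- r) (min 0 \<theta>)))"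
    using assms by (auto simp: segment_def)
  then show ?thesis by (simp add: history_def)
qed

lemma segment_history:
  assumes r: "r \<ge> 0" and x: "continuous_on {t - r..t} x"
  shows "segment r (apply_bcontfun (history r x t)) 0 = segment r x t"
  by (auto simp: segment_def fun_eq_iff apply_history[OF r x])

section \<open>The history space with an arbitrary norm, seen inside the bounded continuous
  functions\<close>

locale normed_delay_equation =
  fixes N :: "real ^ 'n \<Rightarrow> real" and r :: real
    and L :: "real \<Rightarrow> (real \<Rightarrow> real ^ 'n) \<Rightarrow> real ^ 'n" and \<alpha> \<beta> M\<^sub>0 :: real
  assumes N: "is_norm N" and r: "r \<ge> 0"
    and lin: "\<And>t. t \<ge> 0 \<Longrightarrow> bounded_linear_to_vec N r (L t)"
    and cont: "continuous_in_op_norm N r L"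
    and bound: "\<And>t. t \<ge> 0 \<Longrightarrow> op_norm N r N (L t) \<le> ereal M\<^sub>0"
    and \<alpha>: "\<alpha> > 0" and \<beta>: "\<beta> > 0"
    and N_lower: "\<And>v. \<alpha> * norm v \<le> N v" and N_upper: "\<And>v. N v \<le> \<beta> * norm v"
begin

lemma N_scaleR: "N (c *\<^sub>R v) = \<bar>c\<bar> * N v"
  using N by (auto simp: is_norm_def)

abbreviation embed :: "(real \<Rightarrow> real ^ 'n) \<Rightarrow> (real \<Rightarrow>\<^sub>C (real ^ 'n))" where
  "embed \<phi> \<equiv> history r \<phi> 0"

text \<open>Inverse to \<open>embed\<close> between \<open>hist_space r\<close> and the clamped
  functions; on arbitrary f, \<open>embed\<close> after \<open>restr\<close> is the clamping
  projection.\<close>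

definition restr :: "(real \<Rightarrow>\<^sub>C (real ^ 'n)) \<Rightarrow> (real \<Rightarrow> real ^ 'n)" where
  "restr f = segment r (apply_bcontfun f) 0"

lemma hist_space_continuous: "\<phi> \<in> hist_space r \<Longrightarrow> continuous_on {0 - r..0} \<phi>"
  by (simp add: hist_space_def)

lemma restr_in_hist_space: "restr f \<in> hist_space r"
  unfolding restr_def by (rule segment_in_hist_space) simp

lemma restr_embed:
  assumes "\<phi> \<in> hist_space r"
  shows "restr (embed \<phi>) = \<phi>"
  using segment_history[OF r hist_space_continuous[OF assms]] assms
  by (auto simp: restr_def segment_def hist_space_def fun_eq_iff)

lemma embed_restr: "embed (restr f) = history r (apply_bcontfun f) 0"
  unfolding restr_def by (rule history_segment[OF r])

lemma restr_add: "restr (f + g) = (\<lambda>\<theta>. restr f \<theta> + restr g \<theta>)"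
  by (auto simp: restr_def segment_def)

lemma restr_scaleR: "restr (c *\<^sub>R f) = (\<lambda>\<theta>. c *\<^sub>R restr f \<theta>)"
  by (auto simp: restr_def segment_def)

lemma restr_zero: "restr 0 = (\<lambda>\<theta>. 0)"
  by (auto simp: restr_def segment_def)

lemma hist_space_diff: "\<phi> \<in> hist_space r \<Longrightarrow> \<psi> \<in> hist_space r \<Longrightarrow> (\<lambda>\<theta>. \<phi> \<theta> - \<psi> \<theta>) \<in> hist_space r"
  by (auto simp: hist_space_def intro!: continuous_intros)

lemma hist_space_scaleR: "\<phi> \<in> hist_space r \<Longrightarrow> (\<lambda>\<theta>. c *\<^sub>R \<phi> \<theta>) \<in> hist_space r"
  by (auto simp: hist_space_def intro!: continuous_intros)

lemma embed_add: "\<phi> \<in> hist_space r \<Longrightarrow> \<psi> \<in> hist_space r \<Longrightarrow> embed (\<lambda>\<theta>. \<phi> \<theta> + \<psi> \<theta>) = embed \<phi> + embed \<psi>"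
  by (intro history_add r hist_space_continuous)

lemma embed_diff: "\<phi> \<in> hist_space r \<Longrightarrow> \<psi> \<in> hist_space r \<Longrightarrow> embed (\<lambda>\<theta>. \<phi> \<theta> - \<psi> \<theta>) = embed \<phi> - embed \<psi>"
  by (intro history_diff r hist_space_continuous)

lemma embed_scaleR: "\<phi> \<in> hist_space r \<Longrightarrow> embed (\<lambda>\<theta>. c *\<^sub>R \<phi> \<theta>) = c *\<^sub>R embed \<phi>"
  by (intro history_scaleR r hist_space_continuous)

lemma hist_norm_bounds:
  assumes \<phi>: "\<phi> \<in> hist_space r"
  shows "\<alpha> * norm (embed \<phi>) \<le> hist_norm N r \<phi>" "hist_norm N r \<phi> \<le> \<beta> * norm (embed \<phi>)"
proof -
  note c = hist_space_continuous[OF \<phi>]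
  have up: "N (\<phi> \<theta>) \<le> \<beta> * norm (embed \<phi>)" if "\<theta> \<in> {-r..0}" for \<theta>
  proof -
    have "norm (\<phi> \<theta>) \<le> norm (embed \<phi>)" using that by (intro norm_history_ge[OF r c]) auto
    then have "\<beta> * norm (\<phi> \<theta>) \<le> \<beta> * norm (embed \<phi>)" using \<beta> by (intro mult_left_mono) auto
    then show ?thesis using N_upper[of "\<phi> \<theta>"] by linarith
  qed
  then show "hist_norm N r \<phi> \<le> \<beta> * norm (embed \<phi>)"
    unfolding hist_norm_def using r by (intro cSUP_least) auto
  have bdd: "bdd_above ((\<lambda>\<theta>. N (\<phi> \<theta>)) ` {-r..0})" using up by (rule bdd_aboveI2)
  have "norm (embed \<phi>) \<le> hist_norm N r \<phi> / \<alpha>"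
  proof (rule norm_history_le[OF r c])
    fix u assume "0 - r \<le> u" "u \<le> 0"
    then have "N (\<phi> u) \<le> hist_norm N r \<phi>"
      unfolding hist_norm_def by (intro cSUP_upper[OF _ bdd]) auto
    then have "\<alpha> * norm (\<phi> u) \<le> hist_norm N r \<phi>" using N_lower[of "\<phi> u"] by linarith
    then show "norm (\<phi> u) \<le> hist_norm N r \<phi> / \<alpha>" using \<alpha> by (simp add: field_simps)
  qed
  then show "\<alpha> * norm (embed \<phi>) \<le> hist_norm N r \<phi>" using \<alpha> by (simp add: field_simps)
qed

lemma hist_norm_restr_le: "hist_norm N r (restr f) \<le> \<beta> * norm f"
proof -
  have "\<beta> * norm (embed (restr f)) \<le> \<beta> * norm f"
    using \<beta> norm_history_apply_le[OF r, of f] by (simp add: embed_restr)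
  then show ?thesis using hist_norm_bounds(2)[OF restr_in_hist_space, of f] by linarith
qed

lemma op_norm_leD:
  assumes "op_norm N r Q A \<le> ereal K" "\<phi> \<in> hist_space r" "hist_norm N r \<phi> \<le> 1"
  shows "Q (A \<phi>) \<le> K"
  using assms unfolding op_norm_def SUP_le_iff by auto

lemma op_norm_leI:
  assumes "\<And>\<phi>. \<phi> \<in> hist_space r \<Longrightarrow> hist_norm N r \<phi> \<le> 1 \<Longrightarrow> Q (A \<phi>) \<le> K"
  shows "op_norm N r Q A \<le> ereal K"
  unfolding op_norm_def SUP_le_iff using assms by auto

lemma op_norm_vec_bound:
  assumes hom: "\<And>c. A (\<lambda>\<theta>. c *\<^sub>R restr f \<theta>) = c *\<^sub>R A (restr f)"
    and K: "op_norm N r N A \<le> ereal K"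
  shows "norm (A (restr f)) \<le> K * \<beta> / \<alpha> * norm f"
proof (cases "f = 0")
  case True
  have "A (restr f) = 0" using hom[of 0] True by (simp add: restr_zero)
  then show ?thesis using True by simp
next
  case False
  define c where "c = 1 / (\<beta> * norm f)"
  have c: "c > 0" using False \<beta> by (simp add: c_def)
  have "restr (c *\<^sub>R f) \<in> hist_space r" by (rule restr_in_hist_space)
  moreover have "hist_norm N r (restr (c *\<^sub>R f)) \<le> 1"
    using hist_norm_restr_le[of "c *\<^sub>R f"] \<beta> False by (simp add: c_def)
  ultimately have "N (A (restr (c *\<^sub>R f))) \<le> K" by (rule op_norm_leD[OF K])
  then have "c * N (A (restr f)) \<le> K" using c by (simp add: restr_scaleR hom N_scaleR)
  then have "N (A (restr f)) \<le> K * \<beta> * norm f"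
    using False \<beta> by (simp add: c_def field_simps)
  then have "\<alpha> * norm (A (restr f)) \<le> K * \<beta> * norm f" using N_lower[of "A (restr f)"] by linarith
  then show ?thesis using \<alpha> by (simp add: field_simps)
qed

definition Lb :: "real \<Rightarrow> (real \<Rightarrow>\<^sub>C (real ^ 'n)) \<Rightarrow>\<^sub>L (real ^ 'n)" where
  "Lb t = Blinfun (\<lambda>f. L t (restr f))"

lemma L_add:
  "t \<ge> 0 \<Longrightarrow> \<phi> \<in> hist_space r \<Longrightarrow> \<psi> \<in> hist_space r \<Longrightarrow> L t (\<lambda>\<theta>. \<phi> \<theta> + \<psi> \<theta>) = L t \<phi> + L t \<psi>"
  and L_scaleR: "t \<ge> 0 \<Longrightarrow> \<phi> \<in> hist_space r \<Longrightarrow> L t (\<lambda>\<theta>. c *\<^sub>R \<phi> \<theta>) = c *\<^sub>R L t \<phi>"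
  using lin unfolding bounded_linear_to_vec_def by blast+

lemma L_bound:
  assumes "t \<ge> 0"
  shows "norm (L t (restr f)) \<le> M\<^sub>0 * \<beta> / \<alpha> * norm f"
  by (rule op_norm_vec_bound[where A = "L t"]) (use assms L_scaleR restr_in_hist_space bound in auto)

lemma Lb: 
  assumes "t \<ge> 0"
  shows "Lb t f = L t (restr f)"
proof -
  have "bounded_linear (\<lambda>f. L t (restr f))"
  proof (rule bounded_linear_intro[where K = "M\<^sub>0 * \<beta> / \<alpha>"])
    show "norm (L t (restr f)) \<le> norm f * (M\<^sub>0 * \<beta> / \<alpha>)" for f
      using L_bound[OF assms, of f] by (simp only: mult.commute)
    show "L t (restr (f + g)) = L t (restr f) + L t (restr g)" for f g
      unfolding restr_add by (rule L_add[OF assms restr_in_hist_space restr_in_hist_space])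
    show "L t (restr (c *\<^sub>R f)) = c *\<^sub>R L t (restr f)" for c f
      unfolding restr_scaleR by (rule L_scaleR[OF assms restr_in_hist_space])
  qed
  then show ?thesis by (simp add: Lb_def bounded_linear_Blinfun_apply)
qed

lemma Lb_continuous: "continuous_on {0..} Lb"
  unfolding continuous_on_def
proof (intro ballI tendstoI)
  fix t e :: real assume t: "t \<in> {0..}" and e: "e > 0"
  \<comment> \<open>Chosen so that passing from \<open>N\<close> to the Euclidean norm, a factor
    \<beta> / \<alpha>, gives e / 2.\<close>
  define K where "K = e * \<alpha> / (2 * \<beta>)"
  have "K > 0" using e \<alpha> \<beta> by (simp add: K_def)
  have "((\<lambda>s. op_norm N r N (\<lambda>\<phi>. L s \<phi> - L t \<phi>)) \<longlongrightarrow> 0) (at t within {0..})"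
    using cont t by (auto simp: continuous_in_op_norm_def)
  then have "\<forall>\<^sub>F s in at t within {0..}. op_norm N r N (\<lambda>\<phi>. L s \<phi> - L t \<phi>) < ereal K"
    by (rule order_tendstoD) (use \<open>K > 0\<close> in simp)
  moreover have "\<forall>\<^sub>F s in at t within {0..}. s \<ge> 0"
    by (auto simp: eventually_at_filter)
  ultimately show "\<forall>\<^sub>F s in at t within {0..}. dist (Lb s) (Lb t) < e"
  proof eventually_elim
    case (elim s)
    have "norm (Lb s - Lb t) \<le> K * \<beta> / \<alpha>"
    proof (rule norm_blinfun_bound)
      show "K * \<beta> / \<alpha> \<ge> 0" using \<open>K > 0\<close> \<alpha> \<beta> by simp
      fix f
      have "norm (L s (restr f) - L t (restr f)) \<le> K * \<beta> / \<alpha> * norm f"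
        using elim t
        by (intro op_norm_vec_bound[where A = "\<lambda>\<phi>. L s \<phi> - L t \<phi>"])
          (auto simp: L_scaleR restr_in_hist_space scaleR_diff_right)
      then show "norm ((Lb s - Lb t) f) \<le> K * \<beta> / \<alpha> * norm f"
        using elim t by (simp add: blinfun.diff_left Lb)
    qed
    also have "\<dots> < e" using e \<alpha> \<beta> by (simp add: K_def)
    finally show ?case by (simp add: dist_norm)
  qed
qed

sublocale delay_equation r Lb "\<bar>M\<^sub>0\<bar> * \<beta> / \<alpha>"
proof
  fix t :: real assume t: "t \<ge> 0"
  show "norm (Lb t) \<le> \<bar>M\<^sub>0\<bar> * \<beta> / \<alpha>"
  proof (rule norm_blinfun_bound)
    show "0 \<le> \<bar>M\<^sub>0\<bar> * \<beta> / \<alpha>" using \<alpha> \<beta> by simp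
    fix f
    have "norm (L t (restr f)) \<le> M\<^sub>0 * \<beta> / \<alpha> * norm f" by (rule L_bound[OF t])
    also have "\<dots> \<le> \<bar>M\<^sub>0\<bar> * \<beta> / \<alpha> * norm f"
      using \<alpha> \<beta> by (intro mult_right_mono divide_right_mono) auto
    finally show "norm (Lb t f) \<le> \<bar>M\<^sub>0\<bar> * \<beta> / \<alpha> * norm f" by (simp add: Lb[OF t])
  qed
qed (use r Lb_continuous in auto)

lemma L_segment:
  assumes "t \<ge> 0" "continuous_on {t - r..t} x"
  shows "L t (segment r x t) = Lb t (history r x t)"
  by (simp add: Lb[OF assms(1)] restr_def segment_history[OF r assms(2)])

lemma dde_solution_iff:
  assumes "s \<ge> 0"
  shows "dde_solution r L s x \<longleftrightarrow> solution s x"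
proof -
  have eq: "L t (segment r x t) = Lb t (history r x t)" if "continuous_on {s - r..} x" "t \<ge> s" for t
    using assms that by (intro L_segment continuous_on_subset[OF that(1)]) auto
  show ?thesis
    by (cases "continuous_on {s - r..} x") (simp_all add: dde_solution_def solution_def eq)
qed

lemma embed_restr_evolution:
  assumes "0 \<le> s" "s \<le> t"
  shows "embed (restr (evolution t s f)) = evolution t s f"
  unfolding embed_restr evolution_def
  by (rule history_history[OF r solution_continuous[OF flow(1)[OF assms(1)] assms(2)]])

text \<open>The definite description is legitimate: a solution exists by \<open>flow\<close>, and
  \<open>evolution_solution\<close> shows that any other has the same segment at time t.\<close>

lemma sol_op_eq:
  assumes st: "0 \<le> s" "s \<le> t" and \<phi>: "\<phi> \<in> hist_space r"
  shows "sol_op r L t s \<phi> = restr (evolution t s (embed \<phi>))"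
  unfolding sol_op_def
proof (rule the_equality)
  define x where "x = flow s (embed \<phi>)"
  have x: "solution s x" "history r x s = embed (apply_bcontfun (embed \<phi>))"
    using flow[OF st(1), of "embed \<phi>"] by (auto simp: x_def)
  have x_hist: "history r x s = embed \<phi>"
    unfolding x(2) by (rule history_history[OF r hist_space_continuous[OF \<phi>]])
  have "segment r x s = restr (history r x s)"
    using segment_history[OF r solution_continuous[OF x(1)], of s] by (simp add: restr_def)
  also have "\<dots> = \<phi>" unfolding x_hist by (rule restr_embed[OF \<phi>])
  finally have "segment r x s = \<phi>" .
  moreover have "restr (evolution t s (embed \<phi>)) = segment r x t"
    unfolding evolution_def x_def[symmetric] restr_def by (rule segment_history[OF r solution_continuous[OF x(1) st(2)]])
  ultimately show "\<exists>x. dde_solution r L s x \<and> segment r x s = \<phi> \<and> restr (evolution t s (embed \<phi>)) = segment r x t"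
    using x(1) dde_solution_iff[OF st(1)] by blast
next
  fix \<psi> assume "\<exists>x. dde_solution r L s x \<and> segment r x s = \<phi> \<and> \<psi> = segment r x t"
  then obtain x where x: "solution s x" "segment r x s = \<phi>" "\<psi> = segment r x t"
    using dde_solution_iff[OF st(1)] by blast
  have "history r x s = embed \<phi>" using history_segment[OF r, of x s] x(2) by simp
  then have "evolution t s (embed \<phi>) = history r x t"
    using evolution_solution[OF st x(1)] by simp
  then show "\<psi> = restr (evolution t s (embed \<phi>))"
    using segment_history[OF r solution_continuous[OF x(1) st(2)]] x(3) by (simp add: restr_def)
qed

lemma sol_op_in_hist_space:
  assumes "0 \<le> s" "s \<le> t" "\<phi> \<in> hist_space r"
  shows "sol_op r L t s \<phi> \<in> hist_space r"
  by (simp add: sol_op_eq[OF assms] restr_in_hist_space)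

lemma embed_sol_op:
  assumes "0 \<le> s" "s \<le> t" "\<phi> \<in> hist_space r"
  shows "embed (sol_op r L t s \<phi>) = evolution t s (embed \<phi>)"
  by (simp add: sol_op_eq[OF assms] embed_restr_evolution assms)

lemma embed_inject:
  assumes "\<phi> \<in> hist_space r" "\<psi> \<in> hist_space r" "embed \<phi> = embed \<psi>"
  shows "\<phi> = \<psi>"
proof -
  have "restr (embed \<phi>) = restr (embed \<psi>)" using assms(3) by (rule arg_cong)
  then show ?thesis by (simp only: restr_embed assms(1,2))
qed

lemma evolution_self:
  assumes "s \<ge> 0"
  shows "evolution s s f = embed (apply_bcontfun f)"
  using flow(2)[OF assms] by (simp add: evolution_def)

lemma evolution_self_embed:
  assumes "s \<ge> 0" "\<phi> \<in> hist_space r"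
  shows "evolution s s (embed \<phi>) = embed \<phi>"
  unfolding evolution_self[OF assms(1)] by (rule history_history[OF r hist_space_continuous[OF assms(2)]])

lemma sol_op_cocycle:
  assumes "0 \<le> u" "u \<le> s" "s \<le> t" "\<phi> \<in> hist_space r"
  shows "sol_op r L t s (sol_op r L s u \<phi>) = sol_op r L t u \<phi>"
proof (rule embed_inject)
  show "embed (sol_op r L t s (sol_op r L s u \<phi>)) = embed (sol_op r L t u \<phi>)"
    using assms by (simp add: embed_sol_op sol_op_in_hist_space evolution_cocycle)
qed (use assms in \<open>auto intro!: sol_op_in_hist_space\<close>)

lemma sol_op_self:
  assumes "0 \<le> s" "\<phi> \<in> hist_space r"
  shows "sol_op r L s s \<phi> = \<phi>"
  using assms by (simp add: sol_op_eq evolution_self_embed restr_embed)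

end

section \<open>Equivalence of the three notions\<close>

context normed_delay_equation
begin

lemma approx_solution_iff:
  "approx_solution N r L \<delta> y \<longleftrightarrow> continuous_on {-r..} y \<and>
     (\<exists>y'. continuous_on {0..} y' \<and> (\<forall>t\<ge>0. (y has_vector_derivative y' t) (at t within {0..})) \<and>
       (\<forall>t\<ge>0. N (y' t - Lb t (history r y t)) \<le> \<delta>))"
proof -
  have "L t (segment r y t) = Lb t (history r y t)" if "continuous_on {-r..} y" "t \<ge> 0" for t
    using that by (intro L_segment continuous_on_subset[OF that(1)]) auto
  then show ?thesis
    by (cases "continuous_on {-r..} y") (simp_all add: approx_solution_def SUP_le_iff Ball_def)
qed

lemma continuous_window:
  assumes "continuous_on {-r..} y" "t \<ge> 0"
  shows "continuous_on {t - r..t} (y :: real \<Rightarrow> real ^ 'n)"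
  by (rule continuous_on_subset[OF assms(1)]) (use assms(2) in auto)

lemma solution_0_continuous: "solution 0 x \<Longrightarrow> continuous_on {-r..} x"
  by (simp add: solution_def)

lemma segment_diff_bounds:
  assumes x: "continuous_on {-r..} x" and y: "continuous_on {-r..} y" and t: "t \<ge> 0"
  shows "\<alpha> * norm (history r x t - history r y t)
      \<le> hist_norm N r (\<lambda>\<theta>. segment r x t \<theta> - segment r y t \<theta>)"
    and "hist_norm N r (\<lambda>\<theta>. segment r x t \<theta> - segment r y t \<theta>)
      \<le> \<beta> * norm (history r x t - history r y t)"
proof -
  note c = continuous_window[OF x t] continuous_window[OF y t]
  have "(\<lambda>\<theta>. segment r x t \<theta> - segment r y t \<theta>) = segment r (\<lambda>u. x u - y u) t"
    by (auto simp: segment_def)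
  moreover have "segment r (\<lambda>u. x u - y u) t \<in> hist_space r"
    by (intro segment_in_hist_space continuous_on_diff c)
  moreover have "embed (segment r (\<lambda>u. x u - y u) t) = history r x t - history r y t"
    by (simp add: history_segment[OF r] history_diff[OF r c])
  ultimately show "\<alpha> * norm (history r x t - history r y t)
      \<le> hist_norm N r (\<lambda>\<theta>. segment r x t \<theta> - segment r y t \<theta>)"
    "hist_norm N r (\<lambda>\<theta>. segment r x t \<theta> - segment r y t \<theta>)
      \<le> \<beta> * norm (history r x t - history r y t)"
    using hist_norm_bounds by metis+
qed

lemma sup_dist_le_iff:
  "sup_dist N r x y \<le> ereal K \<longleftrightarrow>
    (\<forall>t\<ge>0. hist_norm N r (\<lambda>\<theta>. segment r x t \<theta> - segment r y t \<theta>) \<le> K)"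
  by (simp add: sup_dist_def SUP_le_iff Ball_def)

lemma shadowing_imp_hyers_ulam:
  assumes "shadowing K"
  shows "hyers_ulam_stable N r L"
  unfolding hyers_ulam_stable_def
\<comment> \<open>The summand 1 keeps the constant positive even if K = 0.\<close>
proof (intro exI[of _ "\<beta> * \<bar>K\<bar> / \<alpha> + 1"] conjI allI impI)
  show "\<beta> * \<bar>K\<bar> / \<alpha> + 1 > 0" using \<alpha> \<beta> by (simp add: add_nonneg_pos)
  fix \<delta> :: real and y :: "real \<Rightarrow> real ^ 'n"
  assume \<delta>: "\<delta> > 0" and "approx_solution N r L \<delta> y"
  then obtain y' where y: "continuous_on {-r..} y" and y': "continuous_on {0..} y'"
    "\<And>t. t \<ge> 0 \<Longrightarrow> (y has_vector_derivative y' t) (at t within {0..})"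
    "\<And>t. t \<ge> 0 \<Longrightarrow> N (y' t - Lb t (history r y t)) \<le> \<delta>"
    by (auto simp: approx_solution_iff)
  \<comment> \<open>An \<open>N\<close>-residual of at most \<delta> is a Euclidean one of at most
    \<delta> / \<alpha>; multiplying by \<open>c\<close> normalises it to 1.\<close>
  define c where "c = \<alpha> / \<delta>"
  have c: "c > 0" using \<alpha> \<delta> by (simp add: c_def)
  have "\<exists>x. solution 0 x \<and> (\<forall>t\<ge>0. norm (history r x t - history r (\<lambda>u. c *\<^sub>R y u) t) \<le> K)"
  proof (rule assms[unfolded shadowing_def, rule_format])
    show "continuous_on {-r..} (\<lambda>u. c *\<^sub>R y u)" by (intro continuous_intros y)
    show "continuous_on {0..} (\<lambda>u. c *\<^sub>R y' u)" by (intro continuous_intros y')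
    fix t :: real assume t: "t \<ge> 0"
    show "((\<lambda>u. c *\<^sub>R y u) has_vector_derivative c *\<^sub>R y' t) (at t within {0..})"
      by (rule bounded_linear.has_vector_derivative[OF bounded_linear_scaleR_right y'(2)[OF t]])
    have "\<alpha> * norm (y' t - Lb t (history r y t)) \<le> \<delta>"
      using N_lower y'(3)[OF t] by (rule order_trans)
    then have "c * norm (y' t - Lb t (history r y t)) \<le> 1" using \<delta> by (simp add: c_def field_simps)
    moreover have "c *\<^sub>R y' t - Lb t (history r (\<lambda>u. c *\<^sub>R y u) t) = c *\<^sub>R (y' t - Lb t (history r y t))"
      by (simp add: history_scaleR[OF r continuous_window[OF y t]] blinfun.scaleR_right scaleR_diff_right)
    ultimately show "norm (c *\<^sub>R y' t - Lb t (history r (\<lambda>u. c *\<^sub>R y u) t)) \<le> 1" using c by simp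
  qed
  then obtain x where x: "solution 0 x"
    "\<And>t. t \<ge> 0 \<Longrightarrow> norm (history r x t - history r (\<lambda>u. c *\<^sub>R y u) t) \<le> K" by blast
  define x1 where "x1 u = (1 / c) *\<^sub>R x u" for u
  have x1: "solution 0 x1" unfolding x1_def[abs_def] by (rule solution_scaleR[OF x(1)])
  show "\<exists>x. dde_solution r L 0 x \<and> sup_dist N r x y \<le> ereal ((\<beta> * \<bar>K\<bar> / \<alpha> + 1) * \<delta>)"
  proof (intro exI conjI)
    show "dde_solution r L 0 x1" using x1 by (simp add: dde_solution_iff)
    show "sup_dist N r x1 y \<le> ereal ((\<beta> * \<bar>K\<bar> / \<alpha> + 1) * \<delta>)"
      unfolding sup_dist_le_iff
    proof (intro allI impI)
      fix t :: real assume t: "t \<ge> 0"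
      have "history r x1 t - history r y t = (1 / c) *\<^sub>R (history r x t - history r (\<lambda>u. c *\<^sub>R y u) t)"
        using c unfolding x1_def[abs_def]
        by (simp add: history_scaleR[OF r continuous_window[OF y t]]
            history_scaleR[OF r solution_continuous[OF x(1) t]] scaleR_diff_right)
      then have "norm (history r x1 t - history r y t) \<le> K / c"
        using x(2)[OF t] c by (simp add: divide_right_mono)
      also have "\<dots> \<le> \<bar>K\<bar> * \<delta> / \<alpha>" using \<alpha> \<delta> by (simp add: c_def divide_right_mono mult_right_mono)
      finally have "\<beta> * norm (history r x1 t - history r y t) \<le> \<beta> * (\<bar>K\<bar> * \<delta> / \<alpha>)"
        using \<beta> by (intro mult_left_mono) auto
      also have "\<dots> \<le> (\<beta> * \<bar>K\<bar> / \<alpha> + 1) * \<delta>" using \<delta> by (simp add: algebra_simps)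
      finally show "hist_norm N r (\<lambda>\<theta>. segment r x1 t \<theta> - segment r y t \<theta>) \<le> (\<beta> * \<bar>K\<bar> / \<alpha> + 1) * \<delta>"
        using segment_diff_bounds(2)[OF solution_0_continuous[OF x1] y t] by linarith
    qed
  qed
qed

lemma hyers_ulam_imp_shadowable:
  assumes "hyers_ulam_stable N r L"
  shows "shadowable N r L"
  unfolding shadowable_def
proof (intro allI impI)
  obtain \<kappa> where \<kappa>: "\<kappa> > 0" "\<forall>\<delta>>0. \<forall>y. approx_solution N r L \<delta> y \<longrightarrow>
      (\<exists>x. dde_solution r L 0 x \<and> sup_dist N r x y \<le> ereal (\<kappa> * \<delta>))"
    using assms unfolding hyers_ulam_stable_def by blast
  fix \<epsilon> :: real assume "\<epsilon> > 0"
  then have "\<epsilon> / \<kappa> > 0" "\<kappa> * (\<epsilon> / \<kappa>) = \<epsilon>" using \<kappa> by auto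
  then show "\<exists>\<delta>>0. \<forall>y. approx_solution N r L \<delta> y \<longrightarrow>
      (\<exists>x. dde_solution r L 0 x \<and> sup_dist N r x y \<le> ereal \<epsilon>)"
    using \<kappa>(2) by metis
qed

text \<open>Linearity makes the single choice of 1 for the tolerance sufficient: with its \<delta>,
  every residual of size 1 is scaled by \<delta> / \<beta> and the shadowing orbit scaled
  back.\<close>

lemma shadowable_imp_shadowing:
  assumes "shadowable N r L"
  shows "\<exists>K. shadowing K"
proof -
  obtain \<delta> where \<delta>: "\<delta> > 0" and sh: "\<And>y. approx_solution N r L \<delta> y \<Longrightarrow>
      \<exists>x. dde_solution r L 0 x \<and> sup_dist N r x y \<le> ereal 1"
    using assms unfolding shadowable_def by (metis zero_less_one)
  define c where "c = \<delta> / \<beta>"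
  have c: "c > 0" using \<delta> \<beta> by (simp add: c_def)
  have "\<exists>x. solution 0 x \<and> (\<forall>t\<ge>0. norm (history r x t - history r y t) \<le> 1 / (\<alpha> * c))"
    if y: "continuous_on {-r..} y" and y': "continuous_on {0..} y'"
      "\<forall>t\<ge>0. (y has_vector_derivative y' t) (at t within {0..})"
      "\<forall>t\<ge>0. norm (y' t - Lb t (history r y t)) \<le> 1" for y y'
  proof -
    have cy: "continuous_on {-r..} (\<lambda>u. c *\<^sub>R y u)" by (intro continuous_intros y)
    have "approx_solution N r L \<delta> (\<lambda>u. c *\<^sub>R y u)"
      unfolding approx_solution_iff
    proof (intro conjI exI allI impI cy)
      show "continuous_on {0..} (\<lambda>u. c *\<^sub>R y' u)" by (intro continuous_intros y')
      fix t :: real assume t: "t \<ge> 0"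
      show "((\<lambda>u. c *\<^sub>R y u) has_vector_derivative c *\<^sub>R y' t) (at t within {0..})"
        by (rule bounded_linear.has_vector_derivative[OF bounded_linear_scaleR_right]) (use y' t in blast)
      have "c *\<^sub>R y' t - Lb t (history r (\<lambda>u. c *\<^sub>R y u) t) = c *\<^sub>R (y' t - Lb t (history r y t))"
        by (simp add: history_scaleR[OF r continuous_window[OF y t]] blinfun.scaleR_right scaleR_diff_right)
      then have "N (c *\<^sub>R y' t - Lb t (history r (\<lambda>u. c *\<^sub>R y u) t)) \<le> \<beta> * (c * norm (y' t - Lb t (history r y t)))"
        using N_upper[of "c *\<^sub>R (y' t - Lb t (history r y t))"] c by simp
      also have "\<dots> \<le> \<beta> * (c * 1)" using \<beta> c y'(3) t by (intro mult_left_mono) auto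
      also have "\<dots> = \<delta>" using \<beta> by (simp add: c_def)
      finally show "N (c *\<^sub>R y' t - Lb t (history r (\<lambda>u. c *\<^sub>R y u) t)) \<le> \<delta>" .
    qed
    then obtain x where x: "solution 0 x" "sup_dist N r x (\<lambda>u. c *\<^sub>R y u) \<le> ereal 1"
      using sh by (auto simp: dde_solution_iff)
    show ?thesis
    proof (intro exI conjI allI impI)
      show "solution 0 (\<lambda>u. (1 / c) *\<^sub>R x u)" by (rule solution_scaleR[OF x(1)])
      fix t :: real assume t: "t \<ge> 0"
      have "\<alpha> * norm (history r x t - history r (\<lambda>u. c *\<^sub>R y u) t) \<le> 1"
        using segment_diff_bounds(1)[OF solution_0_continuous[OF x(1)] cy t] x(2) t
        unfolding sup_dist_le_iff by force
      then have "norm (history r x t - history r (\<lambda>u. c *\<^sub>R y u) t) \<le> 1 / \<alpha>"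
        using \<alpha> by (simp add: field_simps)
      moreover have "history r (\<lambda>u. (1 / c) *\<^sub>R x u) t - history r y t
          = (1 / c) *\<^sub>R (history r x t - history r (\<lambda>u. c *\<^sub>R y u) t)"
        using c by (simp add: history_scaleR[OF r continuous_window[OF y t]]
            history_scaleR[OF r solution_continuous[OF x(1) t]] scaleR_diff_right)
      ultimately show "norm (history r (\<lambda>u. (1 / c) *\<^sub>R x u) t - history r y t) \<le> 1 / (\<alpha> * c)"
        using c by (simp add: divide_right_mono flip: divide_divide_eq_left)
    qed
  qed
  then have "shadowing (1 / (\<alpha> * c))" unfolding shadowing_def by blast
  then show ?thesis by blast
qed

lemma op_norm_hist_leI:
  assumes D: "D \<ge> 0" and A: "\<And>\<phi>. \<phi> \<in> hist_space r \<Longrightarrow> A \<phi> = restr (B \<phi>)"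
    and B: "\<And>\<phi>. \<phi> \<in> hist_space r \<Longrightarrow> norm (B \<phi>) \<le> D * norm (embed \<phi>)"
  shows "op_norm N r (hist_norm N r) A \<le> ereal (\<beta> * D / \<alpha>)"
proof (rule op_norm_leI)
  fix \<phi> assume \<phi>: "\<phi> \<in> hist_space r" "hist_norm N r \<phi> \<le> 1"
  have "\<alpha> * norm (embed \<phi>) \<le> 1" using hist_norm_bounds(1)[OF \<phi>(1)] \<phi>(2) by linarith
  then have "D * norm (embed \<phi>) \<le> D * (1 / \<alpha>)" using \<alpha> D by (intro mult_left_mono) (auto simp: field_simps)
  then have "\<beta> * norm (B \<phi>) \<le> \<beta> * (D * (1 / \<alpha>))"
    using B[OF \<phi>(1)] \<beta> by (intro mult_left_mono) auto
  then show "hist_norm N r (A \<phi>) \<le> \<beta> * D / \<alpha>"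
    using hist_norm_restr_le[of "B \<phi>"] by (simp add: A[OF \<phi>(1)])
qed

text \<open>Every kernel is parametrised by \<open>Z\<close> through z |->
  \<open>restr (evolution t 0 z)\<close>. In these coordinates the solution operator between kernels
  is the identity on \<open>Z\<close>, so bijectivity is immediate and its inverse is
  explicit.\<close>

lemma splitting_imp_exponential_dichotomy:
  assumes "perron_splitting evolution h G Z K"
  shows "exponential_dichotomy N r L"
proof -
  interpret perron_splitting evolution h G Z K by (rule assms)
  obtain D \<mu> where D: "D > 0" and \<mu>: "\<mu> > 0"
    and stable: "\<And>s t v. 0 \<le> s \<Longrightarrow> s \<le> t \<Longrightarrow>
       norm (evolution t s (v - evolution s 0 (lift s v))) \<le> D * exp (- \<mu> * (t - s)) * norm v"
    and unstable: "\<And>s t v. 0 \<le> t \<Longrightarrow> t \<le> s \<Longrightarrow>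
       norm (evolution t 0 (lift s v)) \<le> D * exp (- \<mu> * (s - t)) * norm v"
    by (rule splitting_dichotomy) blast
  \<comment> \<open>Q(t) in embedded form, from which P(t) is obtained as the complement.\<close>
  define U where "U t \<phi> = evolution t 0 (lift t (embed \<phi>))" for t \<phi>
  define P where "P t \<phi> = (\<lambda>\<theta>. \<phi> \<theta> - restr (U t \<phi>) \<theta>)" for t \<phi>
  have embed_U: "embed (restr (U t \<phi>)) = U t \<phi>" if "t \<ge> 0" for t \<phi>
    unfolding U_def using that by (intro embed_restr_evolution) auto
  have P_hist: "P t \<phi> \<in> hist_space r" if "\<phi> \<in> hist_space r" for t \<phi>
    unfolding P_def using that restr_in_hist_space by (rule hist_space_diff)
  have embed_P: "embed (P t \<phi>) = embed \<phi> - U t \<phi>" if "t \<ge> 0" "\<phi> \<in> hist_space r" for t \<phi>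
    unfolding P_def by (simp add: embed_diff that restr_in_hist_space embed_U)
  have U_P: "U t (P t \<phi>) = 0" if "t \<ge> 0" "\<phi> \<in> hist_space r" for t \<phi>
  proof -
    have "lift t (embed \<phi> - U t \<phi>) = lift t (embed \<phi>) + (-1) *\<^sub>R lift t (U t \<phi>)"
      using lift_add[of t "embed \<phi>" "(-1) *\<^sub>R U t \<phi>"] lift_scaleR[of t "-1" "U t \<phi>"] that by simp
    also have "\<dots> = 0" using that lift_T0 lift_works(1) by (simp add: U_def)
    finally show ?thesis using that by (simp add: U_def[of t "P t \<phi>"] embed_P T_zero)
  qed
  have U_sol: "U t (sol_op r L t s \<phi>) = evolution t 0 (lift s (embed \<phi>))"
    if "0 \<le> s" "s \<le> t" "\<phi> \<in> hist_space r" for s t \<phi>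
    using that by (simp add: U_def embed_sol_op lift_T)
  have sol_restr: "sol_op r L t s (restr (evolution s 0 z)) = restr (evolution t 0 z)"
    if "0 \<le> s" "s \<le> t" for s t z
    using that by (simp add: sol_op_eq restr_in_hist_space embed_restr_evolution evolution_cocycle)
  have ker: "hist_ker r (P t) = (\<lambda>z. restr (evolution t 0 z)) ` Z" if t: "t \<ge> 0" for t
  proof (intro equalityI subsetI)
    fix \<phi> assume "\<phi> \<in> hist_ker r (P t)"
    then have "\<phi> = restr (U t \<phi>)" by (simp add: hist_ker_def P_def fun_eq_iff)
    then show "\<phi> \<in> (\<lambda>z. restr (evolution t 0 z)) ` Z"
      using lift_works(1)[OF t, of "embed \<phi>"] unfolding U_def by blast
  next
    fix \<phi> assume "\<phi> \<in> (\<lambda>z. restr (evolution t 0 z)) ` Z"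
    then obtain z where z: "z \<in> Z" "\<phi> = restr (evolution t 0 z)" by blast
    then have "U t \<phi> = evolution t 0 z"
      using t by (simp add: U_def embed_restr_evolution lift_T0)
    then show "\<phi> \<in> hist_ker r (P t)"
      using z by (simp add: hist_ker_def P_def restr_in_hist_space)
  qed
  have restr_inj: "z = z'" if "t \<ge> 0" "z \<in> Z" "z' \<in> Z" "restr (evolution t 0 z) = restr (evolution t 0 z')" for t z z'
  proof -
    have "evolution t 0 z = evolution t 0 z'"
      using arg_cong[OF that(4), of embed] that(1) by (simp add: embed_restr_evolution)
    then show ?thesis using lift_T0[OF that(1,2)] lift_T0[OF that(1,3)] by metis
  qed
  have bij: "bij_betw (sol_op r L t s) (hist_ker r (P s)) (hist_ker r (P t))" if st: "0 \<le> s" "s \<le> t" for s t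
    unfolding bij_betw_def
  proof
    show "inj_on (sol_op r L t s) (hist_ker r (P s))"
    proof (rule inj_onI)
      fix \<phi> \<psi> assume *: "\<phi> \<in> hist_ker r (P s)" "\<psi> \<in> hist_ker r (P s)" "sol_op r L t s \<phi> = sol_op r L t s \<psi>"
      then obtain z z' where z: "z \<in> Z" "\<phi> = restr (evolution s 0 z)" "z' \<in> Z" "\<psi> = restr (evolution s 0 z')"
        using st(1) by (auto simp: ker)
      then have "z = z'" using restr_inj[of t z z'] *(3) st by (simp add: sol_restr)
      then show "\<phi> = \<psi>" using z by simp
    qed
    show "sol_op r L t s ` hist_ker r (P s) = hist_ker r (P t)"
      using st by (simp add: ker image_image sol_restr)
  qed
  have proj: "hist_projection N r (P t)" if t: "t \<ge> 0" for t
    unfolding hist_projection_def bounded_linear_to_hist_def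
  proof (intro conjI ballI allI)
    show "P t ` hist_space r \<subseteq> hist_space r" using P_hist by auto
    fix \<phi> :: "real \<Rightarrow> real ^ 'n" assume \<phi>: "\<phi> \<in> hist_space r"
    show "P t (P t \<phi>) = P t \<phi>"
      using U_P[OF t \<phi>] by (simp add: P_def[of t "P t \<phi>"] restr_zero)
    show "P t (\<lambda>\<theta>. c *\<^sub>R \<phi> \<theta>) = (\<lambda>\<theta>. c *\<^sub>R P t \<phi> \<theta>)" for c
    proof -
      have "U t (\<lambda>\<theta>. c *\<^sub>R \<phi> \<theta>) = c *\<^sub>R U t \<phi>"
        using t \<phi> by (simp add: U_def embed_scaleR lift_scaleR T_scaleR)
      then show ?thesis by (simp add: P_def restr_scaleR scaleR_diff_right)
    qed
    show "P t (\<lambda>\<theta>. \<phi> \<theta> + \<psi> \<theta>) = (\<lambda>\<theta>. P t \<phi> \<theta> + P t \<psi> \<theta>)" if "\<psi> \<in> hist_space r" for \<psi>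
    proof -
      have "U t (\<lambda>\<theta>. \<phi> \<theta> + \<psi> \<theta>) = U t \<phi> + U t \<psi>"
        using t \<phi> that by (simp add: U_def embed_add lift_add T_add)
      then show ?thesis by (simp add: P_def restr_add algebra_simps)
    qed
  next
    show "\<exists>K. \<forall>\<phi>\<in>hist_space r. hist_norm N r (P t \<phi>) \<le> K * hist_norm N r \<phi>"
    proof (intro exI ballI)
      fix \<phi> :: "real \<Rightarrow> real ^ 'n" assume \<phi>: "\<phi> \<in> hist_space r"
      \<comment> \<open>Boundedness of the projection is the stable estimate at t = s, because
        \<open>evolution t t\<close> fixes embedded histories.\<close>
      have "embed (P t \<phi>) = evolution t t (embed \<phi> - U t \<phi>)"
        using t \<phi> by (simp add: embed_P T_diff evolution_self_embed U_def evolution_cocycle)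
      then have "norm (embed (P t \<phi>)) \<le> D * norm (embed \<phi>)"
        using stable[OF t order_refl, of "embed \<phi>"] by (simp add: U_def)
      also have "\<dots> \<le> D * (hist_norm N r \<phi> / \<alpha>)"
        using hist_norm_bounds(1)[OF \<phi>] D \<alpha> by (intro mult_left_mono) (auto simp: field_simps)
      finally have "\<beta> * norm (embed (P t \<phi>)) \<le> \<beta> * (D * (hist_norm N r \<phi> / \<alpha>))"
        using \<beta> by (intro mult_left_mono) auto
      then show "hist_norm N r (P t \<phi>) \<le> (\<beta> * D / \<alpha>) * hist_norm N r \<phi>"
        using hist_norm_bounds(2)[OF P_hist[OF \<phi>, of t]] by simp
    qed
  qed
  have comm: "P t (sol_op r L t s \<phi>) = sol_op r L t s (P s \<phi>)"
    if "0 \<le> s" "s \<le> t" "\<phi> \<in> hist_space r" for s t \<phi>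
  proof (rule embed_inject)
    show "P t (sol_op r L t s \<phi>) \<in> hist_space r" "sol_op r L t s (P s \<phi>) \<in> hist_space r"
      using that by (auto intro!: P_hist sol_op_in_hist_space)
    show "embed (P t (sol_op r L t s \<phi>)) = embed (sol_op r L t s (P s \<phi>))"
      using that
      by (simp add: embed_P sol_op_in_hist_space embed_sol_op P_hist T_diff U_sol)
        (simp add: U_def evolution_cocycle)
  qed
  have "op_norm N r (hist_norm N r) (\<lambda>\<phi>. sol_op r L t s (P s \<phi>))
      \<le> ereal (\<beta> * (D * exp (- \<mu> * (t - s))) / \<alpha>)" if st: "0 \<le> s" "s \<le> t" for s t
  proof (rule op_norm_hist_leI)
    fix \<phi> :: "real \<Rightarrow> real ^ 'n" assume \<phi>: "\<phi> \<in> hist_space r"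
    show "sol_op r L t s (P s \<phi>) = restr (evolution t s (embed \<phi> - U s \<phi>))"
      using st \<phi> by (simp add: sol_op_eq P_hist embed_P)
    show "norm (evolution t s (embed \<phi> - U s \<phi>)) \<le> D * exp (- \<mu> * (t - s)) * norm (embed \<phi>)"
      unfolding U_def by (rule stable[OF st])
  qed (use D in simp)
  moreover have "op_norm N r (hist_norm N r)
      (\<lambda>\<phi>. inv_into (hist_ker r (P t)) (sol_op r L s t) (\<lambda>\<theta>. \<phi> \<theta> - P s \<phi> \<theta>))
      \<le> ereal (\<beta> * (D * exp (- \<mu> * (s - t))) / \<alpha>)" if st: "0 \<le> t" "t \<le> s" for s t
  proof (rule op_norm_hist_leI)
    fix \<phi> :: "real \<Rightarrow> real ^ 'n" assume \<phi>: "\<phi> \<in> hist_space r"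
    define z where "z = lift s (embed \<phi>)"
    have z: "z \<in> Z" unfolding z_def using st by (intro lift_works) auto
    show "inv_into (hist_ker r (P t)) (sol_op r L s t) (\<lambda>\<theta>. \<phi> \<theta> - P s \<phi> \<theta>) = restr (evolution t 0 (lift s (embed \<phi>)))"
    proof (rule inv_into_f_eq)
      show "inj_on (sol_op r L s t) (hist_ker r (P t))"
        using bij[OF st] by (rule bij_betw_imp_inj_on)
      show "restr (evolution t 0 (lift s (embed \<phi>))) \<in> hist_ker r (P t)"
        using z st by (auto simp: ker z_def)
      show "sol_op r L s t (restr (evolution t 0 (lift s (embed \<phi>)))) = (\<lambda>\<theta>. \<phi> \<theta> - P s \<phi> \<theta>)"
        using st by (simp add: sol_restr P_def U_def)
    qed
    show "norm (evolution t 0 (lift s (embed \<phi>))) \<le> D * exp (- \<mu> * (s - t)) * norm (embed \<phi>)"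
      by (rule unstable[OF st])
  qed (use D in simp)
  moreover have "\<beta> * (D * e) / \<alpha> = \<beta> * D / \<alpha> * e" for e by simp
  moreover have "\<beta> * D / \<alpha> > 0" using D \<alpha> \<beta> by simp
  ultimately show ?thesis
    unfolding exponential_dichotomy_def using \<mu> proj comm bij
    by (intro exI[of _ P] exI[of _ "\<beta> * D / \<alpha>"] exI[of _ \<mu>]) simp
qed

text \<open>The Green function of the dichotomy, T(n,k) P(k) for n >= k and - T(n,k) Q(k) for n < k,
  is fed to \<open>green_imp_shadowing\<close>.\<close>

lemma dichotomy_imp_shadowing:
  assumes D: "D > 0" and \<mu>: "\<mu> > 0"
    and proj: "\<And>t. t \<ge> 0 \<Longrightarrow> hist_projection N r (P t)"
    and bij: "\<And>s t. 0 \<le> s \<Longrightarrow> s \<le> t \<Longrightarrow> bij_betw (sol_op r L t s) (hist_ker r (P s)) (hist_ker r (P t))"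
    and stable: "\<And>s t. 0 \<le> s \<Longrightarrow> s \<le> t \<Longrightarrow>
      op_norm N r (hist_norm N r) (\<lambda>\<phi>. sol_op r L t s (P s \<phi>)) \<le> ereal (D * exp (- \<mu> * (t - s)))"
    and unstable: "\<And>s t. 0 \<le> t \<Longrightarrow> t \<le> s \<Longrightarrow>
      op_norm N r (hist_norm N r)
        (\<lambda>\<phi>. inv_into (hist_ker r (P t)) (sol_op r L s t) (\<lambda>\<theta>. \<phi> \<theta> - P s \<phi> \<theta>))
      \<le> ereal (D * exp (- \<mu> * (s - t)))"
  shows "\<exists>K. shadowing K"
proof -
  have P_hist: "P t \<phi> \<in> hist_space r" and P_idem: "P t (P t \<phi>) = P t \<phi>"
    and P_scaleR: "P t (\<lambda>\<theta>. c *\<^sub>R \<phi> \<theta>) = (\<lambda>\<theta>. c *\<^sub>R P t \<phi> \<theta>)"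
    if "t \<ge> 0" "\<phi> \<in> hist_space r" for t \<phi> c
    using proj[OF that(1)] that(2) unfolding hist_projection_def bounded_linear_to_hist_def by auto
  have P_add: "P t (\<lambda>\<theta>. \<phi> \<theta> + \<psi> \<theta>) = (\<lambda>\<theta>. P t \<phi> \<theta> + P t \<psi> \<theta>)"
    if "t \<ge> 0" "\<phi> \<in> hist_space r" "\<psi> \<in> hist_space r" for t \<phi> \<psi>
    using proj[OF that(1)] that(2,3) unfolding hist_projection_def bounded_linear_to_hist_def by auto
  define Q where "Q t \<phi> = (\<lambda>\<theta>. \<phi> \<theta> - P t \<phi> \<theta>)" for t \<phi>
  have Q_hist: "Q t \<phi> \<in> hist_space r" if "t \<ge> 0" "\<phi> \<in> hist_space r" for t \<phi>
    unfolding Q_def by (rule hist_space_diff[OF that(2) P_hist[OF that]])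
  have Q_ker: "Q t \<phi> \<in> hist_ker r (P t)" if "t \<ge> 0" "\<phi> \<in> hist_space r" for t \<phi>
  proof -
    have "P t (\<lambda>\<theta>. \<phi> \<theta> + (-1) *\<^sub>R P t \<phi> \<theta>) = (\<lambda>\<theta>. P t \<phi> \<theta> + (-1) *\<^sub>R P t \<phi> \<theta>)"
      using P_add[OF that hist_space_scaleR[OF P_hist[OF that], of "-1"]]
        P_scaleR[OF that(1) P_hist[OF that], of "-1"] P_idem[OF that] by simp
    then show ?thesis using Q_hist[OF that] by (simp add: Q_def hist_ker_def)
  qed
  \<comment> \<open>The backward operator T(t,s) Q(s) for t <= s.\<close>
  define W where "W t s \<phi> = inv_into (hist_ker r (P t)) (sol_op r L s t) (Q s \<phi>)" for t s \<phi>
  have W: "W t s \<phi> \<in> hist_ker r (P t)" "sol_op r L s t (W t s \<phi>) = Q s \<phi>"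
    if "0 \<le> t" "t \<le> s" "\<phi> \<in> hist_space r" for t s \<phi>
  proof -
    have "Q s \<phi> \<in> sol_op r L s t ` hist_ker r (P t)"
      using bij[OF that(1,2)] Q_ker[of s \<phi>] that by (simp add: bij_betw_def)
    then show "W t s \<phi> \<in> hist_ker r (P t)" "sol_op r L s t (W t s \<phi>) = Q s \<phi>"
      unfolding W_def by (rule inv_into_into, rule f_inv_into_f)
  qed
  have W_hist: "W t s \<phi> \<in> hist_space r" if "0 \<le> t" "t \<le> s" "\<phi> \<in> hist_space r" for t s \<phi>
    using W(1)[OF that] by (simp add: hist_ker_def)
  have W_step: "sol_op r L u t (W t s \<phi>) = W u s \<phi>"
    \<comment> \<open>Both sides lie in the kernel at time u and are carried to Q(s) \<phi> at time
      s, where injectivity on that kernel identifies them.\<close>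
    if "0 \<le> t" "t \<le> u" "u \<le> s" "\<phi> \<in> hist_space r" for t u s \<phi>
  proof -
    have "0 \<le> u" "t \<le> s" using that by auto
    note Wt = W[OF that(1) this(2) that(4)] W_hist[OF that(1) this(2) that(4)]
    have "sol_op r L u t (W t s \<phi>) \<in> hist_ker r (P u)"
      using bij[OF that(1,2)] Wt(1) by (auto simp: bij_betw_def)
    moreover have "sol_op r L s u (sol_op r L u t (W t s \<phi>)) = Q s \<phi>"
      using that Wt by (simp add: sol_op_cocycle)
    ultimately show ?thesis
      unfolding W_def[of u] using bij[OF \<open>0 \<le> u\<close> that(3)]
      by (intro inv_into_f_eq[symmetric]) (auto dest: bij_betw_imp_inj_on)
  qed
  define g where "g k f n = (if k \<le> n then embed (sol_op r L (real n) (real k) (P (real k) (restr f)))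
      else - embed (W (real n) (real k) (restr f)))" for k n :: nat and f
  have rf: "restr f \<in> hist_space r" for f by (rule restr_in_hist_space)
  \<comment> \<open>With c = 1 / \<beta> the restricted impulse has \<open>hist_norm\<close> at most
    1, so the operator norm estimates apply without rescaling; 1 / \<alpha> converts the result
    back.\<close>
  show ?thesis
  proof (rule green_imp_shadowing[of "exp (- \<mu>)" "1 / \<beta>" "D / \<alpha>" g])
    fix k n :: nat and f :: "real \<Rightarrow>\<^sub>C (real ^ 'n)"
    assume k: "k > 0" and f: "norm f \<le> 1 / \<beta>" "embed (apply_bcontfun f) = f"
    have f_embed: "embed (restr f) = f" using f(2) by (simp add: embed_restr)
    have unit: "hist_norm N r (restr f) \<le> 1"
    proof -
      have "\<beta> * norm f \<le> 1" using f(1) \<beta> by (simp add: field_simps)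
      then show ?thesis using hist_norm_restr_le[of f] by linarith
    qed
    show "g k f (Suc n) = evolution (real (Suc n)) (real n) (g k f n) + (if k = Suc n then f else 0)"
    proof -
      interpret evolution_family evolution 1 "3 * exp (growth_rate * 1)"
        by (rule evolution_evolution_family) simp
      consider "k \<le> n" | "k = Suc n" | "k > Suc n" by linarith
      then show ?thesis
      proof cases
        case 1
        then have "g k f (Suc n) = embed (sol_op r L (real (Suc n)) (real n) (sol_op r L (real n) (real k) (P (real k) (restr f))))"
          by (simp add: g_def sol_op_cocycle P_hist rf)
        also have "\<dots> = evolution (real (Suc n)) (real n) (g k f n)"
          using 1 by (subst embed_sol_op) (auto simp: g_def intro!: sol_op_in_hist_space P_hist rf)
        finally show ?thesis using 1 by simp
      next
        \<comment> \<open>Across time k the Green function jumps from -Q(k) f to P(k) f, and P(k) +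
          Q(k) = Id makes the jump equal to f.\<close>
        case 2
        have "g k f (Suc n) = embed (P (real k) (restr f))"
          using 2 by (simp add: g_def sol_op_self P_hist rf)
        moreover have "evolution (real (Suc n)) (real n) (g k f n) = - embed (Q (real k) (restr f))"
        proof -
          have "evolution (real (Suc n)) (real n) (g k f n)
              = - evolution (real (Suc n)) (real n) (embed (W (real n) (real k) (restr f)))"
            using 2 by (simp add: g_def T_minus)
          also have "\<dots> = - embed (sol_op r L (real k) (real n) (W (real n) (real k) (restr f)))"
            using 2 by (subst embed_sol_op) (auto intro!: W_hist rf)
          finally show ?thesis using 2 W(2)[of "real n" "real k" "restr f"] rf by simp
        qed
        moreover have "embed (Q (real k) (restr f)) = f - embed (P (real k) (restr f))"
          unfolding Q_def by (simp add: embed_diff P_hist rf f_embed)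
        ultimately show ?thesis using 2 by simp
      next
        case 3
        then have "evolution (real (Suc n)) (real n) (g k f n)
            = - evolution (real (Suc n)) (real n) (embed (W (real n) (real k) (restr f)))"
          by (simp add: g_def T_minus)
        also have "\<dots> = - embed (sol_op r L (real (Suc n)) (real n) (W (real n) (real k) (restr f)))"
          using 3 by (subst embed_sol_op) (auto intro!: W_hist rf)
        also have "\<dots> = - embed (W (real (Suc n)) (real k) (restr f))"
          using 3 by (subst W_step) (auto intro!: rf)
        finally show ?thesis using 3 by (simp add: g_def)
      qed
    qed
    have exp_pow: "exp (- \<mu>) ^ m = exp (- \<mu> * real m)" for m :: nat
      by (simp add: exp_of_nat2_mult[symmetric])
    show "norm (g k f n) \<le> D / \<alpha> * exp (- \<mu>) ^ ((n - k) + (k - n))"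
    proof (cases "k \<le> n")
      case True
      define \<psi> where "\<psi> = sol_op r L (real n) (real k) (P (real k) (restr f))"
      have "hist_norm N r \<psi> \<le> D * exp (- \<mu> * (real n - real k))"
        unfolding \<psi>_def using True by (intro op_norm_leD[OF stable rf unit]) auto
      moreover have "\<psi> \<in> hist_space r"
        unfolding \<psi>_def using True by (intro sol_op_in_hist_space P_hist rf) auto
      ultimately have "\<alpha> * norm (embed \<psi>) \<le> D * exp (- \<mu> * (real n - real k))"
        using hist_norm_bounds(1) by (meson order_trans)
      then have "norm (embed \<psi>) \<le> D / \<alpha> * exp (- \<mu> * (real n - real k))"
        using \<alpha> by (simp add: field_simps)
      then show ?thesis using True unfolding exp_pow by (simp add: g_def \<psi>_def of_nat_diff)
    next
      case False
      define \<psi> where "\<psi> = W (real n) (real k) (restr f)"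
      have "hist_norm N r \<psi> \<le> D * exp (- \<mu> * (real k - real n))"
        unfolding \<psi>_def W_def Q_def using False by (intro op_norm_leD[OF unstable rf unit]) auto
      moreover have "\<psi> \<in> hist_space r"
        unfolding \<psi>_def using False by (intro W_hist rf) auto
      ultimately have "\<alpha> * norm (embed \<psi>) \<le> D * exp (- \<mu> * (real k - real n))"
        using hist_norm_bounds(1) by (meson order_trans)
      then have "norm (embed \<psi>) \<le> D / \<alpha> * exp (- \<mu> * (real k - real n))"
        using \<alpha> by (simp add: field_simps)
      then show ?thesis using False unfolding exp_pow by (simp add: g_def \<psi>_def of_nat_diff)
    qed
  qed (use D \<mu> \<alpha> \<beta> in auto)
qed

lemma exponential_dichotomy_imp_shadowing:
  assumes "exponential_dichotomy N r L"
  shows "\<exists>K. shadowing K"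
  using assms unfolding exponential_dichotomy_def
proof (elim exE conjE, goal_cases)
  case (1 P D \<mu>)
  then show ?case by (intro dichotomy_imp_shadowing[of D \<mu> P]) auto
qed

lemma equivalences:
  "(hyers_ulam_stable N r L \<longleftrightarrow> shadowable N r L) \<and> (shadowable N r L \<longleftrightarrow> exponential_dichotomy N r L)"
proof -
  have "exponential_dichotomy N r L" if "shadowing K" for K
    using shadowing_imp_splitting[OF that] splitting_imp_exponential_dichotomy by metis
  then show ?thesis
    using shadowing_imp_hyers_ulam hyers_ulam_imp_shadowable shadowable_imp_shadowing
      exponential_dichotomy_imp_shadowing by blast
qed

end

theorem theorem3:
  fixes N :: "real ^ 'n \<Rightarrow> real"
    and r :: real
    and L :: "real \<Rightarrow> (real \<Rightarrow> real ^ 'n) \<Rightarrow> real ^ 'n"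
  assumes "is_norm N"
    and "r \<ge> 0"
    and "\<And>t. t \<ge> 0 \<Longrightarrow> bounded_linear_to_vec N r (L t)"
    and "continuous_in_op_norm N r L"
    and "(SUP t\<in>{0..}. op_norm N r N (L t)) < \<infinity>"
  shows "(hyers_ulam_stable N r L \<longleftrightarrow> shadowable N r L) \<and>
         (shadowable N r L \<longleftrightarrow> exponential_dichotomy N r L)"
proof -
  obtain \<alpha> \<beta> where \<alpha>\<beta>: "\<alpha> > 0" "\<beta> > 0" "\<And>v. \<alpha> * norm v \<le> N v" "\<And>v. N v \<le> \<beta> * norm v"
    using is_norm_equivalent[OF assms(1)] by blast
  obtain M where M: "(SUP t\<in>{0..}. op_norm N r N (L t)) \<le> ereal M"
    using assms(5) by (cases "SUP t\<in>{0..}. op_norm N r N (L t)") auto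
  have "op_norm N r N (L t) \<le> ereal M" if "t \<ge> 0" for t
    using M that by (simp add: SUP_le_iff)
  then interpret normed_delay_equation N r L \<alpha> \<beta> M
    using assms(1-4) \<alpha>\<beta> by unfold_locales auto
  show ?thesis by (rule equivalences)
qed

end
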